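(* Let $X$ and $Y$ be separable Hilbert spaces, let $Q$ be an injective, self-adjoint, positive, trace class operator on $Y$ with eigensystem $(\lambda_k, e_k)_{k\in\mathbb{N}}$, let $y \in Y$, and let $F: X \to Y$ satisfy one of the following three conditions: (A) there exists $C > 0$ such that $\sum_{k=1}^\infty \lambda_k^{-1/2}|(F(x_1) - F(x_2), e_k)_Y| \le C\|x_1 - x_2\|_X$ for all $x_1, x_2 \in X$; (B) $F$ is Fréchet differentiable and there exists $C > 0$ such that $\sum_{k=1}^\infty \lambda_k^{-1/2}\|F'(x)^* e_k\|_X \le C$ for all $x \in X$; (C) $F = K$ is a compact linear operator such that $KK^*$ is diagonalizable with respect to the eigenvectors $(e_k)_{k\in\mathbb{N}}$ of $Q$ and $Q^{-1/2}K$ is a Hilbert--Schmidt operator (in particular $\operatorname{ran}(K) \subseteq \operatorname{ran}(Q^{1/2})$). Suppose that the series $$\Phi(u,y) = \sqrt{2}\sum_{k=1}^\infty \frac{|(y - F(u), e_k)_Y| - |(y,e_k)_Y|}{\lambda_k^{1/2}}$$ converges for every $u \in X$, so that $\Phi(\cdot,y): X \to \mathbb{R}$ is well defined. Let $\mu_0 = \mathcal{N}_\Sigma$ be a nondegenerate centered Gaussian measure on $X$ with (injective) covariance operator $\Sigma$, and let $\mu^y$ be a Borel probability measure on $X$ which is absolutely continuous with respect to $\mu_0$ with density $\frac{\mathrm{d}\mu^y}{\mathrm{d}\mu_0}(u) = \frac{1}{Z}\exp(-\Phi(u,y))$ for some $Z > 0$. Then the (strong) modes of $\mu^y$ are precisely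 the minimizers of $I: \operatorname{ran}(\Sigma^{1/2}) \to \mathbb{R}$, $$I(u) = \sqrt{2}\sum_{k=1}^\infty \frac{|(y - F(u), e_k)_Y| - |(y,e_k)_Y|}{\lambda_k^{1/2}} + \frac12\|\Sigma^{-1/2}u\|_X^2 .$$
   Context: $\operatorname{ran}$ denotes the range of a mapping. $B_\varepsilon(x)$ denotes the open ball of radius $\varepsilon$ centred at $x$. An eigensystem $(\lambda_k,e_k)_{k\in\mathbb{N}}$ of $Q$ consists of an orthonormal basis $(e_k)_{k\in\mathbb{N}}$ of $Y$ with $Qe_k = \lambda_k e_k$, $\lambda_k > 0$. Mode (strong mode): $\hat{x} \in X$ is a mode of a Borel probability measure $\mu$ on $X$ if $\lim_{\varepsilon \to 0} \frac{\mu(B_\varepsilon(\hat{x}))}{\sup_{x \in X}\mu(B_\varepsilon(x))} = 1$. *)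

theory Defs
  imports "HOL-Probability.Probability"
begin

text \<open>
  Real Hilbert spaces are types of sorts \<open>real_inner\<close> and \<open>complete_space\<close>; for metric spaces,
  separability is \<open>second_countable_topology\<close>. Operators are plain functions. In a possibly
  finite-dimensional space an orthonormal basis is a set of vectors, so that no index type has
  to be chosen.
\<close>

definition orthonormal_basis :: "'a::real_inner set \<Rightarrow> bool" where
  "orthonormal_basis E \<longleftrightarrow>
     pairwise orthogonal E \<and> (\<forall>x\<in>E. norm x = 1) \<and> closure (span E) = UNIV"

definition self_adjoint :: "('a::real_inner \<Rightarrow> 'a) \<Rightarrow> bool" where
  "self_adjoint T \<longleftrightarrow> bounded_linear T \<and> (\<forall>x y. T x \<bullet> y = x \<bullet> T y)"

definition positive_op :: "('a::real_inner \<Rightarrow> 'a) \<Rightarrow> bool" where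
  "positive_op T \<longleftrightarrow> (\<forall>x. 0 \<le> T x \<bullet> x)"

text \<open>On a Hilbert space a positive self-adjoint operator has exactly one positive self-adjoint
  square root; for other operators the value is unspecified.\<close>

definition op_sqrt :: "('a::real_inner \<Rightarrow> 'a) \<Rightarrow> 'a \<Rightarrow> 'a" where
  "op_sqrt T = (SOME R. self_adjoint R \<and> positive_op R \<and> R \<circ> R = T)"

text \<open>The sums defining the trace norm and the Hilbert--Schmidt norm do not depend on the choice
  of the orthonormal basis. The operator \<open>op_sqrt (adjoint T \<circ> T)\<close> is the absolute value of \<open>T\<close>.\<close>

definition trace_class :: "('a::real_inner \<Rightarrow> 'a) \<Rightarrow> bool" where
  "trace_class T \<longleftrightarrow> bounded_linear T \<and>
     (\<exists>E. orthonormal_basis E \<and> (\<lambda>x. op_sqrt (adjoint T \<circ> T) x \<bullet> x) summable_on E)"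

definition hilbert_schmidt :: "('a::real_inner \<Rightarrow> 'b::real_inner) \<Rightarrow> bool" where
  "hilbert_schmidt T \<longleftrightarrow> bounded_linear T \<and>
     (\<exists>E. orthonormal_basis E \<and> (\<lambda>x. (norm (T x))\<^sup>2) summable_on E)"

definition compact_operator :: "('a::real_normed_vector \<Rightarrow> 'b::real_normed_vector) \<Rightarrow> bool" where
  "compact_operator T \<longleftrightarrow> linear T \<and> (\<forall>B. bounded B \<longrightarrow> compact (closure (T ` B)))"

text \<open>Sequences are indexed from 0, and the injective enumeration of the basis makes the space
  infinite-dimensional.\<close>

definition eigensystem :: "('a::real_inner \<Rightarrow> 'a) \<Rightarrow> (nat \<Rightarrow> real) \<Rightarrow> (nat \<Rightarrow> 'a) \<Rightarrow> bool" where
  "eigensystem Q lam e \<longleftrightarrow>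
     inj e \<and> orthonormal_basis (range e) \<and> (\<forall>k. Q (e k) = lam k *\<^sub>R e k \<and> lam k > 0)"

definition condition_A ::
  "(nat \<Rightarrow> real) \<Rightarrow> (nat \<Rightarrow> 'b::real_inner) \<Rightarrow> ('a::real_inner \<Rightarrow> 'b) \<Rightarrow> bool" where
  "condition_A lam e F \<longleftrightarrow>
     (\<exists>C>0. \<forall>x1 x2.
        summable (\<lambda>k. \<bar>(F x1 - F x2) \<bullet> e k\<bar> / sqrt (lam k)) \<and>
        (\<Sum>k. \<bar>(F x1 - F x2) \<bullet> e k\<bar> / sqrt (lam k)) \<le> C * norm (x1 - x2))"

definition condition_B ::
  "(nat \<Rightarrow> real) \<Rightarrow> (nat \<Rightarrow> 'b::real_inner) \<Rightarrow> ('a::real_inner \<Rightarrow> 'b) \<Rightarrow> bool" where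
  "condition_B lam e F \<longleftrightarrow>
     (\<forall>x. F differentiable (at x)) \<and>
     (\<exists>C>0. \<forall>x.
        summable (\<lambda>k. norm (adjoint (frechet_derivative F (at x)) (e k)) / sqrt (lam k)) \<and>
        (\<Sum>k. norm (adjoint (frechet_derivative F (at x)) (e k)) / sqrt (lam k)) \<le> C)"

text \<open>For injective \<open>Q\<close> the range inclusion makes \<open>inv (op_sqrt Q) \<circ> K\<close> the operator
  $Q^{-1/2}K$; without it \<open>inv\<close> would take arbitrary values.\<close>

definition condition_C ::
  "('b::real_inner \<Rightarrow> 'b) \<Rightarrow> (nat \<Rightarrow> 'b) \<Rightarrow> ('a::real_inner \<Rightarrow> 'b) \<Rightarrow> bool" where
  "condition_C Q e K \<longleftrightarrow>
     compact_operator K \<and>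
     (\<forall>k. \<exists>c. K (adjoint K (e k)) = c *\<^sub>R e k) \<and>
     range K \<subseteq> range (op_sqrt Q) \<and>
     hilbert_schmidt (inv (op_sqrt Q) \<circ> K)"

definition potential_term ::
  "(nat \<Rightarrow> real) \<Rightarrow> (nat \<Rightarrow> 'b::real_inner) \<Rightarrow> ('a \<Rightarrow> 'b) \<Rightarrow> 'b \<Rightarrow> 'a \<Rightarrow> nat \<Rightarrow> real" where
  "potential_term lam e F y u k = (\<bar>(y - F u) \<bullet> e k\<bar> - \<bar>y \<bullet> e k\<bar>) / sqrt (lam k)"

definition potential ::
  "(nat \<Rightarrow> real) \<Rightarrow> (nat \<Rightarrow> 'b::real_inner) \<Rightarrow> ('a \<Rightarrow> 'b) \<Rightarrow> 'b \<Rightarrow> 'a \<Rightarrow> real" where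
  "potential lam e F y u = sqrt 2 * (\<Sum>k. potential_term lam e F y u k)"

text \<open>Only meaningful for \<open>u \<in> range (op_sqrt S)\<close> with \<open>S\<close> injective.\<close>

definition objective ::
  "(nat \<Rightarrow> real) \<Rightarrow> (nat \<Rightarrow> 'b::real_inner) \<Rightarrow> ('a::real_inner \<Rightarrow> 'b) \<Rightarrow> 'b \<Rightarrow> ('a \<Rightarrow> 'a)
     \<Rightarrow> 'a \<Rightarrow> real" where
  "objective lam e F y S u =
     sqrt 2 * (\<Sum>k. potential_term lam e F y u k) + 1 / 2 * (norm (inv (op_sqrt S) u))\<^sup>2"

definition real_gaussian :: "real measure \<Rightarrow> bool" where
  "real_gaussian N \<longleftrightarrow>
     (\<exists>m s. s > 0 \<and> N = density lborel (normal_density m s)) \<or> (\<exists>m. N = return borel m)"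

definition gaussian_measure :: "'a::real_inner measure \<Rightarrow> bool" where
  "gaussian_measure M \<longleftrightarrow>
     prob_space M \<and> sets M = sets borel \<and> (\<forall>h. real_gaussian (distr M borel (\<lambda>x. x \<bullet> h)))"

text \<open>For a Gaussian measure all the integrals below exist, the one-dimensional marginals having
  moments of every order.\<close>

definition centered :: "'a::real_inner measure \<Rightarrow> bool" where
  "centered M \<longleftrightarrow> (\<forall>h. (LINT x|M. x \<bullet> h) = 0)"

definition covariance_operator :: "'a::real_inner measure \<Rightarrow> ('a \<Rightarrow> 'a) \<Rightarrow> bool" where
  "covariance_operator M S \<longleftrightarrow> bounded_linear S \<and>
     (\<forall>g h. S g \<bullet> h =
        (LINT x|M. (x \<bullet> g - (LINT z|M. z \<bullet> g)) * (x \<bullet> h - (LINT z|M. z \<bullet> h))))"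

definition strong_mode :: "'a::real_normed_vector measure \<Rightarrow> 'a \<Rightarrow> bool" where
  "strong_mode M x \<longleftrightarrow>
     ((\<lambda>\<epsilon>. measure M (ball x \<epsilon>) / (SUP z. measure M (ball z \<epsilon>))) \<longlongrightarrow> 1) (at_right 0)"

end

theory Submission
  imports Defs
begin

text \<open>
  Each of the conditions (A), (B), (C) makes \<open>\<Phi>\<close> globally Lipschitz, with constant \<open>L\<close> say. Write
  \<open>R = \<Sigma>\<^sup>1\<^sup>/\<^sup>2\<close> and let \<open>B z r\<close> be the ball of radius \<open>r\<close> around \<open>z\<close>. The small ball probabilities of
  \<open>\<mu>\<^sub>0\<close> are controlled uniformly in the centre, without any compactness:

  \<^item> \<open>\<mu>\<^sub>0 (B (R k) r) \<ge> exp (- \<bar>k\<bar>\<^sup>2 / 2) * \<mu>\<^sub>0 (B 0 r)\<close>, by the Cameron--Martin formula for shifts in the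
    range of \<open>\<Sigma>\<close>, the symmetry of \<open>\<mu>\<^sub>0\<close>, and density of the range of \<open>R\<close>;
  \<^item> for every \<open>z\<close> there is \<open>k\<close> with \<open>\<bar>z - R k\<bar> \<le> r\<close> and
    \<open>\<mu>\<^sub>0 (B z r) \<le> exp (- \<bar>k\<bar>\<^sup>2 / 2) * \<mu>\<^sub>0 (B 0 r)\<close>. Here \<open>k\<close> has minimal norm among all admissible
    vectors; its Lagrange condition puts \<open>R k\<close> in the range of \<open>\<Sigma>\<close> and gives the Cameron--Martin
    exponent the right sign on the ball, and the remaining shift is removed by Anderson's inequality.

  Hence \<open>sup\<^sub>z \<mu>\<^sup>y (B z r)\<close> equals \<open>exp (- inf I) * \<mu>\<^sub>0 (B 0 r) / Z\<close> up to a factor in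
  \<open>[exp (- L r), exp (2 L r)]\<close>. So minimizers are modes, and at a mode \<open>u\<close> the vectors \<open>k\<close> belonging to
  \<open>r \<rightarrow> 0\<close> are norm bounded with \<open>R k \<rightarrow> u\<close>, which by weak compactness, in the form of the intersection of
  nested convex sets, yields \<open>u = R k\<close> with \<open>I u = inf I\<close>.

  Independence, which underlies both the Cameron--Martin formula and Anderson's inequality, comes from
  the uniqueness of a measure with given characteristic functional. Anderson's inequality for balls is
  reduced to one-dimensional shifts, along an orthonormal basis diagonalizing the covariance form on a
  finite-dimensional subspace.
\<close>

section \<open>Convex sets and operators on Hilbert spaces\<close>

text \<open>A substitute for weak compactness. Almost norm-minimal points \<open>k n\<close> of
  \<open>C n\<close> form a Cauchy sequence: the minimal norms \<open>d n\<close> increase to a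
  finite limit \<open>L\<close>, and the midpoint of \<open>k n\<close> and any later
  \<open>k m\<close> stays in \<open>C n\<close>, so the parallelogram law forces the two points
  together.\<close>

lemma nested_convex_inter_nonempty:
  fixes C :: "nat \<Rightarrow> 'a::{real_inner, complete_space} set"
  assumes closed: "\<And>n. closed (C n)" and conv: "\<And>n. convex (C n)"
    and dec: "\<And>m n. m \<le> n \<Longrightarrow> C n \<subseteq> C m"
    and ne: "\<And>n. C n \<inter> cball 0 r \<noteq> {}"
  shows "\<exists>x. \<forall>n. x \<in> C n"
proof -
  define d where "d n = (INF x\<in>C n. norm x)" for n
  have bdd: "bdd_below (norm ` C n)" for n by (auto intro!: bdd_belowI[of _ 0])
  have ne': "C n \<noteq> {}" for n using ne by auto
  have d_le: "d n \<le> norm x" if "x \<in> C n" for n x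
    unfolding d_def using bdd that by (rule cINF_lower)
  have d_nonneg: "0 \<le> d n" for n unfolding d_def using ne' by (intro cINF_greatest) auto
  have d_mono: "d m \<le> d n" if "m \<le> n" for m n
    unfolding d_def using ne' bdd dec[OF that] by (intro cINF_superset_mono) auto
  have d_r: "d n \<le> r" for n
  proof -
    obtain x where "x \<in> C n" "norm x \<le> r" using ne[of n] by auto
    then show ?thesis using d_le by force
  qed
  have "\<exists>x\<in>C n. norm x < d n + 1 / Suc n" for n
    using cINF_less_iff[OF ne' bdd, of n "d n + 1 / Suc n"] unfolding d_def by simp
  then obtain k where k: "\<And>n. k n \<in> C n" "\<And>n. norm (k n) < d n + 1 / Suc n" by metis
  define L where "L = (SUP n. d n)"
  have bdd2: "bdd_above (range d)" using d_r by (auto intro!: bdd_aboveI)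
  have d_L: "d n \<le> L" for n unfolding L_def by (intro cSUP_upper bdd2) auto
  have d_lim: "d \<longlonglongrightarrow> L" unfolding L_def
    by (rule LIMSEQ_incseq_SUP[OF bdd2]) (auto simp: incseq_def d_mono)
  \<comment> \<open>In the parallelogram law, \<open>L + 1 / Suc n\<close> bounds the norms of
    \<open>k n\<close> and of every later \<open>k m\<close>, while \<open>d n\<close> bounds the
    norm of their midpoint from below.\<close>
  define b where "b n = 4 * (L + 1 / Suc n)\<^sup>2 - 4 * (d n)\<^sup>2" for n
  have key: "(dist (k m) (k n))\<^sup>2 \<le> b n" if "n \<le> m" for m n
  proof -
    define p where "p = (1/2) *\<^sub>R k n + (1/2) *\<^sub>R k m"
    have kn: "k m \<in> C n" using dec[OF that] k by auto
    have "p \<in> C n" unfolding p_def using conv k(1) kn by (intro convexD) auto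
    then have "d n \<le> norm p" by (rule d_le)
    then have 1: "(d n)\<^sup>2 \<le> (norm p)\<^sup>2" using d_nonneg by (intro power_mono)
    have par: "(dist (k m) (k n))\<^sup>2 = 2 * (norm (k n))\<^sup>2 + 2 * (norm (k m))\<^sup>2 - 4 * (norm p)\<^sup>2"
      unfolding p_def dist_norm power2_norm_eq_inner by (simp add: inner_simps inner_commute)
    have "1 / Suc m \<le> 1 / Suc n" using that by (simp add: field_simps)
    then have "norm (k m) \<le> L + 1 / Suc n" "norm (k n) \<le> L + 1 / Suc n"
      using k(2)[of m] k(2)[of n] d_L[of m] d_L[of n] by linarith+
    then have "(norm (k m))\<^sup>2 \<le> (L + 1 / Suc n)\<^sup>2" "(norm (k n))\<^sup>2 \<le> (L + 1 / Suc n)\<^sup>2"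
      by (auto intro: power_mono)
    with par 1 show ?thesis unfolding b_def by linarith
  qed
  have "(\<lambda>n. 4 * (L + 1 / Suc n)\<^sup>2 - 4 * (d n)\<^sup>2) \<longlonglongrightarrow> 4 * (L + 0)\<^sup>2 - 4 * L\<^sup>2"
    by (intro tendsto_intros d_lim LIMSEQ_Suc[OF lim_1_over_n])
  then have b0: "b \<longlonglongrightarrow> 0" unfolding b_def by simp
  have "Cauchy k"
    unfolding Cauchy_altdef2
  proof (intro allI impI)
    fix e :: real assume "e > 0"
    then have "eventually (\<lambda>n. b n < e\<^sup>2) sequentially"
      using b0 by (auto intro!: order_tendstoD)
    then obtain N where N: "b N < e\<^sup>2" by (auto simp: eventually_sequentially)
    have "dist (k n) (k N) < e" if "n \<ge> N" for n
      using key[OF that] N \<open>e > 0\<close> by (intro power2_less_imp_less[of _ e]) auto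
    then show "\<exists>N. \<forall>n\<ge>N. dist (k n) (k N) < e" by blast
  qed
  then obtain x where x: "k \<longlonglongrightarrow> x" using Cauchy_convergent convergent_def by blast
  have "x \<in> C n" for n
  proof (rule Lim_in_closed_set[OF closed _ _ x])
    show "eventually (\<lambda>m. k m \<in> C n) sequentially"
      using k(1) dec by (auto simp: eventually_sequentially intro!: exI[of _ n])
  qed auto
  then show ?thesis by blast
qed

text \<open>The slices of \<open>C\<close> by balls of radius slightly above the infimum
  \<open>d\<close> of the norms are nested, and a common point of them has norm at most
  \<open>d\<close>.\<close>

lemma closed_convex_min_norm:
  fixes C :: "'a::{real_inner, complete_space} set"
  assumes "closed C" "convex C" "C \<noteq> {}"
  obtains k where "k \<in> C" "\<And>x. x \<in> C \<Longrightarrow> norm k \<le> norm x"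
proof -
  define d where "d = (INF x\<in>C. norm x)"
  have bdd: "bdd_below (norm ` C)" by (auto intro!: bdd_belowI[of _ 0])
  define D where "D n = C \<inter> cball 0 (d + 1 / Suc n)" for n
  have "\<exists>x. \<forall>n. x \<in> D n"
  proof (rule nested_convex_inter_nonempty)
    show "closed (D n)" "convex (D n)" for n using assms by (auto simp: D_def convex_Int)
    show "D n \<subseteq> D m" if "m \<le> n" for m n
    proof -
      have "1 / Suc n \<le> 1 / Suc m" using that by (simp add: field_simps)
      then show ?thesis unfolding D_def by (intro Int_mono cball_subset_cball_iff[THEN iffD2]) auto
    qed
    show "D n \<inter> cball 0 (d + 1) \<noteq> {}" for n
    proof -
      have "\<exists>x\<in>C. norm x < d + 1 / Suc n"
        using cINF_less_iff[OF assms(3) bdd, of "d + 1 / Suc n"] unfolding d_def by simp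
      then obtain x where x: "x \<in> C" "norm x < d + 1 / Suc n" ..
      have "1 / real (Suc n) \<le> 1" by simp
      with x have "x \<in> D n \<inter> cball 0 (d + 1)" unfolding D_def mem_cball_0 Int_iff
        by (smt (verit) mem_cball_0)
      then show ?thesis by blast
    qed
  qed
  then obtain k where k: "\<And>n. k \<in> D n" by blast
  have "norm k \<le> d"
  proof (rule field_le_epsilon)
    fix e :: real assume "e > 0"
    then obtain n where "1 / Suc n < e" using nat_approx_posE by blast
    then show "norm k \<le> d + e" using k[of n] by (auto simp: D_def)
  qed
  moreover have "d \<le> norm x" if "x \<in> C" for x unfolding d_def using bdd that by (rule cINF_lower)
  ultimately show ?thesis using k that by (force simp: D_def)
qed

section \<open>Riesz representation and adjoints\<close>

text \<open>The point \<open>k\<close> of least norm on the hyperplane \<open>f x = 1\<close> is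
  orthogonal to the kernel of \<open>f\<close>; dividing it by \<open>k \<bullet> k\<close> gives
  the representing vector.\<close>

lemma riesz_representation:
  fixes f :: "'a::{real_inner, complete_space} \<Rightarrow> real"
  assumes "bounded_linear f"
  shows "\<exists>w. \<forall>x. f x = x \<bullet> w"
proof (cases "\<exists>x. f x \<noteq> 0")
  case False then show ?thesis by (auto intro!: exI[of _ 0])
next
  case True
  interpret bounded_linear f by fact
  define C where "C = {x. f x = 1}"
  obtain x0 where "f x0 \<noteq> 0" using True by blast
  then have ne: "C \<noteq> {}" by (auto simp: C_def scaleR intro!: exI[of _ "(1 / f x0) *\<^sub>R x0"])
  have cl: "closed C" unfolding C_def by (intro closed_Collect_eq continuous_intros continuous_on)
  have cv: "convex C" by (auto simp: C_def convex_def add scaleR)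
  obtain k where k: "k \<in> C" and min: "\<And>x. x \<in> C \<Longrightarrow> norm k \<le> norm x"
    using closed_convex_min_norm[OF cl cv ne] by blast
  have orth: "v \<bullet> k = 0" if "f v = 0" for v
  proof (cases "v = 0")
    case False
    \<comment> \<open>This \<open>t\<close> minimizes the squared norm of
      \<open>k + t *\<^sub>R v\<close> over the whole line in direction \<open>v\<close>.\<close>
    define t where "t = - (v \<bullet> k) / (v \<bullet> v)"
    have "k + t *\<^sub>R v \<in> C" using k that by (auto simp: C_def add scaleR)
    then have "norm k \<le> norm (k + t *\<^sub>R v)" by (rule min)
    then have "k \<bullet> k \<le> (k + t *\<^sub>R v) \<bullet> (k + t *\<^sub>R v)" by (simp add: norm_le)
    also have "\<dots> = k \<bullet> k - (v \<bullet> k)\<^sup>2 / (v \<bullet> v)"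
      using False by (simp add: t_def inner_simps inner_commute power2_eq_square field_simps)
    finally have "(v \<bullet> k)\<^sup>2 / (v \<bullet> v) \<le> 0" by simp
    moreover have "v \<bullet> v > 0" using False by simp
    ultimately have "(v \<bullet> k)\<^sup>2 \<le> 0" by (simp add: divide_le_0_iff)
    then show ?thesis by simp
  qed auto
  have kk: "k \<bullet> k \<noteq> 0" using k by (auto simp: C_def zero)
  have "f x = x \<bullet> ((1 / (k \<bullet> k)) *\<^sub>R k)" for x
  proof -
    have "(x - f x *\<^sub>R k) \<bullet> k = 0" using k by (intro orth) (auto simp: C_def diff scaleR)
    then show ?thesis using kk by (simp add: inner_simps field_simps)
  qed
  then show ?thesis by blast
qed

text \<open>\<open>adjoint\<close> is a choice operator, so its defining identity requires that some
  adjoint exists; Riesz representation supplies the value at each \<open>y\<close>.\<close>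

lemma adjoint_inner:
  fixes T :: "'a::{real_inner, complete_space} \<Rightarrow> 'b::real_inner"
  assumes "bounded_linear T"
  shows "T x \<bullet> y = x \<bullet> adjoint T y"
proof -
  interpret bounded_linear T by fact
  have "\<exists>w. \<forall>x. T x \<bullet> y = x \<bullet> w" for y
    by (rule riesz_representation) (intro bounded_linear_inner_left_comp assms)
  then have "\<exists>T'. \<forall>x y. T x \<bullet> y = x \<bullet> T' y" by metis
  then have "\<forall>x y. T x \<bullet> y = x \<bullet> adjoint T y" unfolding adjoint_def by (rule someI_ex)
  then show ?thesis by blast
qed

section \<open>Minimal norm points and an injective self-adjoint operator\<close>

text \<open>First-order optimality: if \<open>k \<bullet> v\<close> were negative, a short step in
  direction \<open>v\<close> would decrease the norm.\<close>

lemma inner_nonneg_if_norm_min: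
  fixes k v :: "'a::real_inner"
  assumes "0 < t0" and min: "\<And>t. 0 < t \<Longrightarrow> t < t0 \<Longrightarrow> norm k \<le> norm (k + t *\<^sub>R v)"
  shows "0 \<le> k \<bullet> v"
proof (rule ccontr)
  assume "\<not> 0 \<le> k \<bullet> v"
  then have neg: "k \<bullet> v < 0" by simp
  have "v \<noteq> 0" using neg by auto
  \<comment> \<open>The first bound keeps \<open>t\<close> below \<open>t0\<close>. The second does
    not pass the minimum of the squared norm along the line, so the quadratic term absorbs at most
    half of the linear decrease.\<close>
  define t where "t = min (t0 / 2) (- (k \<bullet> v) / (v \<bullet> v))"
  have "0 < - (k \<bullet> v) / (v \<bullet> v)" using neg \<open>v \<noteq> 0\<close> by (intro divide_pos_pos) auto
  then have t: "0 < t" using \<open>0 < t0\<close> by (simp add: t_def)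
  have "t \<le> t0 / 2" unfolding t_def by (rule min.cobounded1)
  then have t': "t < t0" using \<open>0 < t0\<close> by linarith
  have "t \<le> - (k \<bullet> v) / (v \<bullet> v)" by (simp add: t_def)
  then have "t * (v \<bullet> v) \<le> - (k \<bullet> v)" using \<open>v \<noteq> 0\<close> by (subst (asm) pos_le_divide_eq) auto
  then have "t * (t * (v \<bullet> v)) \<le> t * (- (k \<bullet> v))" using t by (intro mult_left_mono) auto
  moreover have "k \<bullet> k \<le> (k + t *\<^sub>R v) \<bullet> (k + t *\<^sub>R v)" using min[OF t t'] by (simp add: norm_le)
  then have "0 \<le> 2 * (t * (k \<bullet> v)) + t * (t * (v \<bullet> v))"
    by (simp add: inner_simps inner_commute)
  moreover have "t * (k \<bullet> v) < 0" using t neg by (simp add: mult_pos_neg)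
  ultimately show False by (simp add: algebra_simps)
qed

text \<open>The least-norm element \<open>k\<close> of the closure of the vectors
  \<open>R x - z\<close> is orthogonal to the range of \<open>R\<close>. By self-adjointness
  \<open>R k = 0\<close>, so \<open>k = 0\<close> by injectivity, and \<open>z\<close> lies in the
  closure of the range.\<close>

lemma dense_range_self_adjoint_inj:
  fixes R :: "'a::{real_inner, complete_space} \<Rightarrow> 'a"
  assumes sa: "self_adjoint R" and inj: "inj R" and "e > 0"
  shows "\<exists>k. norm (R k - z) \<le> e"
proof -
  interpret bounded_linear R using sa by (simp add: self_adjoint_def)
  define C where "C = closure (range (\<lambda>x. R x - z))"
  have "convex (range (\<lambda>x. R x - z))"
  proof (rule convexI)
    fix p q and u v :: real
    assume "p \<in> range (\<lambda>x. R x - z)" "q \<in> range (\<lambda>x. R x - z)" and uv: "u + v = 1"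
    then obtain a b where "p = R a - z" "q = R b - z" by auto
    then have "u *\<^sub>R p + v *\<^sub>R q = R (u *\<^sub>R a + v *\<^sub>R b) - (u *\<^sub>R z + v *\<^sub>R z)"
      by (simp add: add scaleR scaleR_diff_right)
    also have "u *\<^sub>R z + v *\<^sub>R z = z" using uv by (metis scaleR_add_left scaleR_one)
    finally have "u *\<^sub>R p + v *\<^sub>R q = R (u *\<^sub>R a + v *\<^sub>R b) - z" .
    then show "u *\<^sub>R p + v *\<^sub>R q \<in> range (\<lambda>x. R x - z)" by blast
  qed
  then have cv: "convex C" unfolding C_def by (rule convex_closure)
  obtain k where k: "k \<in> C" and min: "\<And>x. x \<in> C \<Longrightarrow> norm k \<le> norm x"
    by (rule closed_convex_min_norm[of C]) (use cv in \<open>auto simp: C_def\<close>)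
  have "0 \<le> k \<bullet> R v" for v
  proof (rule inner_nonneg_if_norm_min[of 1])
    fix t :: real
    have "(+) (t *\<^sub>R R v) ` range (\<lambda>x. R x - z) \<subseteq> range (\<lambda>x. R x - z)"
    proof clarsimp
      fix x have "t *\<^sub>R R v + (R x - z) = R (t *\<^sub>R v + x) - z" by (simp add: add scaleR)
      then show "t *\<^sub>R R v + (R x - z) \<in> range (\<lambda>x. R x - z)" by blast
    qed
    then have "(+) (t *\<^sub>R R v) ` C \<subseteq> C"
      unfolding C_def closure_translation[symmetric] by (rule closure_mono)
    then show "norm k \<le> norm (k + t *\<^sub>R R v)" using k by (intro min) (auto simp: add.commute)
  qed simp
  \<comment> \<open>In this direction the inner product is minus the squared norm of
    \<open>R k\<close>.\<close>
  from this[of "- R k"] have "R k \<bullet> R k \<le> 0" 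
    using sa by (simp add: self_adjoint_def neg)
  then have "R k = R 0" using inner_gt_zero_iff[of "R k"] unfolding zero by linarith
  then have "k = 0" by (rule injD[OF inj])
  with k have "0 \<in> closure (range (\<lambda>x. R x - z))" by (simp add: C_def)
  then obtain x where "dist (R x - z) 0 < e" using \<open>e > 0\<close> by (auto simp: closure_approachable)
  then show ?thesis by (auto intro: exI[of _ x])
qed

text \<open>The projection of \<open>0\<close> onto \<open>{k. norm (R k - z) \<le> r}\<close>, together with its Lagrange multiplier.\<close>

lemma ball_min_norm_preimage:
  fixes R :: "'a::{real_inner, complete_space} \<Rightarrow> 'a"
  assumes sa: "self_adjoint R" and inj: "inj R" and "r > 0"
  obtains c k w where "0 \<le> c" "z = R k + w" "norm w \<le> r" "k = c *\<^sub>R R w" "c = 0 \<or> norm w = r"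
proof -
  interpret bounded_linear R using sa by (simp add: self_adjoint_def)
  have adj: "R x \<bullet> y = x \<bullet> R y" for x y using sa by (simp add: self_adjoint_def)
  define C where "C = {k. norm (R k - z) \<le> r}"
  have cl: "closed C" unfolding C_def by (intro closed_Collect_le continuous_intros continuous_on)
  have "C = R -` cball z r" by (auto simp: C_def dist_norm norm_minus_commute)
  then have cv: "convex C" by (simp add: convex_linear_vimage linear_axioms)
  obtain k where k: "k \<in> C" and min: "\<And>x. x \<in> C \<Longrightarrow> norm k \<le> norm x"
    by (rule closed_convex_min_norm[OF cl cv])
      (use dense_range_self_adjoint_inj[OF sa inj \<open>r > 0\<close>, of z] in \<open>auto simp: C_def\<close>)
  define w where "w = z - R k"
  have w: "norm w \<le> r" using k by (simp add: C_def w_def norm_minus_commute)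
  show ?thesis
  proof (cases "k = 0")
    case True
    then show ?thesis using w by (intro that[of 0 k w]) (auto simp: w_def zero)
  next
    case False
    \<comment> \<open>A direction \<open>v\<close> is admissible if it moves \<open>R k\<close>
      towards the interior of the ball around \<open>z\<close>, or if \<open>R k\<close> is in the
      interior already; the norm of \<open>k\<close> cannot decrease along it.\<close>
    have var: "0 \<le> k \<bullet> v" if "0 < w \<bullet> R v \<or> norm w < r" for v
    proof -
      have "\<exists>t0>0. \<forall>t. 0 < t \<and> t < t0 \<longrightarrow> norm (w - t *\<^sub>R R v) \<le> r"
      proof (cases "norm w < r")
        case True
        have "((\<lambda>t. norm (w - t *\<^sub>R R v)) \<longlongrightarrow> norm (w - 0 *\<^sub>R R v)) (at_right 0)"
          by (intro tendsto_intros)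
        then have "eventually (\<lambda>t. norm (w - t *\<^sub>R R v) < r) (at_right 0)"
          using True by (intro order_tendstoD(2)) auto
        then show ?thesis by (auto simp: eventually_at_right_field less_imp_le)
      next
        case ne: False
        with that have pos: "0 < w \<bullet> R v" by simp
        then have Rv: "R v \<noteq> 0" by auto
        show ?thesis
        proof (intro exI conjI allI impI)
          show "0 < (w \<bullet> R v) / (R v \<bullet> R v)" using pos Rv by simp
          fix t assume t: "0 < t \<and> t < (w \<bullet> R v) / (R v \<bullet> R v)"
          then have "t * (R v \<bullet> R v) \<le> w \<bullet> R v" using Rv by (simp add: pos_less_divide_eq less_imp_le)
          then have "t * (t * (R v \<bullet> R v)) \<le> t * (w \<bullet> R v)" using t by (intro mult_left_mono) auto
          moreover have "0 < t * (w \<bullet> R v)" using t pos by simp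
          ultimately have "(w - t *\<^sub>R R v) \<bullet> (w - t *\<^sub>R R v) \<le> w \<bullet> w"
            by (simp add: inner_simps inner_commute)
          then show "norm (w - t *\<^sub>R R v) \<le> r" using w by (simp add: norm_le[symmetric])
        qed
      qed
      then obtain t0 where t0: "t0 > 0" "\<And>t. 0 < t \<Longrightarrow> t < t0 \<Longrightarrow> norm (w - t *\<^sub>R R v) \<le> r"
        by blast
      show ?thesis
      proof (rule inner_nonneg_if_norm_min[OF t0(1)])
        fix t assume "0 < t" "t < t0"
        then have "norm (w - t *\<^sub>R R v) \<le> r" by (rule t0(2))
        moreover have "R (k + t *\<^sub>R v) - z = - (w - t *\<^sub>R R v)"
          by (simp add: w_def add scaleR)
        ultimately have "k + t *\<^sub>R v \<in> C" unfolding C_def mem_Collect_eq by (metis norm_minus_cancel)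
        then show "norm k \<le> norm (k + t *\<^sub>R v)" by (rule min)
      qed
    qed
    \<comment> \<open>With a slack constraint even the direction \<open>- k\<close> would be
      admissible, which is impossible for \<open>k \<noteq> 0\<close>.\<close>
    have "norm w = r"
    proof (rule ccontr)
      assume "norm w \<noteq> r"
      then have "0 \<le> k \<bullet> (- k)" using w by (intro var) simp
      then have "k \<bullet> k \<le> 0" by simp
      then show False using False inner_gt_zero_iff[of k] by linarith
    qed
    define u where "u = R w"
    have "w \<noteq> 0" using \<open>norm w = r\<close> \<open>r > 0\<close> by auto
    then have u: "u \<noteq> 0" using inj zero unfolding u_def by (metis injD)
    then have uu: "0 < u \<bullet> u" by simp
    have half: "0 \<le> k \<bullet> v" if "0 < u \<bullet> v" for v using that by (intro var) (simp add: u_def adj)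
    define c where "c = (k \<bullet> u) / (u \<bullet> u)"
    have "0 \<le> c" unfolding c_def using half[of u] uu by simp
    have "k = c *\<^sub>R u"
    proof -
      define p where "p = k - c *\<^sub>R u"
      have pu: "p \<bullet> u = 0" using uu by (simp add: p_def c_def inner_simps)
      \<comment> \<open>The part \<open>p\<close> of \<open>k\<close> orthogonal to \<open>u\<close>
        must vanish: \<open>u - s *\<^sub>R p\<close> stays in the half-space of \<open>half\<close>
        for every \<open>s\<close>, so \<open>s * (p \<bullet> p)\<close> is bounded over all
        positive \<open>s\<close>.\<close>
      have "s * (p \<bullet> p) \<le> k \<bullet> u" if "s > 0" for s
      proof -
        have "u \<bullet> (u - s *\<^sub>R p) > 0" using pu uu by (simp add: inner_simps inner_commute)
        then have "0 \<le> k \<bullet> (u - s *\<^sub>R p)" by (rule half)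
        moreover have "k \<bullet> p = p \<bullet> p" using pu by (simp add: p_def inner_simps inner_commute)
        ultimately show ?thesis by (simp add: inner_simps)
      qed
      note bound = this
      have "p = 0"
      proof (rule ccontr)
        assume "p \<noteq> 0"
        then have pp: "0 < p \<bullet> p" by simp
        have "((\<bar>k \<bullet> u\<bar> + 1) / (p \<bullet> p)) * (p \<bullet> p) \<le> k \<bullet> u"
          by (rule bound) (use pp in \<open>auto intro!: divide_pos_pos\<close>)
        then show False using pp by simp
      qed
      then show ?thesis by (simp add: p_def)
    qed
    then show ?thesis using \<open>0 \<le> c\<close> \<open>norm w = r\<close> by (intro that[of c k w]) (auto simp: u_def w_def)
  qed
qed

section \<open>Square roots of positive operators\<close>

text \<open>These are the power series coefficients of \<open>sqrt (1 - x)\<close> at 0; inserting a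
  contraction \<open>A\<close> for \<open>x\<close> will give a square root of the identity minus
  \<open>A\<close>.\<close>

definition sqrt_coeff :: "nat \<Rightarrow> real" where
  "sqrt_coeff n = (-1) ^ n * (1/2 gchoose n)"

lemma sqrt_coeff_0: "sqrt_coeff 0 = 1"
  by (simp add: sqrt_coeff_def)

text \<open>The coefficient with index \<open>n + 2\<close> arises from the previous one by the
  positive factor \<open>(n + 1/2) / (n + 2)\<close>, so the sign of the first one persists.\<close>

lemma sqrt_coeff_Suc_nonpos: "sqrt_coeff (Suc n) \<le> 0"
proof (induction n)
  case 0 then show ?case by (simp add: sqrt_coeff_def)
next
  case (Suc n)
  have "real (Suc (Suc n)) * sqrt_coeff (Suc (Suc n)) = (real (Suc n) - 1/2) * sqrt_coeff (Suc n)"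
  proof -
    have "real (Suc (Suc n)) * (1/2 gchoose Suc (Suc n)) = (1/2 - real (Suc n)) * (1/2 gchoose Suc n)"
      using gbinomial_mult_1[of "1/2::real" "Suc n"] by (simp add: algebra_simps)
    then have "(-1) ^ n * (real (Suc (Suc n)) * (1/2 gchoose Suc (Suc n)))
        = (-1) ^ n * ((1/2 - real (Suc n)) * (1/2 gchoose Suc n))" by simp
    then show ?thesis unfolding sqrt_coeff_def power_Suc by (simp only: mult_ac) (simp add: algebra_simps)
  qed
  moreover have "(real (Suc n) - 1/2) * sqrt_coeff (Suc n) \<le> 0"
    using Suc by (intro mult_nonneg_nonpos) auto
  ultimately show ?case by (metis mult_le_0_iff of_nat_0_less_iff not_less zero_less_Suc)
qed

text \<open>For \<open>0 < r < 1\<close> the constant sign makes the series of absolute values equal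
  to \<open>1 - sqrt (1 - r)\<close>, which is at most 1. Each finite partial sum is continuous in
  \<open>r\<close>, so the bound survives the limit \<open>r \<rightarrow> 1\<close>.\<close>

lemma sum_abs_sqrt_coeff_le: "(\<Sum>i<n. \<bar>sqrt_coeff (Suc i)\<bar>) \<le> 1"
proof -
  have le: "(\<Sum>i<n. \<bar>sqrt_coeff (Suc i)\<bar> * r ^ Suc i) \<le> 1" if r: "0 < r" "r < 1" for r :: real
  proof -
    have "(\<lambda>i. (1/2 gchoose i) * (- r) ^ i) sums (1 + - r) powr (1/2)"
      using r by (intro gen_binomial_real) auto
    moreover have "(1/2 gchoose i) * (- r) ^ i = sqrt_coeff i * r ^ i" for i
      by (simp add: sqrt_coeff_def power_minus[of r] mult_ac)
    ultimately have "(\<lambda>i. sqrt_coeff i * r ^ i) sums (1 - r) powr (1/2)" by simp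
    then have "(\<lambda>i. sqrt_coeff (Suc i) * r ^ Suc i) sums ((1 - r) powr (1/2) - 1)"
      by (subst sums_Suc_iff) (simp add: sqrt_coeff_0)
    then have "(\<lambda>i. - (sqrt_coeff (Suc i) * r ^ Suc i)) sums (1 - (1 - r) powr (1/2))"
      using sums_minus by fastforce
    then have s: "(\<lambda>i. \<bar>sqrt_coeff (Suc i)\<bar> * r ^ Suc i) sums (1 - (1 - r) powr (1/2))"
      using sqrt_coeff_Suc_nonpos by (simp add: abs_of_nonpos)
    have "(\<Sum>i<n. \<bar>sqrt_coeff (Suc i)\<bar> * r ^ Suc i) \<le> (\<Sum>i. \<bar>sqrt_coeff (Suc i)\<bar> * r ^ Suc i)"
      using r by (intro sum_le_suminf sums_summable[OF s]) auto
    also have "\<dots> = 1 - (1 - r) powr (1/2)" by (rule sums_unique[OF s, symmetric])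
    also have "\<dots> \<le> 1" by simp
    finally show ?thesis .
  qed
  have "((\<lambda>r::real. \<Sum>i<n. \<bar>sqrt_coeff (Suc i)\<bar> * r ^ Suc i) \<longlongrightarrow> (\<Sum>i<n. \<bar>sqrt_coeff (Suc i)\<bar> * 1 ^ Suc i)) (at_left 1)"
    by (intro tendsto_intros)
  moreover have "eventually (\<lambda>r. (\<Sum>i<n. \<bar>sqrt_coeff (Suc i)\<bar> * r ^ Suc i) \<le> 1) (at_left (1::real))"
    using eventually_at_left_real[of 0 "1::real"] by (auto elim!: eventually_mono simp del: power_Suc intro!: le)
  ultimately show ?thesis by (auto dest!: tendsto_upperbound)
qed

lemma summable_abs_sqrt_coeff: "summable (\<lambda>n. \<bar>sqrt_coeff n\<bar>)"
proof -
  have "summable (\<lambda>n. \<bar>sqrt_coeff (Suc n)\<bar>)"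
    by (rule bounded_imp_summable[of _ 1]) (use sum_abs_sqrt_coeff_le[of "Suc _"] in \<open>auto simp: lessThan_Suc_atMost\<close>)
  then show ?thesis by (subst (asm) summable_Suc_iff)
qed

lemma suminf_abs_sqrt_coeff_Suc_le: "(\<Sum>n. \<bar>sqrt_coeff (Suc n)\<bar>) \<le> 1"
  by (rule suminf_le_const)
    (use summable_abs_sqrt_coeff sum_abs_sqrt_coeff_le in \<open>auto simp: summable_Suc_iff[of "\<lambda>n. \<bar>sqrt_coeff n\<bar>"]\<close>)

text \<open>Vandermonde's identity expresses that the square of the series is
  \<open>1 - x\<close>.\<close>

lemma sqrt_coeff_convolution:
  "(\<Sum>i\<le>k. sqrt_coeff i * sqrt_coeff (k - i)) = (if k = 0 then 1 else if k = 1 then -1 else 0)"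
proof -
  have "(\<Sum>i\<le>k. sqrt_coeff i * sqrt_coeff (k - i)) = (\<Sum>i\<le>k. (-1) ^ k * ((1/2 gchoose i) * (1/2 gchoose (k - i))))"
    by (intro sum.cong refl) (auto simp: sqrt_coeff_def power_add[symmetric] mult_ac)
  also have "\<dots> = (-1) ^ k * (1 gchoose k)"
    using gbinomial_Vandermonde[of "1/2::real" "1/2" k] by (simp add: sum_distrib_left[symmetric] atMost_atLeast0)
  also have "(1 gchoose k :: real) = of_nat (1 choose k)"
    using binomial_gbinomial[of 1 k, where ?'a=real] by simp
  finally show ?thesis by (auto simp: binomial_eq_0)
qed

text \<open>Absolute convergence permits summation along the diagonals \<open>n + m = k\<close>,
  where the convolution identity applies. With \<open>a k\<close> the inner product of
  \<open>(A ^^ k) x\<close> and \<open>y\<close>, this says weakly that the operator series squares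
  to the identity minus \<open>A\<close>.\<close>

lemma double_sum_sqrt_coeff:
  fixes a :: "nat \<Rightarrow> real"
  assumes B: "\<And>n. \<bar>a n\<bar> \<le> B"
  shows "(\<Sum>n. \<Sum>m. sqrt_coeff n * (sqrt_coeff m * a (n + m))) = a 0 - a 1"
proof -
  have ab: "(\<lambda>n. \<bar>sqrt_coeff n\<bar>) summable_on UNIV"
    using summable_abs_sqrt_coeff by (intro norm_summable_imp_summable_on) auto
  have sq: "(\<lambda>(n,m). \<bar>sqrt_coeff n\<bar> * (\<bar>sqrt_coeff m\<bar> * B)) summable_on UNIV \<times> UNIV"
  proof (rule summable_on_SigmaI)
    show "((\<lambda>m. case (n, m) of (n, m) \<Rightarrow> \<bar>sqrt_coeff n\<bar> * (\<bar>sqrt_coeff m\<bar> * B)) has_sum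
       \<bar>sqrt_coeff n\<bar> * ((\<Sum>\<^sub>\<infinity>m. \<bar>sqrt_coeff m\<bar>) * B)) UNIV" for n
      using has_sum_infsum[OF ab] by (simp add: has_sum_cmult_left has_sum_cmult_right)
    show "(\<lambda>n. \<bar>sqrt_coeff n\<bar> * ((\<Sum>\<^sub>\<infinity>m. \<bar>sqrt_coeff m\<bar>) * B)) summable_on UNIV"
      by (intro summable_on_cmult_left ab)
    show "0 \<le> (case (x, y) of (n, m) \<Rightarrow> \<bar>sqrt_coeff n\<bar> * (\<bar>sqrt_coeff m\<bar> * B))" for x y
      using B[of 0] by auto
  qed
  define f where "f = (\<lambda>(n,m). sqrt_coeff n * (sqrt_coeff m * a (n + m)))"
  have f_abs: "(\<lambda>x. norm (f x)) summable_on UNIV \<times> UNIV"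
    by (rule summable_on_comparison_test[OF sq]) (auto simp: f_def abs_mult intro!: mult_left_mono B)
  then have f: "f summable_on UNIV \<times> UNIV" by (rule abs_summable_summable)
  \<comment> \<open>The diagonal index \<open>k\<close> comes first and the position
    \<open>i\<close> on the diagonal second.\<close>
  define g where "g = (\<lambda>(k,i). f (i, k - i))"
  have bij: "bij_betw (\<lambda>(k,i). (i, k - i)) (Sigma UNIV (\<lambda>k. {..k})) (UNIV \<times> UNIV :: (nat \<times> nat) set)"
    by (rule bij_betwI[where g = "\<lambda>(n,m). (n + m, n)"]) auto
  have "(\<lambda>x. f ((\<lambda>(k,i). (i, k - i)) x)) summable_on (Sigma UNIV (\<lambda>k. {..k}))"
    using f by (subst summable_on_reindex_bij_betw[OF bij])
  then have g: "(\<lambda>(k,i). g (k, i)) summable_on (Sigma UNIV (\<lambda>k. {..k}))"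
    by (simp add: g_def case_prod_unfold)
  have inner: "infsum g UNIV = suminf g" if "g summable_on UNIV" for g :: "nat \<Rightarrow> real"
    using sums_unique[OF has_sum_imp_sums[OF has_sum_infsum[OF that]]] by simp
  have f': "(\<lambda>(n,m). f (n, m)) summable_on (Sigma UNIV (\<lambda>_. UNIV))" using f by simp
  have "(\<Sum>n. \<Sum>m. f (n, m)) = (\<Sum>\<^sub>\<infinity>n. \<Sum>\<^sub>\<infinity>m. f (n, m))"
  proof -
    have 1: "(\<lambda>m. f (n, m)) summable_on UNIV" for n
      by (rule summable_on_SigmaD1[OF f']) simp
    show ?thesis using inner[OF summable_on_Sigma_banach[OF f']] inner[OF 1] by simp
  qed
  also have "\<dots> = infsum f (UNIV \<times> UNIV)"
    using infsum_Sigma'_banach[OF f'] by simp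
  also have "\<dots> = infsum g (Sigma UNIV (\<lambda>k. {..k}))"
    unfolding g_def
    by (rule infsum_reindex_bij_witness[of _ "\<lambda>(k,i). (i, k - i)" "\<lambda>(n,m). (n + m, n)"]) auto
  also have "\<dots> = (\<Sum>\<^sub>\<infinity>k. \<Sum>\<^sub>\<infinity>i\<in>{..k}. g (k, i))"
    using infsum_Sigma'_banach[OF g] by simp
  also have "\<dots> = (\<Sum>\<^sub>\<infinity>k. (if k = 0 then 1 else if k = 1 then -1 else 0) * a k)"
  proof (intro infsum_cong)
    fix k
    have "(\<Sum>\<^sub>\<infinity>i\<in>{..k}. g (k, i)) = (\<Sum>i\<le>k. sqrt_coeff i * sqrt_coeff (k - i) * a k)"
      by (simp add: g_def f_def mult.assoc)
    then show "(\<Sum>\<^sub>\<infinity>i\<in>{..k}. g (k, i)) = (if k = 0 then 1 else if k = 1 then -1 else 0) * a k"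
      unfolding sum_distrib_right[symmetric] sqrt_coeff_convolution .
  qed
  also have "\<dots> = (\<Sum>\<^sub>\<infinity>k\<in>{0,1}. (if k = 0 then 1 else if k = 1 then -1 else 0) * a k)"
    by (rule infsum_cong_neutral) auto
  also have "\<dots> = a 0 - a 1" by simp
  finally show ?thesis by (simp add: f_def)
qed

section \<open>Existence of positive square roots\<close>

text \<open>Positivity of \<open>S\<close> is used at \<open>M *\<^sub>R x - S x\<close>; in the
  expansion the norm bound absorbs the term cubic in \<open>S\<close>.\<close>

lemma positive_self_adjoint_sq_norm_le:
  assumes "self_adjoint S" "positive_op S" "0 < M" "\<And>x. norm (S x) \<le> M * norm x"
  shows "S x \<bullet> S x \<le> M * (S x \<bullet> x)"
proof -
  interpret bounded_linear S using assms by (simp add: self_adjoint_def)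
  have adj: "S x \<bullet> y = x \<bullet> S y" for x y using assms by (simp add: self_adjoint_def)
  have "S (S x) \<bullet> S x \<le> norm (S (S x)) * norm (S x)" by (rule norm_cauchy_schwarz)
  also have "\<dots> \<le> (M * norm (S x)) * norm (S x)" using assms by (intro mult_right_mono) auto
  finally have 1: "S (S x) \<bullet> S x \<le> M * (S x \<bullet> S x)" by (simp add: power2_norm_eq_inner[symmetric] power2_eq_square)
  have "0 \<le> S (M *\<^sub>R x - S x) \<bullet> (M *\<^sub>R x - S x)" using assms by (simp add: positive_op_def)
  also have "\<dots> = M * (M * (S x \<bullet> x)) - 2 * (M * (S x \<bullet> S x)) + S (S x) \<bullet> S x"
    using adj[of "S x" x] by (simp add: diff scaleR inner_diff_left inner_diff_right algebra_simps)
  finally have "M * (S x \<bullet> S x) \<le> M * (M * (S x \<bullet> x))" using 1 by linarith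
  then show ?thesis using \<open>0 < M\<close> by simp
qed

text \<open>The sort of the spaces considered here does not include the class \<open>banach\<close>, to which the
  library restricts the comparison test.\<close>

lemma summable_comparison_complete:
  fixes f :: "nat \<Rightarrow> 'a::{real_normed_vector, complete_space}"
  assumes le: "\<And>n. norm (f n) \<le> g n" and g: "summable g"
  shows "summable f" "norm (suminf f) \<le> suminf g"
proof -
  have "Cauchy (\<lambda>n. sum f {..<n})"
  proof (rule CauchyI')
    fix e :: real assume "0 < e"
    then obtain N where N: "\<And>m n. N \<le> m \<Longrightarrow> norm (sum g {m..<n}) < e"
      using g unfolding summable_Cauchy by blast
    have "dist (sum f {..<m}) (sum f {..<n}) < e" if "N \<le> m" "m < n" for m n
    proof -
      have "dist (sum f {..<m}) (sum f {..<n}) = norm (sum f {m..<n})"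
        using that sum_diff_nat_ivl[of 0 m n f]
        by (simp only: dist_norm norm_minus_commute[of "sum f {..<m}"] atLeast0LessThan)
      also have "\<dots> \<le> sum g {m..<n}" by (rule sum_norm_le) (rule le)
      also have "\<dots> < e" using N[OF that(1), of n] by auto
      finally show ?thesis .
    qed
    then show "\<exists>M. \<forall>m\<ge>M. \<forall>n>m. dist (sum f {..<m}) (sum f {..<n}) < e" by blast
  qed
  then show "summable f" unfolding summable_iff_convergent by (rule Cauchy_convergent)
  then have "(\<lambda>n. norm (sum f {..<n})) \<longlonglongrightarrow> norm (suminf f)"
    by (intro tendsto_norm summable_LIMSEQ)
  moreover have "norm (sum f {..<n}) \<le> suminf g" for n
  proof -
    have "norm (sum f {..<n}) \<le> sum g {..<n}" by (rule sum_norm_le) (rule le)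
    also have "\<dots> \<le> suminf g" using le by (intro sum_le_suminf g) (auto intro: order_trans[OF norm_ge_zero])
    finally show ?thesis .
  qed
  ultimately show "norm (suminf f) \<le> suminf g" by (intro LIMSEQ_le_const2) auto
qed

text \<open>\<open>R\<close> is the series of the \<open>sqrt_coeff n\<close> times the iterates of
  \<open>A\<close>, absolutely convergent as these do not increase norms. It is positive because the
  coefficients after the constant term 1 have absolute sum at most 1.\<close>

lemma positive_sqrt_of_contraction_complement:
  fixes A :: "'a::{real_inner, complete_space} \<Rightarrow> 'a"
  assumes sa: "self_adjoint A" and contr: "\<And>x. norm (A x) \<le> norm x"
  shows "\<exists>R. self_adjoint R \<and> positive_op R \<and> R \<circ> R = (\<lambda>x. x - A x)"
proof -
  interpret A: bounded_linear A using sa by (simp add: self_adjoint_def)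
  have Asym: "A x \<bullet> y = x \<bullet> A y" for x y using sa by (simp add: self_adjoint_def)
  define p where "p n x = (A ^^ n) x" for n x
  have p_norm: "norm (p n x) \<le> norm x" for n x
    by (induction n) (auto simp: p_def intro: order_trans[OF contr])
  have p_sym: "p n x \<bullet> y = x \<bullet> p n y" for n x y
    by (induction n arbitrary: x y) (simp_all add: p_def Asym funpow_swap1)
  have p_p: "p n (p m x) = p (n + m) x" for n m x by (simp add: p_def funpow_add)
  have p_add: "p n (x + y) = p n x + p n y" for n x y by (induction n) (auto simp: p_def A.add)
  have p_scale: "p n (c *\<^sub>R x) = c *\<^sub>R p n x" for n c x by (induction n) (auto simp: p_def A.scaleR)
  define b where "b = sqrt_coeff"
  have term_le: "norm (b n *\<^sub>R p n x) \<le> \<bar>b n\<bar> * norm x" for n x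
    using p_norm by (auto intro: mult_left_mono)
  have sm_abs: "summable (\<lambda>n. \<bar>b n\<bar> * norm x)" for x :: 'a
    unfolding b_def by (rule summable_mult2[OF summable_abs_sqrt_coeff])
  have sm: "summable (\<lambda>n. b n *\<^sub>R p n x)" for x
    by (rule summable_comparison_complete(1)[OF term_le sm_abs])
  define R where "R x = (\<Sum>n. b n *\<^sub>R p n x)" for x
  have bl: "bounded_linear R"
  proof (rule bounded_linear_intro)
    show "R (x + y) = R x + R y" for x y
      unfolding R_def by (subst suminf_add[OF sm sm]) (simp add: p_add scaleR_add_right)
    show "R (c *\<^sub>R x) = c *\<^sub>R R x" for c x
      unfolding R_def
      by (subst bounded_linear.suminf[OF bounded_linear_scaleR_right sm]) (simp add: p_scale mult.commute)
    show "norm (R x) \<le> norm x * (\<Sum>n. \<bar>b n\<bar>)" for x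
    proof -
      have "norm (R x) \<le> (\<Sum>n. \<bar>b n\<bar> * norm x)"
        unfolding R_def by (rule summable_comparison_complete(2)[OF term_le sm_abs])
      also have "\<dots> = (\<Sum>n. \<bar>b n\<bar>) * norm x"
        using summable_abs_sqrt_coeff unfolding b_def by (rule suminf_mult2[symmetric])
      finally show ?thesis by (simp add: mult.commute)
    qed
  qed
  have R_inner: "(\<lambda>n. b n * (p n x \<bullet> y)) sums (R x \<bullet> y)" for x y
    using bounded_linear.sums[OF bounded_linear_inner_left summable_sums[OF sm]] unfolding R_def by simp
  have R_sym: "R x \<bullet> y = x \<bullet> R y" for x y
    using R_inner[of x y] R_inner[of y x] p_sym
    by (metis (no_types, lifting) inner_commute sums_cong sums_unique2)
  have "R (R x) = x - A x" for x
  proof -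
    \<comment> \<open>Testing against \<open>y\<close> turns the operator product into a real double
      series, where rearrangement is available.\<close>
    have "R (R x) \<bullet> y = (x - A x) \<bullet> y" for y
    proof -
      define a where "a k = p k x \<bullet> y" for k
      have aB: "\<bar>a k\<bar> \<le> norm x * norm y" for k
        unfolding a_def by (rule order_trans[OF Cauchy_Schwarz_ineq2]) (intro mult_right_mono p_norm; simp)
      have "R (R x) \<bullet> y = (\<Sum>n. b n * (p n (R x) \<bullet> y))" using R_inner sums_unique by blast
      also have "\<dots> = (\<Sum>n. \<Sum>m. b n * (b m * a (n + m)))"
      proof (intro suminf_cong)
        fix n
        have "p n (R x) \<bullet> y = R x \<bullet> p n y" by (rule p_sym)
        also have "\<dots> = (\<Sum>m. b m * (p m x \<bullet> p n y))" using R_inner sums_unique by blast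
        also have "(\<lambda>m. b m * (p m x \<bullet> p n y)) = (\<lambda>m. b m * a (n + m))"
          by (simp add: a_def p_p[symmetric] p_sym[of n "p _ x"])
        finally have *: "p n (R x) \<bullet> y = (\<Sum>m. b m * a (n + m))" .
        have "summable (\<lambda>m. b m * (p m x \<bullet> p n y))" using R_inner by (rule sums_summable)
        then have "summable (\<lambda>m. b m * a (n + m))"
          by (simp add: a_def p_p[symmetric] p_sym[of n "p _ x"])
        then show "b n * (p n (R x) \<bullet> y) = (\<Sum>m. b n * (b m * a (n + m)))"
          unfolding * by (rule suminf_mult[symmetric])
      qed
      also have "\<dots> = a 0 - a 1" unfolding b_def by (rule double_sum_sqrt_coeff[OF aB])
      also have "\<dots> = (x - A x) \<bullet> y" by (simp add: a_def p_def inner_diff_left)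
      finally show ?thesis .
    qed
    then show ?thesis by (metis vector_eq_rdot)
  qed
  moreover have "0 \<le> R x \<bullet> x" for x
  proof -
    have s: "(\<lambda>n. b (Suc n) * (p (Suc n) x \<bullet> x)) sums (R x \<bullet> x - x \<bullet> x)"
      using R_inner[of x x] by (subst sums_Suc_iff) (simp add: b_def sqrt_coeff_0 p_def)
    have le: "norm (b (Suc n) * (p (Suc n) x \<bullet> x)) \<le> \<bar>b (Suc n)\<bar> * (x \<bullet> x)" for n
    proof -
      have "\<bar>p (Suc n) x \<bullet> x\<bar> \<le> norm x * norm x"
        by (rule order_trans[OF Cauchy_Schwarz_ineq2]) (intro mult_right_mono p_norm; simp)
      then show ?thesis by (auto simp: abs_mult power2_norm_eq_inner[symmetric] power2_eq_square intro!: mult_left_mono)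
    qed
    have sb: "summable (\<lambda>n. \<bar>b (Suc n)\<bar>)"
      using summable_abs_sqrt_coeff by (simp add: b_def summable_Suc_iff[of "\<lambda>n. \<bar>sqrt_coeff n\<bar>"])
    have "\<bar>R x \<bullet> x - x \<bullet> x\<bar> \<le> (\<Sum>n. \<bar>b (Suc n)\<bar> * (x \<bullet> x))"
      using norm_suminf_le[OF le summable_mult2[OF sb]] sums_unique[OF s] by simp
    also have "\<dots> = (\<Sum>n. \<bar>b (Suc n)\<bar>) * (x \<bullet> x)" by (rule suminf_mult2[OF sb, symmetric])
    also have "\<dots> \<le> 1 * (x \<bullet> x)"
      unfolding b_def by (intro mult_right_mono suminf_abs_sqrt_coeff_Suc_le) auto
    finally show ?thesis by simp
  qed
  ultimately show ?thesis using bl R_sym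
    by (intro exI[of _ R]) (auto simp: self_adjoint_def positive_op_def fun_eq_iff)
qed

text \<open>For a norm bound \<open>M\<close> of \<open>S\<close>, the identity minus
  \<open>S / M\<close> is a contraction. The root of its complement \<open>S / M\<close>, scaled by
  \<open>sqrt M\<close>, is a witness for the choice in \<open>op_sqrt\<close>.\<close>

lemma op_sqrt:
  fixes S :: "'a::{real_inner, complete_space} \<Rightarrow> 'a"
  assumes sa: "self_adjoint S" and pos: "positive_op S"
  shows "self_adjoint (op_sqrt S)" "positive_op (op_sqrt S)" "op_sqrt S \<circ> op_sqrt S = S"
proof -
  interpret S: bounded_linear S using sa by (simp add: self_adjoint_def)
  have Ssym: "S x \<bullet> y = x \<bullet> S y" for x y using sa by (simp add: self_adjoint_def)
  obtain M where M: "0 < M" "\<And>x. norm (S x) \<le> norm x * M" using S.pos_bounded by blast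
  define A where "A x = x - (1 / M) *\<^sub>R S x" for x
  have "bounded_linear A" unfolding A_def
    by (intro bounded_linear_sub bounded_linear_ident bounded_linear_scaleR_right
        bounded_linear_compose[OF bounded_linear_scaleR_right S.bounded_linear_axioms])
  then have A_sa: "self_adjoint A" by (simp add: self_adjoint_def A_def inner_diff_left inner_diff_right Ssym)
  have "norm (A x) \<le> norm x" for x
  proof -
    have "S x \<bullet> S x \<le> M * (S x \<bullet> x)"
      using M by (intro positive_self_adjoint_sq_norm_le sa pos) (auto simp: mult.commute)
    moreover have "0 \<le> S x \<bullet> x" using pos by (simp add: positive_op_def)
    then have "0 \<le> M * (S x \<bullet> x)" using M by simp
    ultimately have "S x \<bullet> S x \<le> 2 * (M * (S x \<bullet> x))" by linarith
    then have "(1 / M)\<^sup>2 * (S x \<bullet> S x) \<le> (1 / M)\<^sup>2 * (2 * (M * (S x \<bullet> x)))" by (intro mult_left_mono) auto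
    also have "\<dots> = 2 / M * (S x \<bullet> x)" using M by (simp add: power2_eq_square)
    finally have "A x \<bullet> A x \<le> x \<bullet> x"
      by (simp add: A_def inner_diff_left inner_diff_right inner_commute power2_eq_square)
    then show ?thesis by (simp add: norm_le)
  qed
  from positive_sqrt_of_contraction_complement[OF A_sa this]
  obtain R where R: "self_adjoint R" "positive_op R" "R \<circ> R = (\<lambda>x. x - A x)" by blast
  interpret R: bounded_linear R using R by (simp add: self_adjoint_def)
  have RR: "R (R x) = (1 / M) *\<^sub>R S x" for x using R(3) by (simp add: fun_eq_iff A_def)
  define R' where "R' x = sqrt M *\<^sub>R R x" for x
  have "R' \<circ> R' = S" using M RR by (auto simp: R'_def fun_eq_iff R.scaleR)
  moreover have "bounded_linear R'" unfolding R'_def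
    by (rule bounded_linear_compose[OF bounded_linear_scaleR_right R.bounded_linear_axioms])
  then have "self_adjoint R'" "positive_op R'"
    using R M by (auto simp: R'_def self_adjoint_def positive_op_def)
  ultimately have "\<exists>R. self_adjoint R \<and> positive_op R \<and> R \<circ> R = S" by blast
  from someI_ex[OF this] show "self_adjoint (op_sqrt S)" "positive_op (op_sqrt S)" "op_sqrt S \<circ> op_sqrt S = S"
    unfolding op_sqrt_def by blast+
qed

lemma inj_op_sqrt:
  fixes S :: "'a::{real_inner, complete_space} \<Rightarrow> 'a"
  assumes "self_adjoint S" "positive_op S" "inj S"
  shows "inj (op_sqrt S)"
proof (rule injI)
  fix x y assume "op_sqrt S x = op_sqrt S y"
  then have "(op_sqrt S \<circ> op_sqrt S) x = (op_sqrt S \<circ> op_sqrt S) y" by simp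
  then have "S x = S y" unfolding op_sqrt(3)[OF assms(1,2)] .
  then show "x = y" by (rule injD[OF assms(3)])
qed

section \<open>Measures determined by their characteristic functional\<close>

text \<open>Levy's uniqueness theorem with a weight: dividing \<open>w\<close> by its integral gives
  a probability density, and the law of \<open>f\<close> under it is determined by its
  characteristic function, whose real and imaginary parts are the cosine integrals with phases 0 and
  \<open>- pi / 2\<close>.\<close>

lemma integral_weight_indicator_eqI:
  fixes w f :: "'a \<Rightarrow> real"
  assumes P: "finite_measure P" and Q: "finite_measure Q" and PQ: "sets P = sets Q"
    and w: "w \<in> borel_measurable P" and f: "f \<in> borel_measurable P"
    and w0: "\<And>x. 0 \<le> w x" and wB: "\<And>x. w x \<le> B"
    and cos_eq: "\<And>b t. (LINT x|P. w x * cos (b + t * f x)) = (LINT x|Q. w x * cos (b + t * f x))"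
    and A: "A \<in> sets borel"
  shows "(LINT x|P. w x * indicator A (f x)) = (LINT x|Q. w x * indicator A (f x))"
proof -
  define c where "c = (LINT x|P. w x)"
  have c0: "0 \<le> c" unfolding c_def by (simp add: w0)
  have cQ: "c = (LINT x|Q. w x)" using cos_eq[of 0 0] by (simp add: c_def)
  define N where "N M = distr (density M (\<lambda>x. ennreal (w x / c))) borel f" for M
  have *: "real_distribution (N M) \<and>
      (\<forall>t. char (N M) t = Complex ((LINT x|M. w x * cos (0 + t * f x)) / c)
        ((LINT x|M. w x * cos (- pi / 2 + t * f x)) / c)) \<and>
      measure (N M) A = (LINT x|M. w x * indicator A (f x)) / c"
    if M: "finite_measure M" "sets M = sets P" and cM: "c = (LINT x|M. w x)" and "0 < c" for M
  proof -
    interpret M: finite_measure M by fact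
    have [measurable]: "w \<in> borel_measurable M" "f \<in> borel_measurable M"
      using w f M(2) by (simp_all cong: measurable_cong_sets)
    have wi: "integrable M w"
      by (rule M.integrable_const_bound[of _ B]) (auto simp: w0 wB)
    have "(\<integral>\<^sup>+ x. ennreal (w x / c) \<partial>M) = ennreal (LINT x|M. w x / c)"
      using wi w0 c0 by (intro nn_integral_eq_integral) auto
    also have "\<dots> = 1" using \<open>0 < c\<close> cM by simp
    finally have "prob_space (density M (\<lambda>x. ennreal (w x / c)))"
      by (intro prob_spaceI) (simp add: emeasure_density cong: nn_integral_cong)
    then have pN: "prob_space (N M)" unfolding N_def by (rule prob_space.prob_space_distr) simp
    then have rd: "real_distribution (N M)"
      by (simp add: real_distribution_def real_distribution_axioms_def N_def)
    have wb: "\<bar>w x\<bar> \<le> B" for x using w0 wB by simp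
    have wi2: "integrable M (\<lambda>x. w x * cos (b + t * f x))" for b t
      by (rule M.integrable_const_bound[of _ B])
        (auto simp: abs_mult intro!: mult_le_one order_trans[OF mult_mono[OF wb abs_cos_le_one]] intro: order_trans[OF w0 wB])
    have wi3: "integrable M (\<lambda>x. (w x / c) *\<^sub>R iexp (t * f x))" for t
      by (rule M.integrable_const_bound[of _ "B / c"]) (use w0 wB \<open>0 < c\<close> in \<open>auto intro!: divide_right_mono\<close>)
    have "char (N M) t = (CLINT x|M. (w x / c) *\<^sub>R iexp (t * f x))" for t
      unfolding char_def N_def
      by (subst integral_distr, simp, simp, subst integral_density) (use w0 c0 in auto)
    moreover have "Re (CLINT x|M. (w x / c) *\<^sub>R iexp (t * f x)) = (LINT x|M. w x * cos (0 + t * f x)) / c" for t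
      by (subst integral_Re[OF wi3, symmetric]) (simp add: Re_exp)
    moreover have "Im (CLINT x|M. (w x / c) *\<^sub>R iexp (t * f x)) = (LINT x|M. w x * cos (- pi / 2 + t * f x)) / c" for t
    proof -
      have "cos (- pi / 2 + u) = sin u" for u :: real by (simp add: cos_diff)
      then show ?thesis by (subst integral_Im[OF wi3, symmetric]) (simp add: Im_exp)
    qed
    moreover have "measure (N M) A = (LINT x|M. w x * indicator A (f x)) / c"
    proof -
      have "measure (N M) A = (LINT x|N M. indicator A x)"
        using A by (simp add: N_def)
      also have "\<dots> = (LINT x|M. (w x / c) *\<^sub>R indicator A (f x))"
        unfolding N_def using A
        by (subst integral_distr, simp, simp, subst integral_density) (use w0 c0 in auto)
      finally show ?thesis by simp
    qed
    ultimately show ?thesis using rd by (auto simp: complex_eq_iff)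
  qed
  show ?thesis
  proof (cases "c = 0")
    case False
    then have "0 < c" using c0 by simp
    note p = *[OF P refl c_def this] and q = *[OF Q PQ[symmetric] cQ this]
    have "char (N P) t = char (N Q) t" for t
      unfolding p[THEN conjunct2, THEN conjunct1, rule_format, of t]
        q[THEN conjunct2, THEN conjunct1, rule_format, of t] cos_eq ..
    then have "N P = N Q" by (intro Levy_uniqueness) (use p q in \<open>auto simp only: fun_eq_iff\<close>)
    then have "(LINT x|P. w x * indicator A (f x)) / c = (LINT x|Q. w x * indicator A (f x)) / c"
      using p[THEN conjunct2, THEN conjunct2] q[THEN conjunct2, THEN conjunct2] by metis
    then show ?thesis using False by simp
  next
    case True
    \<comment> \<open>Total weight zero cannot be normalized, but then \<open>w\<close> vanishes
      almost everywhere under both measures.\<close>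
    have "(LINT x|M. w x * indicator A (f x)) = 0"
      if M: "finite_measure M" "sets M = sets P" and cM: "(LINT x|M. w x) = 0" for M
    proof -
      interpret M: finite_measure M by fact
      have [measurable]: "w \<in> borel_measurable M" "f \<in> borel_measurable M"
        using w f M(2) by (simp_all cong: measurable_cong_sets)
      have "integrable M w"
        by (rule M.integrable_const_bound[of _ B]) (auto simp: w0 wB)
      then have "AE x in M. w x = 0" using cM w0 by (subst (asm) integral_nonneg_eq_0_iff_AE) auto
      then show ?thesis by (intro integral_eq_zero_AE) auto
    qed
    then show ?thesis using P Q PQ True c_def cQ by metis
  qed
qed

section \<open>Cylinder sets and the Borel sigma-algebra\<close>

text \<open>If \<open>norm v > r\<close>, the inequality fails at \<open>d = v\<close>; failure is
  an open condition, so it also occurs in \<open>D\<close>. For countable \<open>D\<close> a closed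
  ball thus becomes a countable intersection of half-spaces.\<close>

lemma norm_le_iff_inner_dense:
  fixes v :: "'a::real_inner"
  assumes D: "\<And>X. open X \<Longrightarrow> X \<noteq> {} \<Longrightarrow> \<exists>d\<in>D. d \<in> X" and "0 \<le> r"
  shows "norm v \<le> r \<longleftrightarrow> (\<forall>d\<in>D. v \<bullet> d \<le> r * norm d)"
proof
  assume "norm v \<le> r"
  then show "\<forall>d\<in>D. v \<bullet> d \<le> r * norm d"
    using norm_cauchy_schwarz[of v] by (meson mult_right_mono norm_ge_zero order_trans)
next
  assume le: "\<forall>d\<in>D. v \<bullet> d \<le> r * norm d"
  show "norm v \<le> r"
  proof (rule ccontr)
    assume gt: "\<not> norm v \<le> r"
    have "open {d. r * norm d < v \<bullet> d}" by (intro open_Collect_less continuous_intros)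
    moreover have "norm v * norm v > r * norm v" using gt \<open>0 \<le> r\<close> by (intro mult_strict_right_mono) auto
    then have "v \<in> {d. r * norm d < v \<bullet> d}" by (simp add: power2_norm_eq_inner[symmetric] power2_eq_square)
    ultimately obtain d where "d \<in> D" "r * norm d < v \<bullet> d" using D by blast
    with le show False by force
  qed
qed

lemma borel_measurable_inner_left: "(\<lambda>x. x \<bullet> (k :: 'a::real_inner)) \<in> borel_measurable borel"
  by (intro borel_measurable_continuous_onI continuous_intros)

text \<open>\<open>F\<close> is a finite set of pairs, so a vector may occur with several sets
  \<open>A\<close>, and an intersection of two cylinders just unites their index sets.\<close>

definition cylinders :: "'a::real_inner set set" where
  "cylinders = {{x. \<forall>(k, A)\<in>F. x \<bullet> k \<in> A} | F. finite F \<and> (\<forall>(k, A)\<in>F. A \<in> sets borel)}"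

lemma halfspace_in_cylinders: "{x. x \<bullet> d \<le> b} \<in> cylinders"
  unfolding cylinders_def by (rule CollectI, rule exI[of _ "{(d, {..b})}"]) auto

lemma cylinders_borel: "cylinders \<subseteq> sets borel"
proof
  fix X :: "'a set" assume "X \<in> cylinders"
  then obtain F where F: "finite F" "\<forall>(k, A)\<in>F. A \<in> sets borel" "X = {x. \<forall>(k, A)\<in>F. x \<bullet> k \<in> A}"
    by (auto simp: cylinders_def)
  have "{x \<in> space borel. \<forall>p\<in>F. x \<bullet> fst p \<in> snd p} \<in> sets borel"
  proof (rule sets.sets_Collect_finite_All[OF _ F(1)])
    fix p assume "p \<in> F"
    then have [measurable]: "snd p \<in> sets borel" using F(2) by auto
    note borel_measurable_inner_left[measurable]
    show "{x \<in> space borel. x \<bullet> fst p \<in> snd p} \<in> sets borel" by measurable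
  qed
  then show "X \<in> sets borel" by (simp add: F(3) case_prod_beta)
qed

text \<open>Closed balls are countable intersections of half-spaces, and by separability every open
  set is a countable union of closed balls.\<close>

lemma borel_eq_sigma_cylinders:
  "sets (borel :: 'a::{real_inner, second_countable_topology} measure) = sigma_sets UNIV cylinders"
proof
  show "sigma_sets UNIV cylinders \<subseteq> sets (borel :: 'a measure)"
    using sets.sigma_sets_subset[OF cylinders_borel] by simp
  obtain D :: "'a set" where D: "countable D" "\<And>X. open X \<Longrightarrow> X \<noteq> {} \<Longrightarrow> \<exists>d\<in>D. d \<in> X"
    by (rule countable_dense_setE) blast
  interpret S: sigma_algebra UNIV "sigma_sets UNIV (cylinders :: 'a set set)"
    by (rule sigma_algebra_sigma_sets) simp
  have cb: "cball c r \<in> sigma_sets UNIV cylinders" if "0 \<le> r" for c :: 'a and r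
  proof -
    have "cball c r = (\<Inter>d\<in>D. {x. x \<bullet> d \<le> r * norm d + c \<bullet> d})"
      using norm_le_iff_inner_dense[OF D(2) that]
      by (auto simp: dist_norm norm_minus_commute inner_diff_left algebra_simps)
    also have "\<dots> \<in> sigma_sets UNIV cylinders"
      by (intro S.countable_INT'' D(1)) (auto intro!: sigma_sets.Basic halfspace_in_cylinders intro: sigma_sets_top)
    finally show ?thesis .
  qed
  have "U \<in> sigma_sets UNIV cylinders" if "open U" for U :: "'a set"
  proof -
    define I where "I = {(d, q). d \<in> D \<and> q \<in> \<rat> \<and> 0 < q \<and> cball d q \<subseteq> U}"
    have "I \<subseteq> D \<times> \<rat>" by (auto simp: I_def)
    then have I: "countable I" by (rule countable_subset) (intro countable_SIGMA D(1) countable_rat)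
    have "U = (\<Union>(d, q)\<in>I. cball d q)"
    proof
      show "U \<subseteq> (\<Union>(d, q)\<in>I. cball d q)"
      proof
        fix x assume "x \<in> U"
        then obtain e where e: "0 < e" "ball x e \<subseteq> U" using \<open>open U\<close> by (meson open_contains_ball)
        obtain q where q: "q \<in> \<rat>" "0 < q" "q < e / 2" using Rats_dense_in_real[of 0 "e / 2"] e by auto
        obtain d where d: "d \<in> D" "d \<in> ball x q" using D(2)[of "ball x q"] q by auto
        have "cball d q \<subseteq> U"
        proof
          fix z assume "z \<in> cball d q"
          then have "dist x z < e" using d q dist_triangle[of x z d] by auto
          then show "z \<in> U" using e by auto
        qed
        then have "(d, q) \<in> I" using d q by (auto simp: I_def)
        moreover have "x \<in> cball d q" using d by (simp add: dist_commute)
        ultimately show "x \<in> (\<Union>(d, q)\<in>I. cball d q)" by blast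
      qed
    qed (auto simp: I_def)
    also have "\<dots> \<in> sigma_sets UNIV cylinders"
      by (rule sigma_sets_UNION) (use I cb in \<open>auto simp: I_def\<close>)
    finally show ?thesis .
  qed
  then have "sigma_sets UNIV {S. open S} \<subseteq> sigma_sets UNIV (cylinders :: 'a set set)"
    by (intro sigma_sets_mono) auto
  then show "sets (borel :: 'a measure) \<subseteq> sigma_sets UNIV cylinders"
    by (simp add: borel_def)
qed

lemma Int_stable_cylinders: "Int_stable cylinders"
proof (rule Int_stableI)
  fix X Y :: "'a set" assume "X \<in> cylinders" "Y \<in> cylinders"
  then obtain F G where "finite F" "\<forall>(k, A)\<in>F. A \<in> sets borel" "X = {x. \<forall>(k, A)\<in>F. x \<bullet> k \<in> A}"
    "finite G" "\<forall>(k, A)\<in>G. A \<in> sets borel" "Y = {x. \<forall>(k, A)\<in>G. x \<bullet> k \<in> A}"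
    unfolding cylinders_def by blast
  then have "X \<inter> Y = {x. \<forall>(k, A)\<in>F \<union> G. x \<bullet> k \<in> A}" "finite (F \<union> G)"
    "\<forall>(k, A)\<in>F \<union> G. A \<in> sets borel"
    by (simp_all only: ball_Un Collect_conj_eq finite_UnI)
  then show "X \<inter> Y \<in> cylinders"
    unfolding cylinders_def by blast
qed

text \<open>The induction step for cylinders: one more indicator moves into the weight while the
  agreement of all cosine integrals is preserved.\<close>

lemma cos_integral_indicator_step:
  fixes W :: "'a::{real_inner, second_countable_topology} \<Rightarrow> real"
  assumes P: "finite_measure P" "sets P = sets borel" and Q: "finite_measure Q" "sets Q = sets borel"
    and W[measurable]: "W \<in> borel_measurable borel" and W01: "\<And>x. 0 \<le> W x" "\<And>x. W x \<le> 1"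
    and eq: "\<And>a k. (LINT x|P. W x * cos (a + x \<bullet> k)) = (LINT x|Q. W x * cos (a + x \<bullet> k))"
    and A[measurable]: "A \<in> sets borel"
  shows "(LINT x|P. (W x * indicator A (x \<bullet> k)) * cos (a + x \<bullet> h))
    = (LINT x|Q. (W x * indicator A (x \<bullet> k)) * cos (a + x \<bullet> h))"
proof -
  have int: "integrable M (\<lambda>x. W x * g x)"
    if "finite_measure M" "sets M = sets borel" "g \<in> borel_measurable borel" "\<And>x. \<bar>g x\<bar> \<le> 1" for M g
  proof -
    interpret finite_measure M by fact
    have "W \<in> borel_measurable M" "g \<in> borel_measurable M"
      using W that(2,3) by (simp_all cong: measurable_cong_sets)
    then show ?thesis
      by (intro integrable_const_bound[of _ 1]) (use W01 that(4) in \<open>auto simp: abs_mult intro!: mult_le_one\<close>)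
  qed
  \<comment> \<open>The product-to-sum formula reduces cosine integrals against the new weight to
    those of the hypothesis.\<close>
  have expand: "(LINT x|M. (W x * (1 + s * cos (a + x \<bullet> h))) * cos (b + t * (x \<bullet> k)))
     = (LINT x|M. W x * cos (b + x \<bullet> (t *\<^sub>R k)))
       + s / 2 * (LINT x|M. W x * cos ((a - b) + x \<bullet> (h - t *\<^sub>R k)))
       + s / 2 * (LINT x|M. W x * cos ((a + b) + x \<bullet> (h + t *\<^sub>R k)))"
    if M: "finite_measure M" "sets M = sets borel" for M b t s
  proof -
    have "(W x * (1 + s * cos (a + x \<bullet> h))) * cos (b + t * (x \<bullet> k))
      = W x * cos (b + x \<bullet> (t *\<^sub>R k)) + s / 2 * (W x * cos ((a - b) + x \<bullet> (h - t *\<^sub>R k)))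
       + s / 2 * (W x * cos ((a + b) + x \<bullet> (h + t *\<^sub>R k)))" for x
    proof -
      have "cos ((a - b) + x \<bullet> (h - t *\<^sub>R k)) + cos ((a + b) + x \<bullet> (h + t *\<^sub>R k))
        = 2 * (cos (a + x \<bullet> h) * cos (b + t * (x \<bullet> k)))"
        using cos_times_cos[of "a + x \<bullet> h" "b + t * (x \<bullet> k)"]
        by (simp add: inner_simps algebra_simps)
      then have "s / 2 * W x * (cos ((a - b) + x \<bullet> (h - t *\<^sub>R k)) + cos ((a + b) + x \<bullet> (h + t *\<^sub>R k)))
        = s * W x * (cos (a + x \<bullet> h) * cos (b + t * (x \<bullet> k)))" by simp
      then show ?thesis by (simp add: algebra_simps)
    qed
    moreover have "integrable M (\<lambda>x. W x * cos (u + x \<bullet> v))" for u v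
      by (rule int[OF M]) auto
    ultimately show ?thesis by (simp del: cos_add inner_scaleR_right)
  qed
  have PQ: "sets P = sets Q" using P Q by simp
  \<comment> \<open>A weight must be nonnegative, which the cosine is not. So 1 plus the cosine
    (\<open>s = 1\<close>) is used, and the case \<open>s = 0\<close> is subtracted
    afterwards.\<close>
  have eq_s: "(LINT x|P. (W x * (1 + s * cos (a + x \<bullet> h))) * indicator A (x \<bullet> k))
     = (LINT x|Q. (W x * (1 + s * cos (a + x \<bullet> h))) * indicator A (x \<bullet> k))"
    if s: "s = 0 \<or> s = 1" for s
  proof (rule integral_weight_indicator_eqI[OF P(1) Q(1) PQ _ _ _ _ _ A, of _ _ 2])
    show "(\<lambda>x. W x * (1 + s * cos (a + x \<bullet> h))) \<in> borel_measurable P" "(\<lambda>x. x \<bullet> k) \<in> borel_measurable P"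
      using P(2) by (simp_all cong: measurable_cong_sets)
    fix x
    have "0 \<le> 1 + s * cos (a + x \<bullet> h)" "1 + s * cos (a + x \<bullet> h) \<le> 2"
      using s cos_ge_minus_one[of "a + x \<bullet> h"] cos_le_one[of "a + x \<bullet> h"]
      by (elim disjE; simp only: mult_1_left mult_zero_left; linarith)+
    then show "0 \<le> W x * (1 + s * cos (a + x \<bullet> h))" "W x * (1 + s * cos (a + x \<bullet> h)) \<le> 2"
      using W01[of x] mult_mono[of "W x" 1 "1 + s * cos (a + x \<bullet> h)" 2] by auto
  qed (simp only: expand[OF P] expand[OF Q] eq)
  have diff: "(LINT x|M. (W x * indicator A (x \<bullet> k)) * cos (a + x \<bullet> h))
    = (LINT x|M. (W x * (1 + 1 * cos (a + x \<bullet> h))) * indicator A (x \<bullet> k))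
      - (LINT x|M. (W x * (1 + 0 * cos (a + x \<bullet> h))) * indicator A (x \<bullet> k))"
    if M: "finite_measure M" "sets M = sets borel" for M
  proof -
    have "integrable M (\<lambda>x. W x * (indicator A (x \<bullet> k)))"
      "integrable M (\<lambda>x. W x * (cos (a + x \<bullet> h) * indicator A (x \<bullet> k)))"
      by (rule int[OF M]; auto simp: indicator_def)+
    then show ?thesis
      by (simp add: algebra_simps flip: Bochner_Integration.integral_diff)
  qed
  show ?thesis unfolding diff[OF P] diff[OF Q] using eq_s[of 0] eq_s[of 1] by simp
qed

text \<open>Indicators of the coordinates of a cylinder are inserted into the cosine integrals one
  at a time; agreement on the intersection-stable generator of cylinders then identifies the
  measures.\<close>

theorem characteristic_functional_eqI:
  fixes P Q :: "'a::{real_inner, second_countable_topology} measure"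
  assumes P: "prob_space P" "sets P = sets borel" and Q: "prob_space Q" "sets Q = sets borel"
    and eq: "\<And>h. (CLINT x|P. iexp (x \<bullet> h)) = (CLINT x|Q. iexp (x \<bullet> h))"
  shows "P = Q"
proof -
  interpret P: prob_space P by fact
  interpret Q: prob_space Q by fact
  have fP: "finite_measure P" and fQ: "finite_measure Q" by unfold_locales
  have cos_char: "(LINT x|M. cos (a + x \<bullet> k)) = Re (exp (\<i> * a) * (CLINT x|M. iexp (x \<bullet> k)))"
    if M: "prob_space M" "sets M = sets borel" for M a k
  proof -
    have "(\<lambda>x. x \<bullet> k) \<in> borel_measurable M"
      unfolding measurable_cong_sets[OF M(2) refl] by (rule borel_measurable_inner_left)
    then have i: "integrable M (\<lambda>x. exp (\<i> * a) * iexp (x \<bullet> k))"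
      by (intro integrable_mult_right prob_space.integrable_iexp[OF M(1)]) auto
    have "cos (a + x \<bullet> k) = Re (exp (\<i> * a) * iexp (x \<bullet> k))" for x
      by (simp add: exp_add[symmetric] distrib_left[symmetric] of_real_add[symmetric] Re_exp del: of_real_add)
    then have "(LINT x|M. cos (a + x \<bullet> k)) = Re (CLINT x|M. exp (\<i> * a) * iexp (x \<bullet> k))"
      by (simp only: integral_Re[OF i])
    then show ?thesis by simp
  qed
  \<comment> \<open>The cosine factor is carried along for the induction; it becomes 1 at
    \<open>a = 0\<close> and \<open>h = 0\<close>.\<close>
  have cyl: "(LINT x|P. indicator {x. \<forall>(k, A)\<in>F. x \<bullet> k \<in> A} x * cos (a + x \<bullet> h))
      = (LINT x|Q. indicator {x. \<forall>(k, A)\<in>F. x \<bullet> k \<in> A} x * cos (a + x \<bullet> h))"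
    if "finite F" "\<forall>(k, A)\<in>F. A \<in> sets borel" for F a h
    using that
  proof (induction F arbitrary: a h rule: finite_induct)
    case empty
    then show ?case using cos_char[OF P] cos_char[OF Q] eq by simp
  next
    case (insert p F)
    obtain k A where p: "p = (k, A)" by (cases p)
    let ?W = "indicator {x. \<forall>(k, A)\<in>F. x \<bullet> k \<in> A} :: 'a \<Rightarrow> real"
    have "{x. \<forall>(k, A)\<in>F. x \<bullet> k \<in> A} \<in> cylinders"
      using insert by (auto simp: cylinders_def)
    then have W: "?W \<in> borel_measurable borel" using cylinders_borel by (intro borel_measurable_indicator) auto
    have "(LINT x|P. (?W x * indicator A (x \<bullet> k)) * cos (a + x \<bullet> h))
        = (LINT x|Q. (?W x * indicator A (x \<bullet> k)) * cos (a + x \<bullet> h))"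
      by (rule cos_integral_indicator_step[OF fP P(2) fQ Q(2) W])
        (use insert p in auto)
    moreover have "indicator {x. \<forall>(k, A)\<in>insert p F. x \<bullet> k \<in> A} x = ?W x * indicator A (x \<bullet> k)" for x
      by (auto simp: p indicator_def)
    ultimately show ?case by simp
  qed
  have "measure P X = measure Q X" if "X \<in> cylinders" for X
  proof -
    from that obtain F where XF: "X = {x. \<forall>(k, A)\<in>F. x \<bullet> k \<in> A} \<and> finite F \<and> (\<forall>(k, A)\<in>F. A \<in> sets borel)"
      unfolding cylinders_def mem_Collect_eq ..
    note X = conjunct1[OF XF] and F = conjunct1[OF conjunct2[OF XF]] conjunct2[OF conjunct2[OF XF]]
    have "X \<in> sets borel" using that cylinders_borel by auto
    then show ?thesis using cyl[OF F, of 0 0] P(2) Q(2) by (simp add: X[symmetric])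
  qed
  then have em: "emeasure P X = emeasure Q X" if "X \<in> cylinders" for X
    using that by (simp add: P.emeasure_eq_measure Q.emeasure_eq_measure)
  show ?thesis
  proof (rule measure_eqI_generator_eq[OF Int_stable_cylinders _ em])
    show "range (\<lambda>_::nat. UNIV) \<subseteq> cylinders"
      unfolding cylinders_def by (auto intro!: exI[of _ "{}"])
  qed (auto simp: P(2) Q(2) borel_eq_sigma_cylinders P.emeasure_eq_measure)
qed

section \<open>Centred Gaussian measures\<close>

lemma char_normal_density:
  assumes "0 < s"
  shows "char (density lborel (normal_density 0 s)) t = of_real (exp (- (s\<^sup>2 * t\<^sup>2) / 2))"
proof -
  define N where "N = density lborel (normal_density 0 s)"
  interpret N: prob_space N unfolding N_def by (rule prob_space_normal_density) fact
  have "distributed N lborel (\<lambda>x. x) (normal_density 0 s)"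
    by (auto simp: distributed_def N_def distr_id2)
  then have "distributed N lborel (\<lambda>x. x / s) std_normal_density"
    using N.normal_standard_normal_convert[OF assms, of "\<lambda>x. x" 0] by simp
  then have eq: "distr N lborel (\<lambda>x. x / s) = std_normal_distribution"
    by (simp add: distributed_def)
  have "char N t = (CLINT x|distr N lborel (\<lambda>x. x / s). iexp ((s * t) * x))"
    using assms unfolding char_def by (subst integral_distr) (simp_all add: N_def mult_ac)
  also have "\<dots> = char std_normal_distribution (s * t)" unfolding eq char_def ..
  finally show ?thesis by (simp add: char_std_normal_distribution N_def power_mult_distrib)
qed

text \<open>The two intervals differ in sets of equal length, on which the density is at most,
  respectively at least, its value at the endpoint \<open>r\<close>.\<close>

lemma normal_shifted_interval_le:
  fixes a c d s :: real
  assumes "0 < s"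
  shows "(\<integral>\<^sup>+r. indicator {r. c + (r - a)\<^sup>2 \<le> d} r \<partial>density lborel (normal_density 0 s))
    \<le> (\<integral>\<^sup>+r. indicator {r. c + r\<^sup>2 \<le> d} r \<partial>density lborel (normal_density 0 s))"
proof (cases "c \<le> d")
  case False
  have "\<not> c + v\<^sup>2 \<le> d" for v using False zero_le_power2[of v] by linarith
  then show ?thesis by simp
next
  case True
  define \<rho> where "\<rho> = sqrt (d - c)"
  have \<rho>: "0 \<le> \<rho>" "\<rho>\<^sup>2 = d - c" using True by (auto simp: \<rho>_def)
  define N where "N = density lborel (normal_density 0 s)"
  define A where "A = {a - \<rho>..a + \<rho>}"
  define B where "B = {- \<rho>..\<rho>}"
  have AB: "{r. c + (r - a)\<^sup>2 \<le> d} = A" "{r. c + r\<^sup>2 \<le> d} = B"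
  proof -
    have *: "c + v\<^sup>2 \<le> d \<longleftrightarrow> \<bar>v\<bar> \<le> \<rho>" for v
      using \<rho> abs_le_square_iff[of v \<rho>] by auto
    show "{r. c + (r - a)\<^sup>2 \<le> d} = A" "{r. c + r\<^sup>2 \<le> d} = B"
      unfolding * A_def B_def by (auto simp: abs_le_iff)
  qed
  have sets[measurable]: "A \<in> sets borel" "B \<in> sets borel" by (auto simp: A_def B_def)
  define \<phi> where "\<phi> = normal_density 0 s \<rho>"
  have mono: "normal_density 0 s u \<le> normal_density 0 s v" if "\<bar>v\<bar> \<le> \<bar>u\<bar>" for u v
    using that assms by (auto simp: normal_density_def intro!: divide_right_mono mult_left_mono abs_le_square_iff[THEN iffD1])
  have "emeasure lborel A = emeasure lborel B" using \<rho> by (simp add: A_def B_def)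
  moreover have fin: "emeasure lborel (A \<inter> B) \<noteq> \<infinity>"
    by (simp add: A_def B_def Int_atLeastAtMost emeasure_lborel_Icc_eq)
  ultimately have leb: "emeasure lborel (A - B) = emeasure lborel (B - A)"
    using emeasure_Diff[OF fin, of A] emeasure_Diff[OF fin, of B] sets
    by (simp add: Diff_Int Int_commute)
  have "emeasure N (A - B) = (\<integral>\<^sup>+r. ennreal (normal_density 0 s r) * indicator (A - B) r \<partial>lborel)"
    unfolding N_def by (subst emeasure_density) auto
  also have "\<dots> \<le> (\<integral>\<^sup>+r. ennreal \<phi> * indicator (A - B) r \<partial>lborel)"
    unfolding \<phi>_def using \<rho> by (intro nn_integral_mono) (auto simp: indicator_def A_def B_def intro!: ennreal_leI mono)
  also have "\<dots> = (\<integral>\<^sup>+r. ennreal \<phi> * indicator (B - A) r \<partial>lborel)"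
    by (simp add: nn_integral_cmult leb)
  also have "\<dots> \<le> (\<integral>\<^sup>+r. ennreal (normal_density 0 s r) * indicator (B - A) r \<partial>lborel)"
    unfolding \<phi>_def using \<rho> by (intro nn_integral_mono) (auto simp: indicator_def A_def B_def intro!: ennreal_leI mono)
  also have "\<dots> = emeasure N (B - A)" unfolding N_def by (subst emeasure_density) auto
  finally have le: "emeasure N (A - B) \<le> emeasure N (B - A)" .
  have "emeasure N A = emeasure N (A \<inter> B) + emeasure N (A - B)"
    by (subst plus_emeasure) (auto simp: N_def Int_Diff_Un)
  also have "\<dots> \<le> emeasure N (A \<inter> B) + emeasure N (B - A)" using le by (rule add_left_mono)
  also have "\<dots> = emeasure N B" by (subst plus_emeasure) (auto simp: N_def Int_commute intro!: arg_cong[of _ _ "emeasure _"])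
  finally show ?thesis unfolding AB by (simp add: N_def)
qed

locale centered_gaussian =
  fixes M :: "'a::{real_inner, complete_space, second_countable_topology} measure" and S :: "'a \<Rightarrow> 'a"
  assumes gaussian: "gaussian_measure M" and centered: "centered M" and cov: "covariance_operator M S"
begin

sublocale prob_space M using gaussian by (simp add: gaussian_measure_def)

lemma sets_M[simp, measurable_cong]: "sets M = sets borel"
  using gaussian by (simp add: gaussian_measure_def)

lemma space_M[simp]: "space M = UNIV"
  using sets_eq_imp_space_eq[OF sets_M] by simp

lemma bounded_linear_S: "bounded_linear S"
  using cov by (simp add: covariance_operator_def)

lemma S_inner: "S g \<bullet> h = (LINT x|M. (x \<bullet> g) * (x \<bullet> h))"
  using cov centered by (simp add: covariance_operator_def centered_def)

lemma S_sym: "S g \<bullet> h = g \<bullet> S h"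
  using S_inner[of g h] S_inner[of h g] by (simp add: mult.commute inner_commute)

lemma S_nonneg: "0 \<le> S g \<bullet> g"
  unfolding S_inner by simp

lemma self_adjoint_S: "self_adjoint S"
  by (simp add: self_adjoint_def bounded_linear_S S_sym)

lemma positive_op_S: "positive_op S"
  by (simp add: positive_op_def S_nonneg)

text \<open>A real Gaussian law is determined by its mean, here 0, and its variance, here
  \<open>S h \<bullet> h\<close>; variance zero is the point mass.\<close>

lemma marginal:
  "distr M borel (\<lambda>x. x \<bullet> h) =
    (if S h \<bullet> h = 0 then return borel 0 else density lborel (normal_density 0 (sqrt (S h \<bullet> h))))"
proof -
  have mean: "(LINT r|distr M borel (\<lambda>x. x \<bullet> h). r) = 0"
    using centered by (subst integral_distr) (auto simp: centered_def)
  have var: "(LINT r|distr M borel (\<lambda>x. x \<bullet> h). r\<^sup>2) = S h \<bullet> h"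
    by (subst integral_distr) (auto simp: S_inner power2_eq_square)
  have "real_gaussian (distr M borel (\<lambda>x. x \<bullet> h))" using gaussian by (simp add: gaussian_measure_def)
  then consider m s where "s > 0" "distr M borel (\<lambda>x. x \<bullet> h) = density lborel (normal_density m s)"
    | m where "distr M borel (\<lambda>x. x \<bullet> h) = return borel m"
    unfolding real_gaussian_def by blast
  then show ?thesis
  proof cases
    case 1
    have "(LINT r|density lborel (normal_density m s). r) = m"
      using normal_moment_nz_1[OF \<open>s > 0\<close>, of m]
      by (subst integral_density) (auto dest: has_bochner_integral_integral_eq)
    then have m: "m = 0" using mean 1 by simp
    have "(LINT r|density lborel (normal_density 0 s). r\<^sup>2) = s\<^sup>2"
      using integral_normal_moment_even[OF \<open>s > 0\<close>, of 0 1]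
      by (subst integral_density) (auto simp: fact_numeral)
    then have "S h \<bullet> h = s\<^sup>2" using var 1 m by simp
    then show ?thesis using 1 m by simp
  next
    case 2
    then have "m = 0" using mean by (simp add: integral_return)
    then have "S h \<bullet> h = 0" using var 2 by (simp add: integral_return)
    then show ?thesis using 2 \<open>m = 0\<close> by simp
  qed
qed

lemma charfun: "(CLINT x|M. iexp (x \<bullet> h)) = of_real (exp (- (S h \<bullet> h) / 2))"
proof -
  have "(CLINT x|M. iexp (x \<bullet> h)) = char (distr M borel (\<lambda>x. x \<bullet> h)) 1"
    unfolding char_def by (subst integral_distr) auto
  also have "\<dots> = of_real (exp (- (S h \<bullet> h) / 2))"
  proof (cases "S h \<bullet> h = 0")
    case True
    then show ?thesis unfolding marginal by (simp add: char_def integral_return)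
  next
    case False
    then have "0 < S h \<bullet> h" using S_nonneg[of h] by linarith
    then show ?thesis using False unfolding marginal by (simp add: char_normal_density del: of_real_exp)
  qed
  finally show ?thesis .
qed

section \<open>Splitting off one coordinate and the Cameron-Martin formula\<close>

text \<open>The remainder of the linear regression of \<open>x\<close> on the coordinate
  \<open>x \<bullet> g\<close>. It is uncorrelated with that coordinate if
  \<open>S g \<bullet> g > 0\<close>.\<close>

definition residual :: "'a \<Rightarrow> 'a \<Rightarrow> 'a" where
  "residual g x = x - ((x \<bullet> g) / (S g \<bullet> g)) *\<^sub>R S g"

lemma residual_measurable[measurable]: "residual g \<in> borel_measurable borel"
  unfolding residual_def divide_inverse by (intro borel_measurable_continuous_onI continuous_intros) 

text \<open>Both sides have the same characteristic functional on the product space, because the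
  covariance between residual and coordinate vanishes and the exponent splits.\<close>

lemma independent_residual:
  assumes q: "0 < S g \<bullet> g"
  shows "distr M (borel \<Otimes>\<^sub>M borel) (\<lambda>x. (residual g x, x \<bullet> g))
    = distr M borel (residual g) \<Otimes>\<^sub>M distr M borel (\<lambda>x. x \<bullet> g)" (is "?J = ?P \<Otimes>\<^sub>M ?N")
proof (rule characteristic_functional_eqI)
  interpret S: bounded_linear S by (rule bounded_linear_S)
  interpret P: prob_space ?P by (rule prob_space_distr) simp
  interpret N: prob_space ?N by (rule prob_space_distr) simp
  interpret PN: pair_prob_space ?P ?N ..
  show "prob_space ?J" by (rule prob_space_distr) simp
  show "prob_space (?P \<Otimes>\<^sub>M ?N)" by unfold_locales
  show "sets ?J = sets borel" by (simp add: borel_prod)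
  show "sets (?P \<Otimes>\<^sub>M ?N) = sets borel" unfolding borel_prod[symmetric] by (intro sets_pair_measure_cong) auto
  fix p :: "'a \<times> real"
  obtain k t where p: "p = (k, t)" by (cases p)
  \<comment> \<open>Pairing the residual with \<open>k\<close> amounts to pairing \<open>x\<close>
    with \<open>k'\<close>, and \<open>\<alpha>\<close> makes \<open>k'\<close> orthogonal to
    \<open>g\<close> for the covariance form.\<close>
  define \<alpha> where "\<alpha> = (S g \<bullet> k) / (S g \<bullet> g)"
  define k' where "k' = k - \<alpha> *\<^sub>R g"
  have res: "residual g x \<bullet> k = x \<bullet> k'" for x
    by (simp add: residual_def k'_def \<alpha>_def inner_diff_left inner_diff_right)
  have orth: "S k' \<bullet> g = 0" "S g \<bullet> k' = 0"
    using q by (simp_all add: k'_def \<alpha>_def S.diff S.scaleR inner_diff_left inner_diff_right S_sym[of k g] inner_commute[of k])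
  have [measurable]: "(\<lambda>z. iexp (z \<bullet> p)) \<in> borel_measurable (borel \<Otimes>\<^sub>M borel)"
    unfolding borel_prod by (intro borel_measurable_continuous_onI continuous_intros)
  have "(CLINT z|?J. iexp (z \<bullet> p)) = (CLINT x|M. iexp (x \<bullet> (k' + t *\<^sub>R g)))"
    by (subst integral_distr) (simp_all, simp add: p res inner_add_right mult.commute)
  also have "\<dots> = of_real (exp (- (S k' \<bullet> k') / 2)) * of_real (exp (- (S (t *\<^sub>R g) \<bullet> (t *\<^sub>R g)) / 2))"
    unfolding charfun of_real_mult[symmetric] exp_add[symmetric]
    by (simp add: S.add S.scaleR inner_add_left inner_add_right orth field_simps del: of_real_exp)
  also have "\<dots> = (CLINT x|M. iexp (x \<bullet> k')) * (CLINT x|M. iexp (x \<bullet> (t *\<^sub>R g)))"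
    unfolding charfun ..
  also have "\<dots> = (CLINT a|?P. iexp (a \<bullet> k)) * (CLINT r|?N. iexp (r * t))"
    by (subst (1 2) integral_distr) (auto simp: res mult.commute)
  also have "\<dots> = (CLINT a|?P. CLINT r|?N. iexp (a \<bullet> k) * iexp (r * t))" by simp
  also have "\<dots> = (CLINT a|?P. CLINT r|?N. iexp ((a, r) \<bullet> p))"
    by (simp add: p exp_add[symmetric] distrib_left)
  also have "\<dots> = (CLINT z|?P \<Otimes>\<^sub>M ?N. iexp (z \<bullet> p))"
  proof (rule PN.integral_fst')
    have "(\<lambda>z. complex_of_real (z \<bullet> p)) \<in> borel_measurable (borel \<Otimes>\<^sub>M borel)"
      unfolding borel_prod by (intro borel_measurable_continuous_onI continuous_intros)
    then have "(\<lambda>z. complex_of_real (z \<bullet> p)) \<in> borel_measurable (?P \<Otimes>\<^sub>M ?N)"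
      by (simp cong: measurable_cong_sets sets_pair_measure_cong)
    then show "integrable (?P \<Otimes>\<^sub>M ?N) (\<lambda>z. iexp (z \<bullet> p))" by (intro PN.integrable_iexp) auto
  qed
  finally show "(CLINT z|?J. iexp (z \<bullet> p)) = (CLINT z|?P \<Otimes>\<^sub>M ?N. iexp (z \<bullet> p))" .
qed

text \<open>Fubini for the independent pair: it reduces both the Cameron-Martin formula and
  Anderson's inequality to integrals over one normal variable.\<close>

lemma nn_integral_residual:
  assumes q: "0 < S g \<bullet> g" and f[measurable]: "(\<lambda>(a, r). f a r) \<in> borel_measurable (borel \<Otimes>\<^sub>M borel)"
  shows "(\<integral>\<^sup>+x. f (residual g x) (x \<bullet> g) \<partial>M)
    = (\<integral>\<^sup>+x. (\<integral>\<^sup>+r. f (residual g x) r \<partial>density lborel (normal_density 0 (sqrt (S g \<bullet> g)))) \<partial>M)"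
proof -
  let ?P = "distr M borel (residual g)" and ?N = "distr M borel (\<lambda>x. x \<bullet> g)"
  interpret N: prob_space ?N by (rule prob_space_distr) simp
  have N: "?N = density lborel (normal_density 0 (sqrt (S g \<bullet> g)))" using q by (simp add: marginal)
  have [measurable]: "(\<lambda>(a, r). f a r) \<in> borel_measurable (?P \<Otimes>\<^sub>M ?N)"
    using f by (simp cong: measurable_cong_sets sets_pair_measure_cong)
  have "(\<integral>\<^sup>+x. f (residual g x) (x \<bullet> g) \<partial>M)
    = (\<integral>\<^sup>+z. (\<lambda>(a, r). f a r) z \<partial>distr M (borel \<Otimes>\<^sub>M borel) (\<lambda>x. (residual g x, x \<bullet> g)))"
    by (subst nn_integral_distr) auto
  also have "\<dots> = (\<integral>\<^sup>+a. (\<integral>\<^sup>+r. f a r \<partial>?N) \<partial>?P)"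
    unfolding independent_residual[OF q] by (subst N.nn_integral_fst[symmetric]) auto
  also have "\<dots> = (\<integral>\<^sup>+x. (\<integral>\<^sup>+r. f (residual g x) r \<partial>?N) \<partial>M)"
    by (subst nn_integral_distr) auto
  finally show ?thesis unfolding N .
qed

text \<open>Subtracting \<open>S g\<close> lowers the coordinate \<open>x \<bullet> g\<close> by
  \<open>q = S g \<bullet> g\<close> and leaves the residual unchanged, so only a one-dimensional
  normal density of variance \<open>q\<close> is shifted.\<close>

lemma cameron_martin:
  assumes A[measurable]: "A \<in> sets borel"
  shows "emeasure M {x. x - S g \<in> A}
    = (\<integral>\<^sup>+x. indicator A x * ennreal (exp (- (x \<bullet> g) - (S g \<bullet> g) / 2)) \<partial>M)"
proof (cases "S g \<bullet> g = 0")
  case True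
  interpret S: bounded_linear S by (rule bounded_linear_S)
  have "AE r in distr M borel (\<lambda>x. x \<bullet> g). r = 0" using True unfolding marginal by (simp add: AE_return)
  then have ae: "AE x in M. x \<bullet> g = 0" by (subst (asm) AE_distr_iff) auto
  \<comment> \<open>In the degenerate case \<open>S g\<close> itself is zero: its pairing with any
    vector is an integral with the factor \<open>x \<bullet> g\<close>.\<close>
  have "S g \<bullet> S g = 0" unfolding S_inner[of g] using ae by (intro integral_eq_zero_AE) auto
  then have "emeasure M {x. x - S g \<in> A} = (\<integral>\<^sup>+x. indicator A x \<partial>M)" by simp
  also have "\<dots> = (\<integral>\<^sup>+x. indicator A x * ennreal (exp (- (x \<bullet> g) - (S g \<bullet> g) / 2)) \<partial>M)"
    using ae by (intro nn_integral_cong_AE) (auto simp: True)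
  finally show ?thesis .
next
  case False
  define q where "q = S g \<bullet> g"
  have q: "0 < q" using False S_nonneg[of g] by (simp add: q_def)
  define \<phi> where "\<phi> = normal_density 0 (sqrt q)"
  have \<phi>_shift: "\<phi> (q + r) = exp (- r - q / 2) * \<phi> r" for r
  proof -
    have "- (q + r)\<^sup>2 / (2 * q) = (- r - q / 2) + - r\<^sup>2 / (2 * q)"
      using q by (simp add: field_simps power2_eq_square)
    then show ?thesis using q by (simp add: \<phi>_def normal_density_def exp_add[symmetric])
  qed
  have [measurable]: "\<phi> \<in> borel_measurable borel" by (simp add: \<phi>_def)
  have dec: "x = residual g x + ((x \<bullet> g) / q) *\<^sub>R S g" for x by (simp add: residual_def q_def)
  have dec': "x - S g = residual g x + ((x \<bullet> g - q) / q) *\<^sub>R S g" for x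
    using q by (subst dec[of x]) (simp add: diff_divide_distrib scaleR_diff_left)
  have "{x. x - S g \<in> A} \<in> sets M" by measurable
  then have "emeasure M {x. x - S g \<in> A} = (\<integral>\<^sup>+x. indicator {x. x - S g \<in> A} x \<partial>M)" by simp
  also have "\<dots> = (\<integral>\<^sup>+x. indicator A (x - S g) \<partial>M)"
    by (intro nn_integral_cong) (simp add: indicator_def)
  also have "\<dots> = (\<integral>\<^sup>+x. (\<lambda>a r. indicator A (a + ((r - q) / q) *\<^sub>R S g)) (residual g x) (x \<bullet> g) \<partial>M)"
    by (simp add: dec')
  also have "\<dots> = (\<integral>\<^sup>+x. (\<integral>\<^sup>+r. indicator A (residual g x + ((r - q) / q) *\<^sub>R S g) \<partial>density lborel \<phi>) \<partial>M)"
    unfolding \<phi>_def q_def by (subst nn_integral_residual) (use q in \<open>auto simp: q_def\<close>)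
  also have "\<dots> = (\<integral>\<^sup>+x. (\<integral>\<^sup>+r. indicator A (residual g x + (r / q) *\<^sub>R S g) * ennreal (exp (- r - q / 2)) \<partial>density lborel \<phi>) \<partial>M)"
  proof (rule nn_integral_cong)
    fix x
    have "(\<integral>\<^sup>+r. indicator A (residual g x + ((r - q) / q) *\<^sub>R S g) \<partial>density lborel \<phi>)
      = (\<integral>\<^sup>+r. ennreal (\<phi> r) * indicator A (residual g x + ((r - q) / q) *\<^sub>R S g) \<partial>lborel)"
      by (subst nn_integral_density) auto
    \<comment> \<open>Substitution of \<open>q + r\<close> for \<open>r\<close>; the density ratio
      is then \<open>\<phi>_shift\<close>.\<close>
    also have "\<dots> = (\<integral>\<^sup>+r. ennreal (\<phi> (q + r)) * indicator A (residual g x + (r / q) *\<^sub>R S g) \<partial>lborel)"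
      by (subst nn_integral_real_affine[where c = 1 and t = q]) auto
    also have "\<dots> = (\<integral>\<^sup>+r. ennreal (\<phi> r) * (indicator A (residual g x + (r / q) *\<^sub>R S g) * ennreal (exp (- r - q / 2))) \<partial>lborel)"
    proof (intro nn_integral_cong)
      fix r
      have "0 \<le> \<phi> r" by (simp add: \<phi>_def)
      then have "ennreal (\<phi> (q + r)) = ennreal (exp (- r - q / 2)) * ennreal (\<phi> r)"
        unfolding \<phi>_shift by (simp add: ennreal_mult)
      then show "ennreal (\<phi> (q + r)) * indicator A (residual g x + (r / q) *\<^sub>R S g)
        = ennreal (\<phi> r) * (indicator A (residual g x + (r / q) *\<^sub>R S g) * ennreal (exp (- r - q / 2)))"
        by (simp only: mult_ac)
    qed
    also have "\<dots> = (\<integral>\<^sup>+r. indicator A (residual g x + (r / q) *\<^sub>R S g) * ennreal (exp (- r - q / 2)) \<partial>density lborel \<phi>)"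
      by (subst nn_integral_density) auto
    finally show "(\<integral>\<^sup>+r. indicator A (residual g x + ((r - q) / q) *\<^sub>R S g) \<partial>density lborel \<phi>)
      = (\<integral>\<^sup>+r. indicator A (residual g x + (r / q) *\<^sub>R S g) * ennreal (exp (- r - q / 2)) \<partial>density lborel \<phi>)" .
  qed
  also have "\<dots> = (\<integral>\<^sup>+x. (\<lambda>a r. indicator A (a + (r / q) *\<^sub>R S g) * ennreal (exp (- r - q / 2))) (residual g x) (x \<bullet> g) \<partial>M)"
    unfolding \<phi>_def q_def by (subst nn_integral_residual) (use q in \<open>auto simp: q_def\<close>)
  also have "\<dots> = (\<integral>\<^sup>+x. indicator A x * ennreal (exp (- (x \<bullet> g) - q / 2)) \<partial>M)"
    by (simp add: dec[symmetric])
  finally show ?thesis unfolding q_def .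
qed

text \<open>For a fixed residual both conditions define intervals of the same length for the
  coordinate, and the one centred at 0 has the larger normal measure.\<close>

lemma shift_coordinate_le:
  assumes q: "0 < S g \<bullet> g" and T[measurable]: "T \<in> borel_measurable borel"
  shows "emeasure M {x. T (residual g x) + (x \<bullet> g - a)\<^sup>2 \<le> (d::real)}
    \<le> emeasure M {x. T (residual g x) + (x \<bullet> g)\<^sup>2 \<le> d}"
proof -
  have *: "emeasure M {x. T (residual g x) + (x \<bullet> g - a)\<^sup>2 \<le> d}
    = (\<integral>\<^sup>+x. (\<integral>\<^sup>+r. indicator {r. T (residual g x) + (r - a)\<^sup>2 \<le> d} r \<partial>density lborel (normal_density 0 (sqrt (S g \<bullet> g)))) \<partial>M)" for a
  proof -
    let ?X = "{x. T (residual g x) + (x \<bullet> g - a)\<^sup>2 \<le> d}"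
    have "?X \<in> sets M" by measurable
    then have "emeasure M ?X = (\<integral>\<^sup>+x. indicator ?X x \<partial>M)" by simp
    also have "\<dots> = (\<integral>\<^sup>+x. (\<lambda>p r. indicator {r. T p + (r - a)\<^sup>2 \<le> d} r) (residual g x) (x \<bullet> g) \<partial>M)"
      by (intro nn_integral_cong) (simp add: indicator_def)
    also have "\<dots> = (\<integral>\<^sup>+x. (\<integral>\<^sup>+r. indicator {r. T (residual g x) + (r - a)\<^sup>2 \<le> d} r \<partial>density lborel (normal_density 0 (sqrt (S g \<bullet> g)))) \<partial>M)"
      by (rule nn_integral_residual[OF q]) (simp add: indicator_def case_prod_unfold)
    finally show ?thesis .
  qed
  show ?thesis
    unfolding * *[of 0, unfolded diff_zero]
    by (intro nn_integral_mono normal_shifted_interval_le) (use q in simp)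
qed

end

section \<open>Diagonalization of a quadratic form in finite dimension\<close>

text \<open>Proved by adding a compact segment for each vector, since the ambient space need not
  have the Heine-Borel property.\<close>

lemma compact_bounded_combinations:
  fixes C :: "'a::real_normed_vector set"
  assumes "finite C"
  shows "compact ((\<lambda>a. \<Sum>c\<in>C. a c *\<^sub>R c) ` {a. \<forall>c\<in>C. \<bar>a c\<bar> \<le> r c})"
  using assms
proof (induction C)
  case empty
  have "(\<lambda>a::'a \<Rightarrow> real. \<Sum>c\<in>{}. a c *\<^sub>R c) ` {a. \<forall>c\<in>{}. \<bar>a c\<bar> \<le> r c} = {0}" by auto
  then show ?case by (metis compact_sing)
next
  case (insert c C)
  let ?K = "\<lambda>C. (\<lambda>a. \<Sum>c\<in>C. a c *\<^sub>R c) ` {a. \<forall>c\<in>C. \<bar>a c\<bar> \<le> r c}"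
  have "?K (insert c C) = (\<Union>x\<in>(\<lambda>t. t *\<^sub>R c) ` {- r c..r c}. \<Union>y\<in>?K C. {x + y})"
  proof (intro subset_antisym subsetI)
    fix v assume "v \<in> ?K (insert c C)"
    then obtain a where a: "\<forall>d\<in>insert c C. \<bar>a d\<bar> \<le> r d" "v = (\<Sum>d\<in>insert c C. a d *\<^sub>R d)" by blast
    then have "v = a c *\<^sub>R c + (\<Sum>d\<in>C. a d *\<^sub>R d)" using insert by simp
    moreover have "a c \<in> {- r c..r c}" using a by (auto simp: abs_le_iff)
    moreover have "(\<Sum>d\<in>C. a d *\<^sub>R d) \<in> ?K C" using a by blast
    ultimately show "v \<in> (\<Union>x\<in>(\<lambda>t. t *\<^sub>R c) ` {- r c..r c}. \<Union>y\<in>?K C. {x + y})" by blast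
  next
    fix v assume "v \<in> (\<Union>x\<in>(\<lambda>t. t *\<^sub>R c) ` {- r c..r c}. \<Union>y\<in>?K C. {x + y})"
    then obtain t a where ta: "t \<in> {- r c..r c}" "\<forall>d\<in>C. \<bar>a d\<bar> \<le> r d"
      "v = t *\<^sub>R c + (\<Sum>d\<in>C. a d *\<^sub>R d)" by blast
    have "v = (\<Sum>d\<in>insert c C. (a(c := t)) d *\<^sub>R d)"
    proof -
      have "(\<Sum>d\<in>C. (a(c := t)) d *\<^sub>R d) = (\<Sum>d\<in>C. a d *\<^sub>R d)"
        using insert by (intro sum.cong) auto
      then show ?thesis using insert ta by simp
    qed
    moreover have "\<forall>d\<in>insert c C. \<bar>(a(c := t)) d\<bar> \<le> r d" using ta by (auto simp: abs_le_iff)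
    ultimately show "v \<in> ?K (insert c C)" by blast
  qed
  moreover have "compact ((\<lambda>t. t *\<^sub>R c) ` {- r c..r c})"
    by (intro compact_continuous_image continuous_intros) auto
  ultimately show ?case using insert.IH by (simp only: compact_sums')
qed

text \<open>By Cauchy-Schwarz the coefficients of a unit vector in an orthogonal basis are at most
  \<open>1 / norm c\<close>, so the sphere is a closed part of a compact set of
  combinations.\<close>

lemma compact_span_sphere:
  fixes D :: "'a::real_inner set"
  assumes "finite D"
  shows "compact (span D \<inter> sphere 0 1)"
proof -
  obtain C0 where C0: "finite C0" "span C0 = span D" "pairwise orthogonal C0"
    using basis_orthogonal[OF assms] by blast
  define C where "C = C0 - {0}"
  have C: "finite C" "span C = span D" "pairwise orthogonal C" "0 \<notin> C"
    using C0 by (auto simp: C_def intro: pairwise_mono)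
  let ?K = "(\<lambda>a. \<Sum>c\<in>C. a c *\<^sub>R c) ` {a. \<forall>c\<in>C. \<bar>a c\<bar> \<le> 1 / norm c}"
  have "span D \<inter> sphere 0 1 = ?K \<inter> sphere 0 1"
  proof (intro subset_antisym subsetI)
    fix v assume v: "v \<in> span D \<inter> sphere 0 1"
    then obtain a where a: "v = (\<Sum>c\<in>C. a c *\<^sub>R c)" using span_finite[OF C(1)] C(2) by auto
    have "\<bar>a c\<bar> \<le> 1 / norm c" if c: "c \<in> C" for c
    proof -
      have "v \<bullet> c = (\<Sum>d\<in>C. if d = c then a c * (c \<bullet> c) else 0)"
        unfolding a inner_sum_left
        using C(3) c by (intro sum.cong) (auto simp: pairwise_def orthogonal_def)
      also have "\<dots> = a c * (c \<bullet> c)" using c C(1) by simp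
      finally have "\<bar>a c * (c \<bullet> c)\<bar> \<le> norm v * norm c" by (metis Cauchy_Schwarz_ineq2)
      then have "(\<bar>a c\<bar> * norm c) * norm c \<le> 1 * norm c"
        using v by (simp add: abs_mult power2_norm_eq_inner[symmetric] power2_eq_square)
      moreover have "0 < norm c" using c C(4) by auto
      ultimately show ?thesis by (simp add: pos_le_divide_eq)
    qed
    then show "v \<in> ?K \<inter> sphere 0 1" using a v by blast
  next
    fix v assume "v \<in> ?K \<inter> sphere 0 1"
    moreover have "(\<Sum>c\<in>C. a c *\<^sub>R c) \<in> span D" for a
      unfolding C(2)[symmetric] by (intro span_sum span_scale span_base)
    ultimately show "v \<in> span D \<inter> sphere 0 1" by blast
  qed
  moreover have "compact (?K \<inter> sphere 0 1)"
    by (intro compact_Int_closed compact_bounded_combinations C)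
      (auto simp: sphere_def intro!: closed_Collect_eq continuous_intros)
  ultimately show ?thesis by simp
qed

text \<open>\<open>f\<close> maximizes the Rayleigh quotient on the unit sphere of
  \<open>span D\<close>; the first variation vanishes in all directions orthogonal to
  \<open>f\<close>.\<close>

lemma rayleigh_maximizer:
  fixes S :: "'a::real_inner \<Rightarrow> 'a"
  assumes S: "bounded_linear S" and sym: "\<And>x y. S x \<bullet> y = x \<bullet> S y"
    and D: "finite D" and ne: "x \<in> span D" "x \<noteq> 0"
  obtains f where "f \<in> span D" "norm f = 1" "\<And>v. v \<in> span D \<Longrightarrow> f \<bullet> v = 0 \<Longrightarrow> S f \<bullet> v = 0"
proof -
  interpret bounded_linear S by fact
  have "(1 / norm x) *\<^sub>R x \<in> span D \<inter> sphere 0 1" using ne by (auto intro: span_scale)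
  then have ne': "span D \<inter> sphere 0 1 \<noteq> {}" by blast
  have "continuous_on (span D \<inter> sphere 0 1) (\<lambda>v. S v \<bullet> v)"
    by (intro continuous_intros continuous_on)
  from continuous_attains_sup[OF compact_span_sphere[OF D] ne' this]
  obtain f where f: "f \<in> span D" "norm f = 1"
    and max: "\<And>v. v \<in> span D \<Longrightarrow> norm v = 1 \<Longrightarrow> S v \<bullet> v \<le> S f \<bullet> f" by auto
  have max': "S v \<bullet> v \<le> (S f \<bullet> f) * (v \<bullet> v)" if "v \<in> span D" for v
  proof (cases "v = 0")
    case False
    have "S ((1 / norm v) *\<^sub>R v) \<bullet> ((1 / norm v) *\<^sub>R v) \<le> S f \<bullet> f"
      using False that by (intro max) (auto intro: span_scale)
    then have "(S v \<bullet> v) / (v \<bullet> v) \<le> S f \<bullet> f"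
      by (simp add: scaleR power2_norm_eq_inner[symmetric] power2_eq_square)
    moreover have "0 < v \<bullet> v" using False by simp
    ultimately show ?thesis by (simp only: pos_divide_le_eq)
  qed (simp add: zero)
  have "S f \<bullet> v = 0" if v: "v \<in> span D" "f \<bullet> v = 0" for v
  proof -
    define b where "b = S f \<bullet> v"
    define c where "c = (S f \<bullet> f) * (v \<bullet> v) - S v \<bullet> v"
    have ff: "f \<bullet> f = 1" using f by (simp add: norm_eq_1)
    have ineq: "2 * t * b \<le> t\<^sup>2 * c" for t
    proof -
      have "f + t *\<^sub>R v \<in> span D" using f v by (auto intro: span_add span_scale)
      then have le: "S (f + t *\<^sub>R v) \<bullet> (f + t *\<^sub>R v) \<le> (S f \<bullet> f) * ((f + t *\<^sub>R v) \<bullet> (f + t *\<^sub>R v))" by (rule max')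
      have e1: "S (f + t *\<^sub>R v) \<bullet> (f + t *\<^sub>R v) = S f \<bullet> f + 2 * t * b + t\<^sup>2 * (S v \<bullet> v)"
        using sym[of v f] by (simp add: add scaleR inner_add_left inner_add_right b_def power2_eq_square inner_commute algebra_simps)
      have e2: "(f + t *\<^sub>R v) \<bullet> (f + t *\<^sub>R v) = 1 + t\<^sup>2 * (v \<bullet> v)"
        using v ff by (simp add: inner_add_left inner_add_right inner_commute power2_eq_square)
      show ?thesis using le unfolding e1 e2 by (simp add: c_def algebra_simps)
    qed
    have "b = 0"
    proof (rule ccontr)
      assume "b \<noteq> 0"
      \<comment> \<open>With this \<open>t\<close> the linear term \<open>2 * t * b\<close> equals
        \<open>2 * (t\<^sup>2 * (\<bar>c\<bar> + 1))\<close>, too large for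
        \<open>ineq\<close>.\<close>
      define t where "t = b / (\<bar>c\<bar> + 1)"
      have pos: "0 < \<bar>c\<bar> + 1" by simp
      have tb: "t * (\<bar>c\<bar> + 1) = b" using pos by (simp add: t_def)
      have t0: "t \<noteq> 0" using \<open>b \<noteq> 0\<close> pos by (simp add: t_def)
      have "2 * t * b = 2 * (t\<^sup>2 * (\<bar>c\<bar> + 1))" by (subst tb[symmetric]) (simp add: power2_eq_square)
      then have "2 * (t\<^sup>2 * (\<bar>c\<bar> + 1)) \<le> t\<^sup>2 * c" using ineq[of t] by simp
      also have "\<dots> \<le> t\<^sup>2 * (\<bar>c\<bar> + 1)" by (intro mult_left_mono) auto
      finally have "t\<^sup>2 * (\<bar>c\<bar> + 1) \<le> 0" by linarith
      moreover have "0 < t\<^sup>2 * (\<bar>c\<bar> + 1)" using t0 pos by (intro mult_pos_pos) auto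
      ultimately show False by simp
    qed
    then show ?thesis by (simp add: b_def)
  qed
  then show ?thesis using f that by blast
qed

text \<open>A Rayleigh maximizer \<open>f\<close> is split off and the induction continues in its
  orthogonal complement \<open>V\<close> inside \<open>span D\<close>; \<open>f\<close> is
  orthogonal to \<open>V\<close> for the form of \<open>S\<close> as well.\<close>

lemma orthonormal_diagonalizing_basis:
  fixes S :: "'a::real_inner \<Rightarrow> 'a"
  assumes S: "bounded_linear S" and sym: "\<And>x y. S x \<bullet> y = x \<bullet> S y" and "finite D"
  shows "\<exists>B. finite B \<and> span B = span D \<and> (\<forall>f\<in>B. norm f = 1) \<and>
    (\<forall>f\<in>B. \<forall>g\<in>B. f \<noteq> g \<longrightarrow> f \<bullet> g = 0 \<and> S f \<bullet> g = 0)"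
  using \<open>finite D\<close>
proof (induction "card D" arbitrary: D rule: less_induct)
  case less
  show ?case
  proof (cases "\<exists>x. x \<in> span D \<and> x \<noteq> 0")
    case False
    then have "span D = span {}" using span_zero[of D] by auto
    then show ?thesis by (intro exI[of _ "{}"]) auto
  next
    case True
    then obtain x where "x \<in> span D" "x \<noteq> 0" by blast
    then obtain f where f: "f \<in> span D" "norm f = 1"
      and diag: "\<And>v. v \<in> span D \<Longrightarrow> f \<bullet> v = 0 \<Longrightarrow> S f \<bullet> v = 0"
      using rayleigh_maximizer[OF S sym less.prems] by blast
    have ff: "f \<bullet> f = 1" using f by (simp add: norm_eq_1)
    define V where "V = {v \<in> span D. f \<bullet> v = 0}"
    have V: "subspace V"
      unfolding V_def subspace_def by (auto simp: inner_add_right intro: span_zero span_add span_scale)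
    obtain B' where B': "B' \<subseteq> V" "independent B'" "V \<subseteq> span B'"
      using maximal_independent_subset by blast
    have spB': "span B' = V" using B' V by (meson span_minimal subset_antisym)
    have "f \<notin> span B'" using ff by (auto simp: spB' V_def)
    then have ind: "independent (insert f B')" "f \<notin> B'"
      using independent_insertI[OF _ B'(2)] span_base by blast+
    have "insert f B' \<subseteq> span D" using f B' by (auto simp: V_def)
    \<comment> \<open>\<open>insert f B'\<close> is independent within \<open>span D\<close>, so it
      has at most as many elements as \<open>D\<close>, and \<open>B'\<close> has fewer.\<close>
    from independent_span_bound[OF less.prems ind(1) this]
    have "finite B'" "card B' < card D" using ind(2) by auto
    from less.hyps[OF this(2,1), unfolded spB'] obtain C where C': "finite C \<and> span C = V \<and>
      (\<forall>f\<in>C. norm f = 1) \<and> (\<forall>f\<in>C. \<forall>g\<in>C. f \<noteq> g \<longrightarrow> f \<bullet> g = 0 \<and> S f \<bullet> g = 0)" ..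
    then have C: "finite C" "span C = V" "\<forall>f\<in>C. norm f = 1"
      and C_diag: "\<forall>f\<in>C. \<forall>g\<in>C. f \<noteq> g \<longrightarrow> f \<bullet> g = 0 \<and> S f \<bullet> g = 0" by simp_all
    have CV: "C \<subseteq> V" using C(2) span_superset by blast
    have fc: "f \<bullet> c = 0" "S f \<bullet> c = 0" if "c \<in> C" for c
    proof -
      have "c \<in> span D" "f \<bullet> c = 0" using that CV by (auto simp: V_def)
      then show "f \<bullet> c = 0" "S f \<bullet> c = 0" using diag by blast+
    qed
    have "span (insert f C) = span D"
    proof
      show "span (insert f C) \<subseteq> span D"
        using f CV by (intro span_minimal) (auto simp: V_def)
      show "span D \<subseteq> span (insert f C)"
      proof
        fix v assume v: "v \<in> span D"
        have "v - (v \<bullet> f) *\<^sub>R f \<in> V"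
          using v f ff by (auto simp: V_def inner_diff_right inner_commute intro: span_diff span_scale)
        then have "v - (v \<bullet> f) *\<^sub>R f \<in> span (insert f C)"
          unfolding C(2)[symmetric] using span_mono[of C "insert f C"] by blast
        moreover have "(v \<bullet> f) *\<^sub>R f \<in> span (insert f C)" by (intro span_scale span_base) simp
        ultimately have "(v - (v \<bullet> f) *\<^sub>R f) + (v \<bullet> f) *\<^sub>R f \<in> span (insert f C)" by (rule span_add)
        then show "v \<in> span (insert f C)" by simp
      qed
    qed
    moreover have "\<forall>g\<in>insert f C. \<forall>h\<in>insert f C. g \<noteq> h \<longrightarrow> g \<bullet> h = 0 \<and> S g \<bullet> h = 0"
    proof (intro ballI impI)
      fix g h assume gh: "g \<in> insert f C" "h \<in> insert f C" "g \<noteq> h"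
      have "S c \<bullet> f = 0" if "c \<in> C" for c using fc(2)[OF that] sym[of c f] by (simp add: inner_commute)
      then show "g \<bullet> h = 0 \<and> S g \<bullet> h = 0"
        using gh C_diag fc by (auto simp: inner_commute[of _ f])
    qed
    ultimately show ?thesis using C f by (intro exI[of _ "insert f C"]) auto
  qed
qed

text \<open>The sum is the squared norm of the projection \<open>p\<close> of \<open>v\<close> onto
  \<open>span B\<close>. The right-hand side depends only on the span, so bases can be changed
  freely.\<close>

lemma sum_sq_orthonormal_le_iff:
  fixes B :: "'a::real_inner set"
  assumes B: "finite B" "\<And>f. f \<in> B \<Longrightarrow> norm f = 1" "\<And>f g. f \<in> B \<Longrightarrow> g \<in> B \<Longrightarrow> f \<noteq> g \<Longrightarrow> f \<bullet> g = 0"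
    and "0 \<le> r"
  shows "(\<Sum>f\<in>B. (v \<bullet> f)\<^sup>2) \<le> r\<^sup>2 \<longleftrightarrow> (\<forall>d\<in>span B. v \<bullet> d \<le> r * norm d)"
proof -
  define p where "p = (\<Sum>f\<in>B. (v \<bullet> f) *\<^sub>R f)"
  have "(norm p)\<^sup>2 = (\<Sum>f\<in>B. (norm ((v \<bullet> f) *\<^sub>R f))\<^sup>2)" unfolding p_def
    by (rule norm_sum_Pythagorean) (use B in \<open>auto simp: pairwise_def orthogonal_def\<close>)
  then have np: "(norm p)\<^sup>2 = (\<Sum>f\<in>B. (v \<bullet> f)\<^sup>2)" using B by (simp add: power_mult_distrib)
  have p_span: "p \<in> span B" unfolding p_def by (intro span_sum span_scale span_base)
  have vp: "v \<bullet> d = p \<bullet> d" if "d \<in> span B" for d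
    using that
  proof (induction rule: span_induct_alt)
    case base
    then show ?case by simp
  next
    case (step c f d)
    have "p \<bullet> f = (\<Sum>g\<in>B. if g = f then v \<bullet> f else 0)"
      unfolding p_def inner_sum_left using step B by (intro sum.cong) (auto simp: norm_eq_1)
    also have "\<dots> = v \<bullet> f" using step B by simp
    finally show ?case using step by (simp add: inner_add_right)
  qed
  show ?thesis
  proof
    assume "(\<Sum>f\<in>B. (v \<bullet> f)\<^sup>2) \<le> r\<^sup>2"
    then have "norm p \<le> r" using np \<open>0 \<le> r\<close> by (metis power2_le_imp_le)
    then show "\<forall>d\<in>span B. v \<bullet> d \<le> r * norm d"
      using vp norm_cauchy_schwarz[of p] by (metis mult_right_mono norm_ge_zero order_trans)
  next
    assume "\<forall>d\<in>span B. v \<bullet> d \<le> r * norm d"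
    then have "p \<bullet> p \<le> r * norm p" using vp p_span by metis
    then have "norm p * norm p \<le> r * norm p" by (simp add: power2_norm_eq_inner[symmetric] power2_eq_square)
    then have "norm p \<le> r" using \<open>0 \<le> r\<close> by (cases "norm p = 0") auto
    then show "(\<Sum>f\<in>B. (v \<bullet> f)\<^sup>2) \<le> r\<^sup>2" unfolding np[symmetric] by (intro power_mono) auto
  qed
qed

section \<open>Small balls under a nondegenerate Gaussian measure\<close>

locale nondegenerate_gaussian = centered_gaussian +
  assumes inj_S: "inj S"
begin

definition R :: "'a \<Rightarrow> 'a" where "R = op_sqrt S"

lemma R_props: "self_adjoint R" "positive_op R" "R \<circ> R = S" "inj R"
  unfolding R_def
  by (rule op_sqrt[OF self_adjoint_S positive_op_S] inj_op_sqrt[OF self_adjoint_S positive_op_S inj_S])+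

lemma R_R: "R (R x) = S x" using R_props(3) by (metis comp_apply)

lemma bounded_linear_R: "bounded_linear R" using R_props(1) by (simp add: self_adjoint_def)

lemma R_sym: "R x \<bullet> y = x \<bullet> R y" using R_props(1) by (simp add: self_adjoint_def)

lemma S_inner_eq_norm_R: "S g \<bullet> g = (norm (R g))\<^sup>2"
  using R_sym[of "R g" g] by (simp add: R_R power2_norm_eq_inner)

lemma S_pos:
  assumes "g \<noteq> 0"
  shows "0 < S g \<bullet> g"
proof -
  have "R g \<noteq> R 0" using assms injD[OF R_props(4)] by blast
  then have "R g \<noteq> 0" by (simp add: linear_0[OF bounded_linear.linear[OF bounded_linear_R]])
  then show ?thesis by (simp add: S_inner_eq_norm_R)
qed

text \<open>The shifts \<open>a f\<close> are removed one coordinate at a time; \<open>A\<close>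
  collects the coordinates already treated.\<close>

lemma shift_finite_coordinates_le:
  assumes B: "finite B" "\<And>f. f \<in> B \<Longrightarrow> norm f = 1" "\<And>f g. f \<in> B \<Longrightarrow> g \<in> B \<Longrightarrow> f \<noteq> g \<Longrightarrow> S f \<bullet> g = 0"
  shows "emeasure M {x. (\<Sum>f\<in>B. (x \<bullet> f - a f)\<^sup>2) \<le> (d::real)} \<le> emeasure M {x. (\<Sum>f\<in>B. (x \<bullet> f)\<^sup>2) \<le> d}"
proof -
  have step: "emeasure M {x. (\<Sum>f\<in>B. (x \<bullet> f - a f)\<^sup>2) \<le> d}
      \<le> emeasure M {x. (\<Sum>f\<in>B. (x \<bullet> f - (if f \<in> A then 0 else a f))\<^sup>2) \<le> d}"
    if "finite A" "A \<subseteq> B" for A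
    using that
  proof (induction A)
    case (insert g A)
    define b where "b f = (if f \<in> A then 0 else a f)" for f
    define T where "T p = (\<Sum>f\<in>B - {g}. (p \<bullet> f - b f)\<^sup>2)" for p :: 'a
    have g: "g \<in> B" "g \<notin> A" using insert by auto
    have T: "T \<in> borel_measurable borel" unfolding T_def by measurable
    have "g \<noteq> 0" using B(2)[OF g(1)] by auto
    then have q: "0 < S g \<bullet> g" by (rule S_pos)
    \<comment> \<open>Orthogonality for the covariance form means that passing to the residual of
      \<open>g\<close> leaves all other coordinates unchanged.\<close>
    have res: "T (residual g x) = (\<Sum>f\<in>B - {g}. (x \<bullet> f - b f)\<^sup>2)" for x
      unfolding T_def using B(3) g by (intro sum.cong) (auto simp: residual_def inner_diff_left)
    have "{x. (\<Sum>f\<in>B. (x \<bullet> f - b f)\<^sup>2) \<le> d} = {x. T (residual g x) + (x \<bullet> g - a g)\<^sup>2 \<le> d}"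
      using g by (simp add: res sum.remove[OF B(1) g(1)] b_def add.commute)
    moreover have "(\<Sum>f\<in>B. (x \<bullet> f - (if f \<in> insert g A then 0 else a f))\<^sup>2) = T (residual g x) + (x \<bullet> g)\<^sup>2" for x
    proof -
      have "(\<Sum>f\<in>B - {g}. (x \<bullet> f - (if f \<in> insert g A then 0 else a f))\<^sup>2) = T (residual g x)"
        unfolding res by (intro sum.cong) (auto simp: b_def)
      then show ?thesis by (simp add: sum.remove[OF B(1) g(1)])
    qed
    ultimately have "emeasure M {x. (\<Sum>f\<in>B. (x \<bullet> f - b f)\<^sup>2) \<le> d}
      \<le> emeasure M {x. (\<Sum>f\<in>B. (x \<bullet> f - (if f \<in> insert g A then 0 else a f))\<^sup>2) \<le> d}"
      using shift_coordinate_le[OF q T] by (simp only:)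
    moreover have "emeasure M {x. (\<Sum>f\<in>B. (x \<bullet> f - a f)\<^sup>2) \<le> d} \<le> emeasure M {x. (\<Sum>f\<in>B. (x \<bullet> f - b f)\<^sup>2) \<le> d}"
      using insert unfolding b_def by blast
    ultimately show ?case by order
  qed simp
  have zero: "(\<Sum>f\<in>B. (x \<bullet> f - (if f \<in> B then 0 else a f))\<^sup>2) = (\<Sum>f\<in>B. (x \<bullet> f)\<^sup>2)" for x
    by (intro sum.cong) auto
  show ?thesis using step[OF B(1) subset_refl] unfolding zero .
qed

section \<open>Anderson's inequality for balls\<close>

text \<open>The ball is the intersection of decreasing sets \<open>C n\<close>, each depending on
  finitely many coordinates. A diagonalizing basis for each \<open>n\<close> gives the inequality
  for \<open>C n\<close>, and continuity from above gives it for the ball.\<close>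

lemma anderson_cball:
  assumes "0 \<le> r"
  shows "measure M (cball z r) \<le> measure M (cball 0 r)"
proof -
  obtain D :: "'a set" where D: "countable D" "\<And>X. open X \<Longrightarrow> X \<noteq> {} \<Longrightarrow> \<exists>d\<in>D. d \<in> X"
    by (rule countable_dense_setE) blast
  have Dne: "D \<noteq> {}" using D(2)[of UNIV] by auto
  define E where "E n = from_nat_into D ` {..<n}" for n
  have UE: "(\<Union>n. E n) = D"
    using range_from_nat_into[OF Dne D(1)] by (fastforce simp: E_def)
  \<comment> \<open>Stated through the span, because the diagonalizing bases for different
    \<open>n\<close> are unrelated while the spans increase.\<close>
  define C where "C n = {v. \<forall>d\<in>span (E n). v \<bullet> d \<le> r * norm d}" for n
  have C_dec: "C n \<subseteq> C m" if "m \<le> n" for m n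
  proof -
    have "span (E m) \<subseteq> span (E n)" using that by (intro span_mono) (auto simp: E_def)
    then show ?thesis by (auto simp: C_def)
  qed
  have C_Int: "(\<Inter>n. C n) = cball 0 r"
  proof
    show "(\<Inter>n. C n) \<subseteq> cball 0 r"
    proof
      fix v assume v: "v \<in> (\<Inter>n. C n)"
      have "\<forall>d\<in>D. v \<bullet> d \<le> r * norm d"
      proof
        fix d assume "d \<in> D"
        then obtain n where "d \<in> E n" using UE by blast
        then show "v \<bullet> d \<le> r * norm d" using v by (auto simp: C_def intro: span_base)
      qed
      then show "v \<in> cball 0 r" using norm_le_iff_inner_dense[OF D(2) assms, of v] by simp
    qed
    show "cball 0 r \<subseteq> (\<Inter>n. C n)"
    proof (clarsimp simp: C_def)
      fix v d :: 'a assume "norm v \<le> r"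
      then show "v \<bullet> d \<le> r * norm d"
        by (meson mult_right_mono norm_cauchy_schwarz norm_ge_zero order_trans)
    qed
  qed
  have C_sets: "C n \<in> sets borel" and le: "measure M (cball z r) \<le> measure M (C n)" for n
  proof -
    have "finite (E n)" by (simp add: E_def)
    from orthonormal_diagonalizing_basis[OF bounded_linear_S S_sym this]
    obtain B where B': "finite B \<and> span B = span (E n) \<and> (\<forall>f\<in>B. norm f = 1) \<and>
      (\<forall>f\<in>B. \<forall>g\<in>B. f \<noteq> g \<longrightarrow> f \<bullet> g = 0 \<and> S f \<bullet> g = 0)" ..
    then have B: "finite B" "span B = span (E n)" "\<And>f. f \<in> B \<Longrightarrow> norm f = 1"
      "\<And>f g. f \<in> B \<Longrightarrow> g \<in> B \<Longrightarrow> f \<noteq> g \<Longrightarrow> f \<bullet> g = 0" "\<And>f g. f \<in> B \<Longrightarrow> g \<in> B \<Longrightarrow> f \<noteq> g \<Longrightarrow> S f \<bullet> g = 0"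
      by simp_all
    have C: "C n = {v. (\<Sum>f\<in>B. (v \<bullet> f)\<^sup>2) \<le> r\<^sup>2}"
      unfolding C_def B(2)[symmetric] using sum_sq_orthonormal_le_iff[OF B(1,3,4) assms] by auto
    show C_sets: "C n \<in> sets borel" unfolding C by measurable
    have "cball z r \<subseteq> {x. (\<Sum>f\<in>B. (x \<bullet> f - z \<bullet> f)\<^sup>2) \<le> r\<^sup>2}"
    proof
      fix x assume "x \<in> cball z r"
      then have "x - z \<in> (\<Inter>n. C n)" unfolding C_Int by (simp add: dist_norm norm_minus_commute)
      then have "x - z \<in> C n" by blast
      then show "x \<in> {x. (\<Sum>f\<in>B. (x \<bullet> f - z \<bullet> f)\<^sup>2) \<le> r\<^sup>2}" unfolding C by (simp add: inner_diff_left)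
    qed
    moreover have "{x. (\<Sum>f\<in>B. (x \<bullet> f - z \<bullet> f)\<^sup>2) \<le> r\<^sup>2} \<in> sets M" by measurable
    ultimately have "emeasure M (cball z r) \<le> emeasure M {x. (\<Sum>f\<in>B. (x \<bullet> f - z \<bullet> f)\<^sup>2) \<le> r\<^sup>2}"
      by (rule emeasure_mono)
    also have "\<dots> \<le> emeasure M (C n)" unfolding C by (rule shift_finite_coordinates_le[OF B(1,3,5)])
    finally show "measure M (cball z r) \<le> measure M (C n)" by (simp add: emeasure_eq_measure)
  qed
  have "(\<lambda>n. measure M (C n)) \<longlonglongrightarrow> measure M (\<Inter>n. C n)"
    by (rule finite_Lim_measure_decseq) (use C_sets C_dec in \<open>auto simp: decseq_def\<close>)
  then show ?thesis unfolding C_Int by (rule LIMSEQ_le_const) (use le in auto)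
qed

text \<open>Continuity from below along radii that start at 0 and increase to \<open>r\<close>.
  Closed balls exhaust the open ball too, which transfers Anderson's inequality to open
  balls.\<close>

lemma measure_balls_tendsto:
  assumes "0 < r"
  shows "(\<lambda>n. measure M (ball z (r - r / Suc n))) \<longlonglongrightarrow> measure M (ball z r)"
    and "(\<lambda>n. measure M (cball z (r - r / Suc n))) \<longlonglongrightarrow> measure M (ball z r)"
proof -
  have mono: "r - r / Suc m \<le> r - r / Suc n" if "m \<le> n" for m n
    using that assms by (simp add: divide_left_mono)
  have lt: "r - r / Suc n < r" for n using assms by simp
  have ex: "\<exists>n. t < r - r / Suc n" if "t < r" for t
  proof -
    have "0 < (r - t) / r" using that assms by simp
    then obtain n where "1 / Suc n < (r - t) / r" by (rule nat_approx_posE)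
    then have "r / Suc n < r - t" using assms by (simp add: field_simps)
    then show ?thesis by (intro exI[of _ n]) simp
  qed
  have U1: "(\<Union>n. ball z (r - r / Suc n)) = ball z r"
  proof (intro equalityI subsetI)
    fix x assume "x \<in> (\<Union>n. ball z (r - r / Suc n))"
    then obtain n where "dist z x < r - r / Suc n" by auto
    with lt[of n] show "x \<in> ball z r" unfolding mem_ball by linarith
  next
    fix x assume "x \<in> ball z r"
    then obtain n where "dist z x < r - r / Suc n" using ex unfolding mem_ball by blast
    then show "x \<in> (\<Union>n. ball z (r - r / Suc n))" unfolding UN_iff mem_ball by blast
  qed
  have U2: "(\<Union>n. cball z (r - r / Suc n)) = ball z r"
  proof (intro equalityI subsetI)
    fix x assume "x \<in> (\<Union>n. cball z (r - r / Suc n))"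
    then obtain n where "dist z x \<le> r - r / Suc n" by auto
    with lt[of n] show "x \<in> ball z r" unfolding mem_ball by linarith
  next
    fix x assume "x \<in> ball z r"
    then obtain n where "dist z x < r - r / Suc n" using ex unfolding mem_ball by blast
    then show "x \<in> (\<Union>n. cball z (r - r / Suc n))" unfolding UN_iff mem_cball using less_imp_le by blast
  qed
  have "(\<lambda>n. measure M (ball z (r - r / Suc n))) \<longlonglongrightarrow> measure M (\<Union>n. ball z (r - r / Suc n))"
    using mono by (intro finite_Lim_measure_incseq) (auto simp: incseq_def intro!: subset_ball)
  then show "(\<lambda>n. measure M (ball z (r - r / Suc n))) \<longlonglongrightarrow> measure M (ball z r)" unfolding U1 .
  have "(\<lambda>n. measure M (cball z (r - r / Suc n))) \<longlonglongrightarrow> measure M (\<Union>n. cball z (r - r / Suc n))"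
    using mono by (intro finite_Lim_measure_incseq) (auto simp: incseq_def intro!: subset_cball)
  then show "(\<lambda>n. measure M (cball z (r - r / Suc n))) \<longlonglongrightarrow> measure M (ball z r)" unfolding U2 .
qed

lemma anderson_ball:
  assumes "0 < r"
  shows "measure M (ball z r) \<le> measure M (ball 0 r)"
proof (rule LIMSEQ_le[OF measure_balls_tendsto(2)[OF assms] measure_balls_tendsto(2)[OF assms]])
  have "0 \<le> r - r / Suc n" for n using assms by (simp add: field_simps)
  then show "\<exists>N. \<forall>n\<ge>N. measure M (cball z (r - r / Suc n)) \<le> measure M (cball 0 (r - r / Suc n))"
    using anderson_cball by blast
qed

text \<open>If the centred ball were null, Anderson's inequality would make all balls of this radius
  null, and countably many of them cover the space.\<close>

lemma measure_ball_0_pos: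
  assumes "0 < r"
  shows "0 < measure M (ball 0 r)"
proof (rule ccontr)
  assume "\<not> 0 < measure M (ball 0 r)"
  then have "measure M (ball z r) = 0" for z
    using anderson_ball[OF assms, of z] measure_nonneg[of M] by (metis dual_order.antisym not_less order_trans)
  then have null: "ball z r \<in> null_sets M" for z by (auto simp: null_sets_def emeasure_eq_measure)
  obtain D :: "'a set" where D: "countable D" "\<And>X. open X \<Longrightarrow> X \<noteq> {} \<Longrightarrow> \<exists>d\<in>D. d \<in> X"
    by (rule countable_dense_setE) blast
  have "(\<Union>d\<in>D. ball d r) = UNIV"
  proof (intro equalityI subsetI UNIV_I)
    fix x :: 'a
    obtain d where "d \<in> D" "d \<in> ball x r" using D(2)[of "ball x r"] assms by auto
    then show "x \<in> (\<Union>d\<in>D. ball d r)" by (auto simp: dist_commute)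
  qed
  moreover have "(\<Union>d\<in>D. ball d r) \<in> null_sets M" by (rule null_sets_UN'[OF D(1)]) (rule null)
  ultimately have "emeasure M (space M) = 0" by (simp add: null_sets_def)
  then show False using emeasure_space_1 by simp
qed

section \<open>Comparison of shifted balls with the centred ball\<close>

lemma distr_uminus: "distr M borel uminus = M"
proof (rule characteristic_functional_eqI)
  show "prob_space (distr M borel uminus)" by (rule prob_space_distr) simp
  show "prob_space M" by unfold_locales
  have [measurable]: "(\<lambda>x. iexp (x \<bullet> h)) \<in> borel_measurable borel" for h :: 'a
    by (intro borel_measurable_continuous_onI continuous_intros)
  show "(CLINT x|distr M borel uminus. iexp (x \<bullet> h)) = (CLINT x|M. iexp (x \<bullet> h))" for h
  proof -
    have "(CLINT x|distr M borel uminus. iexp (x \<bullet> h)) = (CLINT x|M. iexp (x \<bullet> (- h)))"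
      by (subst integral_distr) auto
    also have "\<dots> = (CLINT x|M. iexp (x \<bullet> h))"
      unfolding charfun by (simp add: linear_neg bounded_linear.linear[OF bounded_linear_S])
    finally show ?thesis .
  qed
qed auto

text \<open>By symmetry the Cameron--Martin weight \<open>exp (- (x \<bullet> g))\<close> can be replaced by its hyperbolic
  cosine, which is at least 1.\<close>

lemma measure_ball_range_S_ge:
  "exp (- (S g \<bullet> g) / 2) * measure M (ball 0 r) \<le> measure M (ball (S g) r)"
proof -
  define w where "w s x = indicator (ball 0 r) x * ennreal (exp (s * (x \<bullet> g)))" for s :: real and x :: 'a
  have [measurable]: "w s \<in> borel_measurable borel" for s
    unfolding w_def by (intro borel_measurable_times_ennreal borel_measurable_indicator
        measurable_compose[OF _ measurable_ennreal] borel_measurable_continuous_onI continuous_intros) auto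
  have "(\<integral>\<^sup>+x. w (-1) x \<partial>M) = (\<integral>\<^sup>+x. w (-1) x \<partial>distr M borel uminus)" by (simp only: distr_uminus)
  also have "\<dots> = (\<integral>\<^sup>+x. w 1 x \<partial>M)"
    by (subst nn_integral_distr) (auto intro!: nn_integral_cong simp: w_def indicator_def)
  finally have sym: "(\<integral>\<^sup>+x. w (-1) x \<partial>M) = (\<integral>\<^sup>+x. w 1 x \<partial>M)" .
  have "2 * emeasure M (ball 0 r) = (\<integral>\<^sup>+x. 2 * indicator (ball 0 r) x \<partial>M)"
    by (subst nn_integral_cmult) (auto intro!: borel_measurable_indicator)
  also have "\<dots> \<le> (\<integral>\<^sup>+x. w (-1) x + w 1 x \<partial>M)"
  proof (intro nn_integral_mono)
    fix x
    have "2 \<le> exp (- (x \<bullet> g)) + exp (x \<bullet> g)" using exp_ge_add_one_self[of "x \<bullet> g"] exp_ge_add_one_self[of "- (x \<bullet> g)"] by linarith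
    then have "ennreal 2 \<le> ennreal (exp (- (x \<bullet> g)) + exp (x \<bullet> g))" by (rule ennreal_leI)
    also have "\<dots> = ennreal (exp (- (x \<bullet> g))) + ennreal (exp (x \<bullet> g))" by (rule ennreal_plus) auto
    finally show "2 * indicator (ball 0 r) x \<le> w (-1) x + w 1 x" by (auto simp: w_def indicator_def)
  qed
  also have "\<dots> = 2 * (\<integral>\<^sup>+x. w (-1) x \<partial>M)" by (subst nn_integral_add) (auto simp: sym mult_2)
  finally have J: "emeasure M (ball 0 r) \<le> (\<integral>\<^sup>+x. w (-1) x \<partial>M)"
    by (subst (asm) ennreal_mult_le_mult_iff) auto
  have "ennreal (exp (- (S g \<bullet> g) / 2)) * emeasure M (ball 0 r) \<le> ennreal (exp (- (S g \<bullet> g) / 2)) * (\<integral>\<^sup>+x. w (-1) x \<partial>M)"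
    using J by (intro mult_left_mono) auto
  also have "\<dots> = (\<integral>\<^sup>+x. ennreal (exp (- (S g \<bullet> g) / 2)) * w (-1) x \<partial>M)" by (subst nn_integral_cmult) auto
  also have "\<dots> = (\<integral>\<^sup>+x. indicator (ball 0 r) x * ennreal (exp (- (x \<bullet> g) - (S g \<bullet> g) / 2)) \<partial>M)"
  proof (rule nn_integral_cong)
    fix x
    have "exp (- (x \<bullet> g) - (S g \<bullet> g) / 2) = exp (- (S g \<bullet> g) / 2) * exp (-1 * (x \<bullet> g))"
      by (simp add: exp_add[symmetric])
    then show "ennreal (exp (- (S g \<bullet> g) / 2)) * w (-1) x = indicator (ball 0 r) x * ennreal (exp (- (x \<bullet> g) - (S g \<bullet> g) / 2))"
      unfolding w_def by (simp only: ennreal_mult exp_ge_zero mult_ac)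
  qed
  also have "\<dots> = emeasure M {x. x - S g \<in> ball 0 r}" by (rule cameron_martin[symmetric]) simp
  also have "{x. x - S g \<in> ball 0 r} = ball (S g) r" by (auto simp: dist_norm norm_minus_commute)
  finally show ?thesis by (simp add: emeasure_eq_measure ennreal_mult[symmetric])
qed

text \<open>Points \<open>R (l n)\<close> tend to \<open>k\<close>, so \<open>S (l n)\<close> tends
  to \<open>R k\<close> and the bound for the range of \<open>S\<close> passes to the limit. A
  smaller radius \<open>s\<close> absorbs the displacement of the centre; finally \<open>s\<close>
  grows to \<open>r\<close>.\<close>

lemma measure_ball_range_R_ge:
  assumes "0 < r"
  shows "exp (- (norm k)\<^sup>2 / 2) * measure M (ball 0 r) \<le> measure M (ball (R k) r)"
proof -
  interpret R: bounded_linear R by (rule bounded_linear_R)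
  have "\<exists>l. norm (R l - k) \<le> 1 / Suc n" for n
    by (rule dense_range_self_adjoint_inj[OF R_props(1,4)]) simp
  then obtain l where l: "\<And>n. norm (R (l n) - k) \<le> 1 / Suc n" by metis
  have lim: "(\<lambda>n. R (l n)) \<longlonglongrightarrow> k"
    by (rule LIM_zero_cancel, rule Lim_null_comparison[OF _ LIMSEQ_Suc[OF lim_1_over_n]]) (use l in auto)
  have limS: "(\<lambda>n. S (l n)) \<longlonglongrightarrow> R k" using R.tendsto[OF lim] by (simp only: R_R)
  have *: "exp (- (norm k)\<^sup>2 / 2) * measure M (ball 0 s) \<le> measure M (ball (R k) r)" if "s < r" for s
  proof (rule tendsto_upperbound)
    show "(\<lambda>n. exp (- (norm (R (l n)))\<^sup>2 / 2) * measure M (ball 0 s)) \<longlonglongrightarrow> exp (- (norm k)\<^sup>2 / 2) * measure M (ball 0 s)"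
      by (intro tendsto_intros lim) simp
    have "eventually (\<lambda>n. dist (S (l n)) (R k) < r - s) sequentially"
      using limS that by (intro tendstoD) auto
    then show "eventually (\<lambda>n. exp (- (norm (R (l n)))\<^sup>2 / 2) * measure M (ball 0 s) \<le> measure M (ball (R k) r)) sequentially"
    proof eventually_elim
      case (elim n)
      have "ball (S (l n)) s \<subseteq> ball (R k) r"
      proof
        fix x assume "x \<in> ball (S (l n)) s"
        then show "x \<in> ball (R k) r" using elim dist_triangle[of "R k" x "S (l n)"] by (auto simp: dist_commute)
      qed
      then have "measure M (ball (S (l n)) s) \<le> measure M (ball (R k) r)" by (intro finite_measure_mono) auto
      then show ?case using measure_ball_range_S_ge[of "l n" s] unfolding S_inner_eq_norm_R by simp
    qed
  qed auto
  show ?thesis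
  proof (rule LIMSEQ_le_const2)
    show "(\<lambda>n. exp (- (norm k)\<^sup>2 / 2) * measure M (ball 0 (r - r / Suc n))) \<longlonglongrightarrow> exp (- (norm k)\<^sup>2 / 2) * measure M (ball 0 r)"
      by (intro tendsto_intros measure_balls_tendsto assms)
    show "\<exists>N. \<forall>n\<ge>N. exp (- (norm k)\<^sup>2 / 2) * measure M (ball 0 (r - r / Suc n)) \<le> measure M (ball (R k) r)"
      using assms by (intro exI allI impI *) simp
  qed
qed

text \<open>The shift is the minimal Cameron--Martin norm point of the ball: on the shifted ball the exponent
  of the Cameron--Martin density is then nonpositive, and Anderson's inequality applies.\<close>

lemma measure_ball_le:
  assumes "0 < r"
  obtains k where "norm (z - R k) \<le> r" "measure M (ball z r) \<le> exp (- (norm k)\<^sup>2 / 2) * measure M (ball 0 r)"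
proof -
  interpret R: bounded_linear R by (rule bounded_linear_R)
  obtain c k w where ckw: "0 \<le> c" "z = R k + w" "norm w \<le> r" "k = c *\<^sub>R R w" "c = 0 \<or> norm w = r"
    using ball_min_norm_preimage[OF R_props(1,4) assms] by blast
  show ?thesis
  proof (cases "c = 0")
    case True
    then show ?thesis using ckw anderson_ball[OF assms] by (intro that[of k]) (auto simp: R.zero)
  next
    case False
    then have nw: "norm w = r" using ckw by simp
    \<comment> \<open>The Lagrange condition gives \<open>R g = k\<close>, so the shift by
      \<open>R k\<close> equals \<open>S g\<close> and the Cameron-Martin formula applies to
      it.\<close>
    define g where "g = c *\<^sub>R w"
    have kg: "k = R g" using ckw by (simp add: g_def R.scaleR)
    then have Sg: "S g = R k" "S g \<bullet> g = (norm k)\<^sup>2" by (simp_all add: R_R S_inner_eq_norm_R)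
    have "ball z r = {x. x - S g \<in> ball w r}"
      using ckw(2) Sg by (auto simp: dist_norm algebra_simps)
    then have "emeasure M (ball z r) = (\<integral>\<^sup>+x. indicator (ball w r) x * ennreal (exp (- (x \<bullet> g) - (S g \<bullet> g) / 2)) \<partial>M)"
      using cameron_martin[of "ball w r" g] by simp
    also have "\<dots> \<le> (\<integral>\<^sup>+x. ennreal (exp (- (norm k)\<^sup>2 / 2)) * indicator (ball w r) x \<partial>M)"
    proof (intro nn_integral_mono)
      fix x
      show "indicator (ball w r) x * ennreal (exp (- (x \<bullet> g) - (S g \<bullet> g) / 2)) \<le> ennreal (exp (- (norm k)\<^sup>2 / 2)) * indicator (ball w r) x"
      proof (cases "x \<in> ball w r")
        case True
        \<comment> \<open>The origin lies on the boundary of the ball around \<open>w\<close>, so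
          the ball is contained in the half-space of nonnegative
          \<open>x \<bullet> w\<close>.\<close>
        then have "norm (w - x) < norm w" by (simp add: nw dist_norm)
        then have "(w - x) \<bullet> (w - x) < w \<bullet> w" by (simp add: norm_lt)
        then have "x \<bullet> x < 2 * (x \<bullet> w)" by (simp add: inner_diff_left inner_diff_right inner_commute)
        then have "0 \<le> x \<bullet> w" using inner_ge_zero[of x] by linarith
        then have "0 \<le> x \<bullet> g" using ckw by (simp add: g_def)
        then show ?thesis using True Sg by (auto intro!: ennreal_leI)
      qed simp
    qed
    also have "\<dots> = ennreal (exp (- (norm k)\<^sup>2 / 2)) * emeasure M (ball w r)"
      by (subst nn_integral_cmult) (auto intro!: borel_measurable_indicator)
    finally have "measure M (ball z r) \<le> exp (- (norm k)\<^sup>2 / 2) * measure M (ball w r)"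
      by (simp add: emeasure_eq_measure ennreal_mult[symmetric])
    also have "\<dots> \<le> exp (- (norm k)\<^sup>2 / 2) * measure M (ball 0 r)"
      by (intro mult_left_mono anderson_ball assms) auto
    finally show ?thesis using ckw by (intro that[of k]) auto
  qed
qed

end

section \<open>The three conditions on the forward map\<close>

text \<open>The terms are nonnegative, so bounding the partial sums suffices; the reductions of (B)
  and (C) to (A) both produce finite sums.\<close>

lemma condition_AI:
  assumes "0 < C"
    and le: "\<And>x1 x2 n. (\<Sum>k<n. \<bar>(F x1 - F x2) \<bullet> e k\<bar> / sqrt (lam k)) \<le> C * norm (x1 - x2)"
    and lam: "\<And>k. 0 < lam k"
  shows "condition_A lam e F"
  unfolding condition_A_def
proof (intro exI conjI allI)
  fix x1 x2
  have nonneg: "0 \<le> \<bar>(F x1 - F x2) \<bullet> e k\<bar> / sqrt (lam k)" for k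
    using lam[of k] by simp
  show s: "summable (\<lambda>k. \<bar>(F x1 - F x2) \<bullet> e k\<bar> / sqrt (lam k))"
    by (rule summableI_nonneg_bounded[OF nonneg le])
  show "(\<Sum>k. \<bar>(F x1 - F x2) \<bullet> e k\<bar> / sqrt (lam k)) \<le> C * norm (x1 - x2)"
    by (rule suminf_le_const[OF s le])
qed (rule assms)

text \<open>The signs turn each partial sum into a scalar function on the segment, to which the mean value
  theorem applies.\<close>

lemma condition_B_imp_A:
  fixes F :: "'a::{real_inner, complete_space} \<Rightarrow> 'b::real_inner"
  assumes B: "condition_B lam e F" and lam: "\<And>k. 0 < lam k"
  shows "condition_A lam e F"
proof -
  from B obtain C where C: "0 < C"
    and diff: "\<And>x. F differentiable (at x)"
    and sm: "\<And>x. summable (\<lambda>k. norm (adjoint (frechet_derivative F (at x)) (e k)) / sqrt (lam k))"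
    and bd: "\<And>x. (\<Sum>k. norm (adjoint (frechet_derivative F (at x)) (e k)) / sqrt (lam k)) \<le> C"
    unfolding condition_B_def by blast
  show ?thesis
  proof (rule condition_AI[OF C _ lam])
    fix x1 x2 :: 'a and n
    define d where "d = x1 - x2"
    define \<sigma> where "\<sigma> k = sgn ((F x1 - F x2) \<bullet> e k) / sqrt (lam k)" for k
    define w where "w = (\<Sum>k<n. \<sigma> k *\<^sub>R e k)"
    define g where "g t = F (x2 + t *\<^sub>R d) \<bullet> w" for t :: real
    define D where "D x = frechet_derivative F (at x)" for x
    have der: "(F has_derivative D x) (at x)" for x
      using diff frechet_derivative_works unfolding D_def by blast
    have "DERIV g t :> D (x2 + t *\<^sub>R d) d \<bullet> w" for t
    proof -
      interpret Dx: bounded_linear "D (x2 + t *\<^sub>R d)" using der by (rule has_derivative_bounded_linear)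
      have "((\<lambda>t. x2 + t *\<^sub>R d) has_derivative (\<lambda>s. s *\<^sub>R d)) (at t)"
        by (auto intro!: derivative_eq_intros)
      then have "((\<lambda>t. F (x2 + t *\<^sub>R d)) has_derivative (\<lambda>s. D (x2 + t *\<^sub>R d) (s *\<^sub>R d))) (at t)"
        by (rule has_derivative_compose[OF _ der])
      then have "(g has_derivative (\<lambda>s. D (x2 + t *\<^sub>R d) (s *\<^sub>R d) \<bullet> w)) (at t)"
        unfolding g_def by (rule has_derivative_inner_left)
      then show ?thesis by (simp add: has_field_derivative_def Dx.scaleR mult.commute[of _ "_ \<bullet> w"])
    qed
    then obtain t where t: "g 1 - g 0 = (1 - 0) * (D (x2 + t *\<^sub>R d) d \<bullet> w)"
      using MVT2[of 0 1 g "\<lambda>t. D (x2 + t *\<^sub>R d) d \<bullet> w"] by auto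
    define p where "p = x2 + t *\<^sub>R d"
    have adj: "D p d \<bullet> e k = d \<bullet> adjoint (D p) (e k)" for k
      by (rule adjoint_inner) (rule has_derivative_bounded_linear[OF der])
    have "(\<Sum>k<n. \<bar>(F x1 - F x2) \<bullet> e k\<bar> / sqrt (lam k)) = (F x1 - F x2) \<bullet> w"
      by (simp add: w_def \<sigma>_def inner_sum_right abs_sgn mult.commute)
    also have "\<dots> = g 1 - g 0" by (simp add: g_def d_def inner_diff_left)
    also have "\<dots> = D p d \<bullet> w" using t by (simp add: p_def)
    also have "\<dots> = (\<Sum>k<n. \<sigma> k * (d \<bullet> adjoint (D p) (e k)))"
      by (simp add: w_def inner_sum_right adj)
    also have "\<dots> \<le> (\<Sum>k<n. (norm (adjoint (D p) (e k)) / sqrt (lam k)) * norm d)"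
    proof (rule sum_mono)
      fix k
      have "\<bar>\<sigma> k\<bar> \<le> 1 / sqrt (lam k)" using lam[of k] by (auto simp: \<sigma>_def abs_sgn_eq)
      then have "\<bar>\<sigma> k * (d \<bullet> adjoint (D p) (e k))\<bar> \<le> (1 / sqrt (lam k)) * (norm d * norm (adjoint (D p) (e k)))"
        unfolding abs_mult using lam[of k] by (intro mult_mono Cauchy_Schwarz_ineq2) auto
      then show "\<sigma> k * (d \<bullet> adjoint (D p) (e k)) \<le> (norm (adjoint (D p) (e k)) / sqrt (lam k)) * norm d"
        by (simp add: mult_ac)
    qed
    also have "\<dots> = (\<Sum>k<n. norm (adjoint (D p) (e k)) / sqrt (lam k)) * norm d"
      by (rule sum_distrib_right[symmetric])
    also have "\<dots> \<le> C * norm d"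
    proof (rule mult_right_mono)
      have "(\<Sum>k<n. norm (adjoint (D p) (e k)) / sqrt (lam k)) \<le> (\<Sum>k. norm (adjoint (D p) (e k)) / sqrt (lam k))"
        using lam by (intro sum_le_suminf) (auto simp: D_def less_imp_le intro!: sm divide_nonneg_nonneg)
      then show "(\<Sum>k<n. norm (adjoint (D p) (e k)) / sqrt (lam k)) \<le> C"
        using bd[of p] unfolding D_def by linarith
    qed simp
    finally show "(\<Sum>k<n. \<bar>(F x1 - F x2) \<bullet> e k\<bar> / sqrt (lam k)) \<le> C * norm (x1 - x2)"
      unfolding d_def .
  qed
qed

section \<open>Hilbert-Schmidt sums and condition (C)\<close>

text \<open>Approximate Parseval: a vector near \<open>v\<close> is supported on \<open>F\<close>,
  and among combinations of \<open>F'\<close> the coordinates of \<open>v\<close> approximate best.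
  Allowing all larger \<open>F'\<close> lets one finite set serve several vectors.\<close>

lemma orthonormal_basis_norm_le:
  fixes v :: "'a::real_inner"
  assumes E: "orthonormal_basis E" and "0 < \<delta>"
  shows "\<exists>F. finite F \<and> F \<subseteq> E \<and> (\<forall>F'. finite F' \<longrightarrow> F \<subseteq> F' \<longrightarrow> F' \<subseteq> E \<longrightarrow> (norm v)\<^sup>2 \<le> (\<Sum>x\<in>F'. (v \<bullet> x)\<^sup>2) + \<delta>)"
proof -
  have "v \<in> closure (span E)" using E by (simp add: orthonormal_basis_def)
  then obtain p where p: "p \<in> span E" "dist p v < sqrt \<delta>"
    using \<open>0 < \<delta>\<close> by (meson closure_approachable real_sqrt_gt_zero)
  obtain F a where F: "finite F" "F \<subseteq> E" "p = (\<Sum>x\<in>F. a x *\<^sub>R x)"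
    using p(1) unfolding span_explicit by blast
  have "(norm v)\<^sup>2 \<le> (\<Sum>x\<in>F'. (v \<bullet> x)\<^sup>2) + \<delta>" if F': "finite F'" "F \<subseteq> F'" "F' \<subseteq> E" for F'
  proof -
    define b where "b x = (if x \<in> F then a x else 0)" for x
    have pb: "p = (\<Sum>x\<in>F'. b x *\<^sub>R x)"
      unfolding F(3) b_def using F' by (intro sum.mono_neutral_cong_left) auto
    have "(norm p)\<^sup>2 = (\<Sum>x\<in>F'. (norm (b x *\<^sub>R x))\<^sup>2)" unfolding pb
      by (rule norm_sum_Pythagorean[OF F'(1)])
        (use E F' in \<open>auto simp: orthonormal_basis_def pairwise_def orthogonal_def subset_eq\<close>)
    also have "\<dots> = (\<Sum>x\<in>F'. (b x)\<^sup>2)"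
      using E F' by (intro sum.cong) (auto simp: orthonormal_basis_def power_mult_distrib subset_eq)
    finally have np: "(norm p)\<^sup>2 = (\<Sum>x\<in>F'. (b x)\<^sup>2)" .
    have vp: "v \<bullet> p = (\<Sum>x\<in>F'. b x * (v \<bullet> x))" by (simp add: pb inner_sum_right)
    have "0 \<le> (\<Sum>x\<in>F'. (b x - v \<bullet> x)\<^sup>2)" by (rule sum_nonneg) simp
    also have "\<dots> = (norm p)\<^sup>2 - 2 * (v \<bullet> p) + (\<Sum>x\<in>F'. (v \<bullet> x)\<^sup>2)"
      by (simp add: np vp power2_diff sum.distrib sum_subtractf sum_distrib_left mult.assoc)
    also have "\<dots> = (norm (p - v))\<^sup>2 - (norm v)\<^sup>2 + (\<Sum>x\<in>F'. (v \<bullet> x)\<^sup>2)"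
      by (simp add: power2_norm_eq_inner inner_diff_left inner_diff_right inner_commute)
    finally have "(norm v)\<^sup>2 \<le> (\<Sum>x\<in>F'. (v \<bullet> x)\<^sup>2) + (norm (p - v))\<^sup>2" by simp
    moreover have "(norm (p - v))\<^sup>2 \<le> (sqrt \<delta>)\<^sup>2" using p(2) by (intro power_mono) (auto simp: dist_norm)
    ultimately show ?thesis using \<open>0 < \<delta>\<close> by simp
  qed
  then show ?thesis using F(1,2) by blast
qed

lemma bessel_inequality:
  fixes e :: "nat \<Rightarrow> 'a::real_inner"
  assumes "inj e" "\<And>k. norm (e k) = 1" "\<And>j k. j \<noteq> k \<Longrightarrow> e j \<bullet> e k = 0"
  shows "(\<Sum>k<n. (v \<bullet> e k)\<^sup>2) \<le> (norm v)\<^sup>2"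
proof -
  have "(\<Sum>f\<in>e ` {..<n}. (v \<bullet> f)\<^sup>2) \<le> (norm v)\<^sup>2"
  proof (subst sum_sq_orthonormal_le_iff)
    show "\<forall>d\<in>span (e ` {..<n}). v \<bullet> d \<le> norm v * norm d" using norm_cauchy_schwarz by blast
  qed (use assms in \<open>auto simp: inj_eq\<close>)
  then show ?thesis by (simp add: sum.reindex inj_on_subset[OF assms(1)])
qed

text \<open>Both sides are compared through the double sum of the squares of
  \<open>T x \<bullet> e k\<close>: summing first over \<open>x\<close> gives the norms of the
  adjoint vectors up to \<open>\<delta>\<close>, while Bessel's inequality bounds the sum over
  \<open>k\<close>.\<close>

lemma hilbert_schmidt_adjoint_sum_le:
  fixes T :: "'a::{real_inner, complete_space} \<Rightarrow> 'b::real_inner"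
  assumes T: "bounded_linear T" and E: "orthonormal_basis E"
    and hs: "(\<lambda>x. (norm (T x))\<^sup>2) summable_on E"
    and e: "inj e" "\<And>k::nat. norm (e k) = 1" "\<And>j k. j \<noteq> k \<Longrightarrow> e j \<bullet> e k = 0"
  shows "(\<Sum>k<n. (norm (adjoint T (e k)))\<^sup>2) \<le> (\<Sum>\<^sub>\<infinity>x\<in>E. (norm (T x))\<^sup>2)"
proof (rule field_le_epsilon)
  fix \<delta>' :: real assume "0 < \<delta>'"
  \<comment> \<open>Each of the \<open>n\<close> vectors costs an error \<open>\<delta>\<close>;
    \<open>Suc n\<close> also covers \<open>n = 0\<close>.\<close>
  define \<delta> where "\<delta> = \<delta>' / Suc n"
  have \<delta>: "0 < \<delta>" "n * \<delta> \<le> \<delta>'" using \<open>0 < \<delta>'\<close> by (auto simp: \<delta>_def field_simps)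
  let ?t = "\<lambda>k. adjoint T (e k)"
  have "\<forall>k. \<exists>F. finite F \<and> F \<subseteq> E \<and>
      (\<forall>F'. finite F' \<longrightarrow> F \<subseteq> F' \<longrightarrow> F' \<subseteq> E \<longrightarrow> (norm (?t k))\<^sup>2 \<le> (\<Sum>x\<in>F'. (?t k \<bullet> x)\<^sup>2) + \<delta>)"
    using orthonormal_basis_norm_le[OF E \<delta>(1)] by blast
  then obtain G where G: "\<forall>k. finite (G k) \<and> G k \<subseteq> E \<and>
      (\<forall>F'. finite F' \<longrightarrow> G k \<subseteq> F' \<longrightarrow> F' \<subseteq> E \<longrightarrow> (norm (?t k))\<^sup>2 \<le> (\<Sum>x\<in>F'. (?t k \<bullet> x)\<^sup>2) + \<delta>)"
    by (rule choice[THEN exE])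
  define F where "F = (\<Union>k<n. G k)"
  have F: "finite F" "F \<subseteq> E" using G by (auto simp: F_def)
  have "(\<Sum>k<n. (norm (?t k))\<^sup>2) \<le> (\<Sum>k<n. (\<Sum>x\<in>F. (?t k \<bullet> x)\<^sup>2) + \<delta>)"
  proof (rule sum_mono)
    fix k assume "k \<in> {..<n}"
    then have "G k \<subseteq> F" by (auto simp: F_def)
    then show "(norm (?t k))\<^sup>2 \<le> (\<Sum>x\<in>F. (?t k \<bullet> x)\<^sup>2) + \<delta>" using G F by blast
  qed
  also have "\<dots> = (\<Sum>x\<in>F. \<Sum>k<n. (?t k \<bullet> x)\<^sup>2) + n * \<delta>"
    by (simp add: sum.distrib sum.swap[of _ F])
  also have "\<dots> \<le> (\<Sum>x\<in>F. (norm (T x))\<^sup>2) + \<delta>'"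
  proof (intro add_mono sum_mono \<delta>)
    fix x
    have "(\<Sum>k<n. (?t k \<bullet> x)\<^sup>2) = (\<Sum>k<n. (T x \<bullet> e k)\<^sup>2)"
      by (simp add: adjoint_inner[OF T] inner_commute)
    also have "\<dots> \<le> (norm (T x))\<^sup>2" by (rule bessel_inequality[OF e])
    finally show "(\<Sum>k<n. (?t k \<bullet> x)\<^sup>2) \<le> (norm (T x))\<^sup>2" .
  qed
  also have "\<dots> \<le> (\<Sum>\<^sub>\<infinity>x\<in>E. (norm (T x))\<^sup>2) + \<delta>'"
    using finite_sum_le_infsum[OF hs F] by simp
  finally show "(\<Sum>k<n. (norm (?t k))\<^sup>2) \<le> (\<Sum>\<^sub>\<infinity>x\<in>E. (norm (T x))\<^sup>2) + \<delta>'" .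
qed

text \<open>The defect \<open>u\<close> satisfies \<open>R u = - sqrt c *\<^sub>R u\<close>, which
  positivity of \<open>R\<close> allows only for \<open>u = 0\<close>.\<close>

lemma positive_sqrt_eigenvector:
  assumes "self_adjoint R" "positive_op R" "R (R v) = c *\<^sub>R v" "0 < c"
  shows "R v = sqrt c *\<^sub>R v"
proof -
  interpret bounded_linear R using assms by (simp add: self_adjoint_def)
  define u where "u = R v - sqrt c *\<^sub>R v"
  have "R u = - sqrt c *\<^sub>R u" using assms(3,4) by (simp add: u_def diff scaleR scaleR_diff_right)
  moreover have "0 \<le> R u \<bullet> u" using assms by (simp add: positive_op_def)
  ultimately have "sqrt c * (u \<bullet> u) \<le> 0" by simp
  then have "u \<bullet> u \<le> 0" using assms(4) by (simp add: mult_le_0_iff)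
  then have "u = 0" using inner_gt_zero_iff[of u] by linarith
  then show ?thesis by (simp add: u_def)
qed

text \<open>In case (C) the vectors \<open>(Q\<^sup>-\<^sup>1\<^sup>/\<^sup>2 K)\<^sup>* e\<^sub>k\<close> are pairwise orthogonal and square summable, so the
  \<open>\<ell>\<^sup>1\<close> norm of the coordinates is bounded by Pythagoras' theorem.\<close>

lemma condition_C_imp_A:
  fixes K :: "'a::{real_inner, complete_space} \<Rightarrow> 'b::{real_inner, complete_space}"
  assumes C: "condition_C Q e K" and Q: "self_adjoint Q" "positive_op Q"
    and es: "eigensystem Q lam e"
  shows "condition_A lam e K"
proof -
  define R where "R = op_sqrt Q"
  have R: "self_adjoint R" "positive_op R" "R \<circ> R = Q"
    unfolding R_def by (rule op_sqrt[OF Q(1,2)])+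
  have Rsym: "R x \<bullet> y = x \<bullet> R y" for x y using R(1) by (simp add: self_adjoint_def)
  have lam: "0 < lam k" and Qe: "Q (e k) = lam k *\<^sub>R e k" for k
    using es by (simp_all add: eigensystem_def)
  have e_inj: "inj e" and onb: "orthonormal_basis (range e)" using es by (simp_all add: eigensystem_def)
  have e1: "norm (e k) = 1" for k using onb by (simp add: orthonormal_basis_def)
  have e0: "e j \<bullet> e k = 0" if "j \<noteq> k" for j k
    using onb that injD[OF e_inj] by (fastforce simp: orthonormal_basis_def pairwise_def orthogonal_def)
  have Re: "R (e k) = sqrt (lam k) *\<^sub>R e k" for k
    using R(3) Qe lam by (intro positive_sqrt_eigenvector R) (metis comp_apply, simp)
  define T where "T = inv R \<circ> K"
  have T: "bounded_linear T" and "\<exists>E. orthonormal_basis E \<and> (\<lambda>x. (norm (T x))\<^sup>2) summable_on E"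
    using C by (simp_all add: condition_C_def hilbert_schmidt_def T_def R_def)
  then obtain E where E: "orthonormal_basis E" "(\<lambda>x. (norm (T x))\<^sup>2) summable_on E" by blast
  have RT: "R (T x) = K x" for x
  proof -
    have "K x \<in> range R" using C by (auto simp: condition_C_def R_def)
    then show ?thesis unfolding T_def comp_apply by (rule f_inv_into_f)
  qed
  have "bounded_linear (\<lambda>x. R (T x))"
    using R(1) by (intro bounded_linear_compose[OF _ T]) (simp add: self_adjoint_def)
  then have K: "bounded_linear K" by (simp add: RT)
  interpret K: bounded_linear K by (rule K)
  define t where "t k = adjoint T (e k)" for k
  have Kt: "K x \<bullet> e k = sqrt (lam k) * (x \<bullet> t k)" for x k
  proof -
    have "K x \<bullet> e k = T x \<bullet> R (e k)" by (simp only: RT[symmetric] Rsym)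
    then show ?thesis by (simp add: Re adjoint_inner[OF T] t_def)
  qed
  have adjK: "adjoint K (e k) = sqrt (lam k) *\<^sub>R t k" for k
  proof -
    have "x \<bullet> adjoint K (e k) = x \<bullet> (sqrt (lam k) *\<^sub>R t k)" for x
      using adjoint_inner[OF K, of x "e k"] Kt[of x k] by simp
    then show ?thesis by (metis vector_eq_ldot)
  qed
  \<comment> \<open>Diagonality of \<open>K\<close> composed with its adjoint enters here: the
    matrix entry at \<open>e j\<close> and \<open>e k\<close> is \<open>t j \<bullet> t k\<close>
    times a positive factor.\<close>
  have t_orth: "t j \<bullet> t k = 0" if "j \<noteq> k" for j k
  proof -
    obtain c where "K (adjoint K (e j)) = c *\<^sub>R e j" using C unfolding condition_C_def by blast
    then have "K (adjoint K (e j)) \<bullet> e k = 0" using e0[OF that] by simp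
    then have "sqrt (lam k) * (sqrt (lam j) * (t j \<bullet> t k)) = 0" by (simp add: Kt adjK)
    then show ?thesis using lam[of j] lam[of k] by simp
  qed
  define H where "H = (\<Sum>\<^sub>\<infinity>x\<in>E. (norm (T x))\<^sup>2)"
  have H0: "0 \<le> H" unfolding H_def by (rule infsum_nonneg) simp
  have t_sum: "(\<Sum>k<n. (norm (t k))\<^sup>2) \<le> H" for n
    unfolding H_def t_def by (rule hilbert_schmidt_adjoint_sum_le[OF T E e_inj e1 e0])
  show ?thesis
  proof (rule condition_AI[OF _ _ lam])
    \<comment> \<open>The summand 1 keeps the constant positive when \<open>H = 0\<close>.\<close>
    show "0 < sqrt H + 1" using H0 by (simp add: add_nonneg_pos)
    fix x1 x2 :: 'a and n
    define x where "x = x1 - x2"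
    define \<sigma> where "\<sigma> k = sgn (x \<bullet> t k)" for k
    define w where "w = (\<Sum>k<n. \<sigma> k *\<^sub>R t k)"
    have "(norm w)\<^sup>2 = (\<Sum>k<n. (norm (\<sigma> k *\<^sub>R t k))\<^sup>2)"
      unfolding w_def by (rule norm_sum_Pythagorean) (auto simp: pairwise_def orthogonal_def t_orth)
    also have "\<dots> \<le> (\<Sum>k<n. (norm (t k))\<^sup>2)"
      by (intro sum_mono power_mono) (auto simp: \<sigma>_def abs_sgn_eq)
    also have "\<dots> \<le> H" by (rule t_sum)
    finally have "norm w \<le> sqrt H" by (rule real_le_rsqrt)
    have "(\<Sum>k<n. \<bar>(K x1 - K x2) \<bullet> e k\<bar> / sqrt (lam k)) = (\<Sum>k<n. \<bar>x \<bullet> t k\<bar>)"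
    proof (intro sum.cong refl)
      fix k
      have "(K x1 - K x2) \<bullet> e k = sqrt (lam k) * (x \<bullet> t k)" by (simp add: K.diff[symmetric] Kt x_def)
      then show "\<bar>(K x1 - K x2) \<bullet> e k\<bar> / sqrt (lam k) = \<bar>x \<bullet> t k\<bar>"
        using lam[of k] by (simp add: abs_mult)
    qed
    also have "\<dots> = x \<bullet> w" by (simp add: w_def \<sigma>_def inner_sum_right abs_sgn mult.commute)
    also have "\<dots> \<le> norm x * norm w" by (rule norm_cauchy_schwarz)
    also have "\<dots> \<le> norm x * (sqrt H + 1)" using \<open>norm w \<le> sqrt H\<close> by (intro mult_left_mono) auto
    finally show "(\<Sum>k<n. \<bar>(K x1 - K x2) \<bullet> e k\<bar> / sqrt (lam k)) \<le> (sqrt H + 1) * norm (x1 - x2)"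
      by (simp add: x_def mult.commute)
  qed
qed

text \<open>In a difference of potentials the reverse triangle inequality removes \<open>y\<close>
  and bounds the terms by those of condition (A).\<close>

lemma potential_lipschitz:
  assumes A: "condition_A lam e F" and sm: "\<And>u. summable (potential_term lam e F y u)"
    and lam: "\<And>k. 0 < lam k"
  shows "\<exists>L\<ge>0. \<forall>u v. \<bar>potential lam e F y u - potential lam e F y v\<bar> \<le> L * norm (u - v)"
proof -
  from A obtain C where C: "0 < C"
    and sC: "\<And>x1 x2. summable (\<lambda>k. \<bar>(F x1 - F x2) \<bullet> e k\<bar> / sqrt (lam k))"
    and bC: "\<And>x1 x2. (\<Sum>k. \<bar>(F x1 - F x2) \<bullet> e k\<bar> / sqrt (lam k)) \<le> C * norm (x1 - x2)"
    unfolding condition_A_def by blast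
  have "\<bar>potential lam e F y u - potential lam e F y v\<bar> \<le> (sqrt 2 * C) * norm (u - v)" for u v
  proof -
    let ?d = "\<lambda>k. potential_term lam e F y u k - potential_term lam e F y v k"
    have le: "norm (?d k) \<le> \<bar>(F u - F v) \<bullet> e k\<bar> / sqrt (lam k)" for k
    proof -
      have "\<bar>\<bar>(y - F u) \<bullet> e k\<bar> - \<bar>(y - F v) \<bullet> e k\<bar>\<bar> \<le> \<bar>(F u - F v) \<bullet> e k\<bar>"
        using abs_triangle_ineq3[of "(y - F u) \<bullet> e k" "(y - F v) \<bullet> e k"]
        by (simp add: inner_diff_left abs_minus_commute)
      then show ?thesis using lam[of k]
        by (simp add: potential_term_def diff_divide_distrib[symmetric] divide_right_mono)
    qed
    have "potential lam e F y u - potential lam e F y v = sqrt 2 * (\<Sum>k. ?d k)"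
      by (simp add: potential_def suminf_diff[OF sm sm, symmetric] right_diff_distrib)
    moreover have "\<bar>\<Sum>k. ?d k\<bar> \<le> C * norm (u - v)"
      using norm_suminf_le[OF le sC] bC[of u v] by simp
    ultimately show ?thesis by (simp add: abs_mult mult.assoc mult_left_mono)
  qed
  moreover have "0 \<le> sqrt 2 * C" using C by simp
  ultimately show ?thesis by blast
qed

section \<open>Strong modes\<close>

context nondegenerate_gaussian
begin

text \<open>The Lipschitz bound makes the density nearly constant on small balls, so the Gaussian
  ball estimates carry over to \<open>N\<close>. Both inclusions are expressed through the unique
  \<open>k\<close> with \<open>u = R k\<close>.\<close>

lemma strong_modes_eq_minimizers:
  fixes \<Phi> :: "'a \<Rightarrow> real"
  assumes "0 \<le> L" and lip: "\<And>u v. \<bar>\<Phi> u - \<Phi> v\<bar> \<le> L * norm (u - v)"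
    and "0 < Z" and N: "N = density M (\<lambda>u. ennreal (1 / Z * exp (- \<Phi> u)))" and prob_N: "prob_space N"
  shows "{u. strong_mode N u}
    = {u. is_arg_min (\<lambda>u. \<Phi> u + 1 / 2 * (norm (inv R u))\<^sup>2) (\<lambda>v. v \<in> range R) u}"
proof -
  interpret N: prob_space N by fact
  interpret R: bounded_linear R by (rule bounded_linear_R)
  have "L-lipschitz_on UNIV \<Phi>"
    using lip \<open>0 \<le> L\<close> by (intro lipschitz_onI) (auto simp: dist_norm)
  then have "continuous_on UNIV \<Phi>" by (rule lipschitz_on_continuous_on)
  then have [measurable]: "\<Phi> \<in> borel_measurable borel" by (rule borel_measurable_continuous_onI)
  define m where "m r = measure M (ball 0 r)" for r
  have m_pos: "0 < m r" if "0 < r" for r unfolding m_def by (rule measure_ball_0_pos[OF that])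
  have em: "emeasure N (ball z r) = (\<integral>\<^sup>+u. ennreal (1 / Z * exp (- \<Phi> u)) * indicator (ball z r) u \<partial>M)" for z r
    unfolding N by (subst emeasure_density) auto
  have const: "(\<integral>\<^sup>+u. ennreal c * indicator (ball z r) u \<partial>M) = ennreal (c * measure M (ball z r))"
    if "0 \<le> c" for c z r
    using that by (simp add: nn_integral_cmult_indicator emeasure_eq_measure ennreal_mult)
  have close: "\<Phi> z - L * r \<le> \<Phi> u" "\<Phi> u \<le> \<Phi> z + L * r" if "norm (z - u) \<le> r" for z u r
    using lip[of z u] mult_left_mono[OF that \<open>0 \<le> L\<close>] by linarith+
  have upper: "measure N (ball z r) \<le> (1 / Z * exp (- \<Phi> z + L * r)) * measure M (ball z r)" for z r
  proof -
    have "emeasure N (ball z r) \<le> (\<integral>\<^sup>+u. ennreal (1 / Z * exp (- \<Phi> z + L * r)) * indicator (ball z r) u \<partial>M)"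
      unfolding em
    proof (rule nn_integral_mono)
      fix u
      show "ennreal (1 / Z * exp (- \<Phi> u)) * indicator (ball z r) u
        \<le> ennreal (1 / Z * exp (- \<Phi> z + L * r)) * indicator (ball z r) u"
        using \<open>0 < Z\<close> close(1)[of z u r]
        by (cases "u \<in> ball z r") (auto simp: dist_norm intro!: ennreal_leI divide_right_mono)
    qed
    then show ?thesis using \<open>0 < Z\<close> by (subst (asm) const) (auto simp: N.emeasure_eq_measure)
  qed
  have lower: "(1 / Z * exp (- \<Phi> z - L * r)) * measure M (ball z r) \<le> measure N (ball z r)" for z r
  proof -
    have "(\<integral>\<^sup>+u. ennreal (1 / Z * exp (- \<Phi> z - L * r)) * indicator (ball z r) u \<partial>M) \<le> emeasure N (ball z r)"
      unfolding em
    proof (rule nn_integral_mono)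
      fix u
      show "ennreal (1 / Z * exp (- \<Phi> z - L * r)) * indicator (ball z r) u
        \<le> ennreal (1 / Z * exp (- \<Phi> u)) * indicator (ball z r) u"
        using \<open>0 < Z\<close> close(2)[of z u r]
        by (cases "u \<in> ball z r") (auto simp: dist_norm intro!: ennreal_leI divide_right_mono)
    qed
    then show ?thesis using \<open>0 < Z\<close> by (subst (asm) const) (auto simp: N.emeasure_eq_measure)
  qed
  \<comment> \<open>The objective pulled back along \<open>R\<close>, defined on the whole
    space.\<close>
  define J where "J k = \<Phi> (R k) + (norm k)\<^sup>2 / 2" for k
  have J_lower: "1 / Z * exp (- J k - L * r) * m r \<le> measure N (ball (R k) r)" if "0 < r" for k r
  proof -
    have "1 / Z * exp (- J k - L * r) * m r = (1 / Z * exp (- \<Phi> (R k) - L * r)) * (exp (- (norm k)\<^sup>2 / 2) * m r)"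
      by (simp add: J_def exp_add[symmetric])
    also have "\<dots> \<le> (1 / Z * exp (- \<Phi> (R k) - L * r)) * measure M (ball (R k) r)"
      unfolding m_def using \<open>0 < Z\<close> by (intro mult_left_mono measure_ball_range_R_ge that) auto
    also have "\<dots> \<le> measure N (ball (R k) r)" by (rule lower)
    finally show ?thesis .
  qed
  \<comment> \<open>One \<open>L * r\<close> replaces the density on the ball by its value at
    \<open>z\<close>, a second one moves from \<open>z\<close> to \<open>R k\<close>.\<close>
  have J_upper: "\<exists>k. norm (z - R k) \<le> r \<and> measure N (ball z r) \<le> 1 / Z * exp (- J k + 2 * L * r) * m r"
    if r: "0 < r" for z r
  proof -
    obtain k where k: "norm (z - R k) \<le> r" "measure M (ball z r) \<le> exp (- (norm k)\<^sup>2 / 2) * m r"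
      unfolding m_def using measure_ball_le[OF r] by blast
    have "measure N (ball z r) \<le> (1 / Z * exp (- \<Phi> z + L * r)) * measure M (ball z r)" by (rule upper)
    also have "\<dots> \<le> (1 / Z * exp (- \<Phi> (R k) + 2 * L * r)) * (exp (- (norm k)\<^sup>2 / 2) * m r)"
      using close(2)[OF k(1)] \<open>0 < Z\<close> k(2) by (intro mult_mono divide_right_mono) auto
    also have "\<dots> = 1 / Z * exp (- J k + 2 * L * r) * m r" by (simp add: J_def exp_add[symmetric])
    finally show ?thesis using k(1) by blast
  qed
  \<comment> \<open>Balls of radius 1 have \<open>N\<close>-measure at most 1, so
    \<open>J_lower\<close> prevents \<open>J\<close> from being arbitrarily negative and
    \<open>Js\<close> below is a genuine infimum.\<close>
  have J_bdd: "bdd_below (range J)"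
  proof (rule bdd_belowI2)
    fix k
    have "1 / Z * exp (- J k - L * 1) * m 1 \<le> 1"
      using J_lower[of 1 k] N.prob_le_1[of "ball (R k) 1"] by linarith
    then have "exp (- J k - L) \<le> Z / m 1" using m_pos[of 1] \<open>0 < Z\<close> by (simp add: field_simps)
    then have "- J k - L \<le> ln (Z / m 1)" using m_pos[of 1] \<open>0 < Z\<close> by (subst ln_ge_iff) auto
    then show "- L - ln (Z / m 1) \<le> J k" by linarith
  qed
  define Js where "Js = (INF k. J k)"
  have Js_le: "Js \<le> J k" for k unfolding Js_def using J_bdd by (intro cINF_lower) auto
  have Js_ge: "c \<le> Js" if "\<And>k. c \<le> J k" for c unfolding Js_def using that by (intro cINF_greatest) auto
  define P where "P r = (SUP z. measure N (ball z r))" for r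
  have P_bdd: "bdd_above (range (\<lambda>z. measure N (ball z r)))" for r by (rule bdd_aboveI2[of _ _ 1]) simp
  have le_P: "measure N (ball z r) \<le> P r" for z r unfolding P_def by (intro cSUP_upper P_bdd) auto
  have P_pos: "0 < P r" if "0 < r" for r
  proof -
    have "0 < 1 / Z * exp (- J 0 - L * r) * m r" using m_pos[OF that] \<open>0 < Z\<close> by simp
    then show ?thesis using J_lower[OF that, of 0] le_P[of "R 0" r] by linarith
  qed
  \<comment> \<open>The infimum need not be attained at this point; taking logarithms turns the
    bound for every \<open>J k\<close> into one for \<open>Js\<close>.\<close>
  have P_lower: "1 / Z * exp (- Js - L * r) * m r \<le> P r" if "0 < r" for r
  proof -
    define a where "a = 1 / Z * exp (- L * r) * m r"
    have a: "0 < a" using m_pos[OF that] \<open>0 < Z\<close> by (simp add: a_def)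
    have "- ln (P r / a) \<le> J k" for k
    proof -
      have "1 / Z * exp (- J k - L * r) * m r = exp (- J k) * a" by (simp add: a_def exp_diff exp_minus field_simps)
      then have "exp (- J k) * a \<le> P r" using J_lower[OF that, of k] le_P[of "R k" r] by linarith
      then have "exp (- J k) \<le> P r / a" using a by (simp add: pos_le_divide_eq)
      then have "- J k \<le> ln (P r / a)" using a P_pos[OF that] by (subst ln_ge_iff) auto
      then show ?thesis by linarith
    qed
    then have "- ln (P r / a) \<le> Js" by (rule Js_ge)
    then have "- Js \<le> ln (P r / a)" by linarith
    then have "exp (- Js) \<le> P r / a" using a P_pos[OF that] by (subst (asm) ln_ge_iff) auto
    then have "exp (- Js) * a \<le> P r" using a by (simp add: pos_le_divide_eq)
    moreover have "1 / Z * exp (- Js - L * r) * m r = exp (- Js) * a" by (simp add: a_def exp_diff exp_minus field_simps)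
    ultimately show ?thesis by linarith
  qed
  have P_upper: "P r \<le> 1 / Z * exp (- Js + 2 * L * r) * m r" if r: "0 < r" for r
    unfolding P_def
  proof (rule cSUP_least)
    fix z
    obtain k where "measure N (ball z r) \<le> 1 / Z * exp (- J k + 2 * L * r) * m r"
      using J_upper[OF r] by blast
    also have "\<dots> \<le> 1 / Z * exp (- Js + 2 * L * r) * m r"
      using Js_le[of k] m_pos[OF that] \<open>0 < Z\<close> by (intro mult_right_mono mult_left_mono) auto
    finally show "measure N (ball z r) \<le> 1 / Z * exp (- Js + 2 * L * r) * m r" .
  qed simp
  have pos_ev: "eventually (\<lambda>r. 0 < r) (at_right (0::real))" by (rule eventually_at_right_less)
  \<comment> \<open>The quotient lies between \<open>exp (- 3 * L * r)\<close> and 1, the exponent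
    combining the losses of \<open>J_lower\<close> and \<open>P_upper\<close>.\<close>
  have mode_if: "strong_mode N (R k)" if "J k \<le> Js" for k
    unfolding strong_mode_def P_def[symmetric]
  proof (rule tendsto_sandwich)
    have "((\<lambda>r. exp (- 3 * L * r)) \<longlongrightarrow> exp (- 3 * L * 0)) (at_right 0)" by (intro tendsto_intros)
    then show "((\<lambda>r. exp (- 3 * L * r)) \<longlongrightarrow> 1) (at_right 0)" by simp
    show "((\<lambda>_. 1) \<longlongrightarrow> (1::real)) (at_right (0::real))" by simp
    show "eventually (\<lambda>r. measure N (ball (R k) r) / P r \<le> 1) (at_right 0)"
      using pos_ev by eventually_elim (use le_P P_pos in \<open>simp add: divide_le_eq_1\<close>)
    show "eventually (\<lambda>r. exp (- 3 * L * r) \<le> measure N (ball (R k) r) / P r) (at_right 0)"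
      using pos_ev
    proof eventually_elim
      case (elim r)
      have "exp (- 3 * L * r) * P r \<le> exp (- 3 * L * r) * (1 / Z * exp (- Js + 2 * L * r) * m r)"
        by (intro mult_left_mono P_upper elim) auto
      also have "\<dots> = 1 / Z * (exp (- 3 * L * r) * exp (- Js + 2 * L * r)) * m r" by simp
      also have "exp (- 3 * L * r) * exp (- Js + 2 * L * r) = exp (- Js - L * r)"
        by (simp add: exp_add[symmetric])
      also have "1 / Z * exp (- Js - L * r) * m r \<le> 1 / Z * exp (- J k - L * r) * m r"
        using that m_pos[OF elim] \<open>0 < Z\<close> by (intro mult_right_mono mult_left_mono) auto
      also have "\<dots> \<le> measure N (ball (R k) r)" by (rule J_lower[OF elim])
      finally show ?case using P_pos[OF elim] by (simp add: pos_le_divide_eq)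
    qed
  qed
  have mode_imp: "\<exists>k. u = R k \<and> J k \<le> Js" if mode: "strong_mode N u" for u
  proof -
    define q where "q r = measure N (ball u r) / P r" for r
    have q: "(q \<longlongrightarrow> 1) (at_right 0)" using mode unfolding strong_mode_def q_def P_def .
    \<comment> \<open>The value that the squared norm of \<open>k\<close> has if
      \<open>R k = u\<close> and \<open>J k = Js\<close>.\<close>
    define b where "b = 2 * (Js - \<Phi> u)"
    \<comment> \<open>Comparing \<open>J_upper\<close> with \<open>P_lower\<close> costs
      \<open>3 * L * r\<close>, replacing \<open>\<Phi> (R k)\<close> by \<open>\<Phi> u\<close>
      another \<open>L * r\<close>; doubling gives the 8.\<close>
    have step: "\<exists>k. norm (u - R k) \<le> r \<and> (norm k)\<^sup>2 \<le> b + (8 * L * r - 2 * ln (q r))"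
      if r: "0 < r" "0 < q r" for r
    proof -
      obtain k where k: "norm (u - R k) \<le> r" "measure N (ball u r) \<le> 1 / Z * exp (- J k + 2 * L * r) * m r"
        using J_upper[OF r(1), of u] by blast
      have "q r * (1 / Z * exp (- Js - L * r) * m r) \<le> q r * P r"
        using r by (intro mult_left_mono P_lower) auto
      also have "\<dots> = measure N (ball u r)" using P_pos[OF r(1)] by (simp add: q_def)
      also have "\<dots> \<le> 1 / Z * exp (- J k + 2 * L * r) * m r" by (rule k(2))
      finally have "(q r * exp (- Js - L * r)) * (m r / Z) \<le> exp (- J k + 2 * L * r) * (m r / Z)"
        by (simp add: mult_ac)
      then have "q r * exp (- Js - L * r) \<le> exp (- J k + 2 * L * r)"
        using m_pos[OF r(1)] \<open>0 < Z\<close> by (subst (asm) mult_le_cancel_right_pos) auto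
      then have "exp (ln (q r) + (- Js - L * r)) \<le> exp (- J k + 2 * L * r)"
        using r by (simp add: exp_add)
      then have "ln (q r) + (- Js - L * r) \<le> - J k + 2 * L * r" by simp
      then have "(norm k)\<^sup>2 \<le> b + (8 * L * r - 2 * ln (q r))"
        using close(1)[OF k(1)] unfolding J_def b_def by (simp add: algebra_simps)
      then show ?thesis using k(1) by blast
    qed
    \<comment> \<open>A point common to these closed convex sets satisfies \<open>R k = u\<close>
      and has squared norm at most \<open>b\<close>.\<close>
    define C where "C n = {k. norm (u - R k) \<le> 1 / Suc n} \<inter> cball 0 (sqrt (b + 1 / Suc n))" for n
    have ne: "\<exists>k. k \<in> C n \<and> (norm k)\<^sup>2 \<le> b + 1 / Suc n" for n
    proof -
      have "((\<lambda>r. 8 * L * r - 2 * ln (q r)) \<longlongrightarrow> 8 * L * 0 - 2 * ln 1) (at_right 0)"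
        by (intro tendsto_intros q) auto
      then have "eventually (\<lambda>r. 8 * L * r - 2 * ln (q r) < 1 / Suc n) (at_right 0)"
        by (rule order_tendstoD) simp
      moreover have "eventually (\<lambda>r. 0 < q r) (at_right 0)" by (rule order_tendstoD(1)[OF q]) simp
      moreover have "eventually (\<lambda>r. r < 1 / Suc n) (at_right 0)"
        by (rule order_tendstoD(2)[OF tendsto_ident_at]) simp
      ultimately have "eventually (\<lambda>r. 0 < r \<and> r < 1 / Suc n \<and> 0 < q r \<and> 8 * L * r - 2 * ln (q r) < 1 / Suc n) (at_right 0)"
        using pos_ev by eventually_elim auto
      then obtain r where r: "0 < r" "r < 1 / Suc n" "0 < q r" "8 * L * r - 2 * ln (q r) < 1 / Suc n"
        using eventually_happens[of _ "at_right (0::real)"] by (auto simp: trivial_limit_at_right_real)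
      obtain k where k: "norm (u - R k) \<le> r" "(norm k)\<^sup>2 \<le> b + (8 * L * r - 2 * ln (q r))"
        using step[OF r(1,3)] by blast
      have "(norm k)\<^sup>2 \<le> b + 1 / Suc n" using k(2) r(4) by linarith
      moreover have "norm k \<le> sqrt (b + 1 / Suc n)" by (rule real_le_rsqrt) fact
      ultimately show ?thesis using k(1) r(2) by (intro exI[of _ k]) (auto simp: C_def)
    qed
    \<comment> \<open>This allows the square root in \<open>C n\<close> to be squared back.\<close>
    have nonneg: "0 \<le> b + 1 / Suc n" for n
      using ne[of n] zero_le_power2 order_trans by blast
    have mono: "1 / real (Suc n) \<le> 1 / Suc n'" if "n' \<le> n" for n n' using that by (simp add: field_simps)
    have "\<exists>k. \<forall>n. k \<in> C n"
    proof (rule nested_convex_inter_nonempty)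
      show "closed (C n)" for n
        unfolding C_def by (intro closed_Int closed_Collect_le continuous_intros R.continuous_on closed_cball)
      have "{k. norm (u - R k) \<le> 1 / Suc n} = R -` cball u (1 / Suc n)" for n by (auto simp: dist_norm)
      then show "convex (C n)" for n
        unfolding C_def by (simp add: convex_Int convex_linear_vimage R.linear_axioms)
      show "C n \<subseteq> C n'" if "n' \<le> n" for n n'
      proof
        fix k assume "k \<in> C n"
        then have k: "norm (u - R k) \<le> 1 / Suc n" "norm k \<le> sqrt (b + 1 / Suc n)" by (auto simp: C_def)
        have "norm (u - R k) \<le> 1 / Suc n'" using k(1) mono[OF that] by linarith
        moreover have "sqrt (b + 1 / Suc n) \<le> sqrt (b + 1 / Suc n')" using mono[OF that] by simp
        then have "norm k \<le> sqrt (b + 1 / Suc n')" using k(2) by linarith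
        ultimately show "k \<in> C n'" by (simp add: C_def)
      qed
      show "C n \<inter> cball 0 (sqrt (b + 1)) \<noteq> {}" for n
      proof -
        obtain k where k: "k \<in> C n" "(norm k)\<^sup>2 \<le> b + 1 / Suc n" using ne by blast
        have "1 / real (Suc n) \<le> 1" using mono[of 0 n] by simp
        then have "(norm k)\<^sup>2 \<le> b + 1" using k(2) by linarith
        then have "norm k \<le> sqrt (b + 1)" by (rule real_le_rsqrt)
        then show ?thesis using k(1) by auto
      qed
    qed
    then obtain k where k: "\<And>n. k \<in> C n" by blast
    have small: "norm (u - R k) \<le> 1 / Suc n" "(norm k)\<^sup>2 \<le> b + 1 / Suc n" for n
    proof -
      show "norm (u - R k) \<le> 1 / Suc n" using k[of n] by (simp add: C_def)
      have "norm k \<le> sqrt (b + 1 / Suc n)" using k[of n] by (simp add: C_def)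
      then have "(norm k)\<^sup>2 \<le> (sqrt (b + 1 / Suc n))\<^sup>2" by (intro power_mono) auto
      then show "(norm k)\<^sup>2 \<le> b + 1 / Suc n" using nonneg[of n] by simp
    qed
    have approx: "x \<le> 0" if "\<And>n. x \<le> 1 / Suc n" for x :: real
      by (rule LIMSEQ_le_const[OF LIMSEQ_Suc[OF lim_1_over_n]]) (use that in auto)
    have "norm (u - R k) \<le> 0" using small(1) by (rule approx)
    then have u: "u = R k" by simp
    have "(norm k)\<^sup>2 - b \<le> 0"
    proof (rule approx)
      fix n show "(norm k)\<^sup>2 - b \<le> 1 / Suc n" using small(2)[of n] by linarith
    qed
    then have "J k \<le> Js" by (simp add: J_def b_def u)
    then show ?thesis using u by blast
  qed
  have inv_R: "inv R (R k) = k" for k using R_props(4) by simp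
  have arg_min: "is_arg_min (\<lambda>u. \<Phi> u + 1 / 2 * (norm (inv R u))\<^sup>2) (\<lambda>v. v \<in> range R) u \<longleftrightarrow> (\<exists>k. u = R k \<and> J k \<le> Js)" for u
  proof
    assume "is_arg_min (\<lambda>u. \<Phi> u + 1 / 2 * (norm (inv R u))\<^sup>2) (\<lambda>v. v \<in> range R) u"
    then obtain k where k: "u = R k" and min: "\<And>l. \<not> J l < J k"
      unfolding is_arg_min_def J_def by (auto simp: inv_R)
    have "J k \<le> Js" using min by (intro Js_ge) (simp add: not_less)
    then show "\<exists>k. u = R k \<and> J k \<le> Js" using k by blast
  next
    assume "\<exists>k. u = R k \<and> J k \<le> Js"
    then obtain k where "u = R k" "J k \<le> Js" by blast
    then show "is_arg_min (\<lambda>u. \<Phi> u + 1 / 2 * (norm (inv R u))\<^sup>2) (\<lambda>v. v \<in> range R) u"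
      using order_trans[OF _ Js_le] unfolding is_arg_min_def J_def by (force simp: inv_R not_less)
  qed
  show ?thesis
    unfolding arg_min using mode_if mode_imp by auto
qed

end

theorem theorem3p14:
  fixes Q :: "'b \<Rightarrow> 'b::{real_inner, complete_space, second_countable_topology}"
    and lam :: "nat \<Rightarrow> real" and e :: "nat \<Rightarrow> 'b" and y :: 'b
    and F :: "'a::{real_inner, complete_space, second_countable_topology} \<Rightarrow> 'b"
    and \<mu>0 \<mu>y :: "'a measure" and S :: "'a \<Rightarrow> 'a" and Z :: real
  assumes "inj Q" and "self_adjoint Q" and "positive_op Q" and "trace_class Q"
    and "eigensystem Q lam e"
    and "condition_A lam e F \<or> condition_B lam e F \<or> condition_C Q e F"
    and "\<And>u. summable (potential_term lam e F y u)"
    and "gaussian_measure \<mu>0" and "centered \<mu>0"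
    and "covariance_operator \<mu>0 S" and "inj S"
    and "Z > 0"
    and "prob_space \<mu>y"
    and "\<mu>y = density \<mu>0 (\<lambda>u. ennreal (1 / Z * exp (- potential lam e F y u)))"
  shows "{u. strong_mode \<mu>y u} =
         {u. is_arg_min (objective lam e F y S) (\<lambda>v. v \<in> range (op_sqrt S)) u}"
proof -
  have lam: "\<And>k. 0 < lam k" using \<open>eigensystem Q lam e\<close> by (simp add: eigensystem_def)
  have "condition_A lam e F"
    using \<open>condition_A lam e F \<or> condition_B lam e F \<or> condition_C Q e F\<close>
  proof (elim disjE)
    assume "condition_B lam e F"
    then show ?thesis using lam by (rule condition_B_imp_A)
  next
    assume "condition_C Q e F"
    then show ?thesis
      using \<open>self_adjoint Q\<close> \<open>positive_op Q\<close> \<open>eigensystem Q lam e\<close> by (rule condition_C_imp_A)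
  qed
  then obtain L where L: "0 \<le> L"
    "\<And>u v. \<bar>potential lam e F y u - potential lam e F y v\<bar> \<le> L * norm (u - v)"
    using potential_lipschitz[OF _ assms(7) lam] by blast
  interpret nondegenerate_gaussian \<mu>0 S
    by unfold_locales fact+
  have "objective lam e F y S = (\<lambda>u. potential lam e F y u + 1 / 2 * (norm (inv R u))\<^sup>2)"
    by (simp add: fun_eq_iff objective_def potential_def R_def)
  then show ?thesis
    using strong_modes_eq_minimizers[OF L \<open>0 < Z\<close> assms(14,13)] by (simp only: R_def)
qed

end
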